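(* Let $\mathcal{G}=(X,Y,A,B,\lambda)$ be a mirror game and let $p\in\mathcal{C}_{\rm ns}(\lambda)$. The following are equivalent: (i) $p\in\mathcal{C}_{\rm qa}(\lambda)$; (ii) there exist an amenable trace $\tau:\mathcal{A}(X,A)\to\mathbb{C}$ and a unital *-homomorphism $\rho:\mathcal{A}(Y,B)\to\mathcal{A}(X,A)$ with $\rho(\mathcal{S}_{Y,B})\subseteq\mathcal{S}_{X,A}$ such that $$p(a,b|x,y)=\tau(e_{x,a}\rho(f_{y,b})),\quad x\in X,\ y\in Y,\ a\in A,\ b\in B.$$
   Context: $X,Y,A,B$ are finite non-empty sets. A non-signalling game is a tuple $(X,Y,A,B,\lambda)$ with $\lambda:X\times Y\times A\times B\to\{0,1\}$. It is a mirror game if there exist functions $\xi:X\to Y$ and $\eta:Y\to X$ such that $\lambda(x,\xi(x),a,b)\lambda(x,\xi(x),a',b)=0$ for all $x\in X$, $b\in B$, $a,a'\in A$ with $a\ne a'$, and $\lambda(\eta(y),y,a,b)\lambda(\eta(y),y,a,b')=0$ for all $y\in Y$, $a\in A$, $b,b'\in B$ with $b\neq b'$. $\mathcal{A}(X,A)$ is the unital C*-algebra free product, amalgamated over the unit, of $|X|$ copies of $\ell^\infty(A)$, indexed by $X$; $(e_{x,a})_{a\in A}$ is the canonical basis of the $x$-th copy; $\mathcal{S}_{X,A}={\rm span}\{e_{x,a}:x\in X,a\in A\}\subseteq\mathcal{A}(X,A)$. The corresponding generators of $\mathcal{A}(Y,B)$ are denoted $f_{y,b}$, with span $\mathcal{S}_{Y,B}$.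 A trace on a C*-algebra $\mathcal{A}$ is a positive linear functional $\tau$ with $\tau(zw)=\tau(wz)$ for all $z,w$. The opposite C*-algebra $\mathcal{A}^{\rm op}$ is the same involutive normed space, with elements written $a^{\rm op}$ and product $a^{\rm op}b^{\rm op}=(ba)^{\rm op}$. A trace $\tau$ on $\mathcal{A}$ is amenable if the linear functional $\phi$ on the algebraic tensor product $\mathcal{A}\otimes\mathcal{A}^{\rm op}$ given by $\phi(a\otimes b^{\rm op})=\tau(ab)$ is bounded with respect to the minimal C*-tensor norm. $\mathcal{C}_{\rm ns}\subseteq\mathbb{R}^{X\times Y\times A\times B}$ is the set of non-signalling correlations, i.e. families $p=\{p(a,b|x,y)\}$ such that each $p(\cdot,\cdot|x,y)$ is a probability distribution on $A\times B$, $\sum_{b}p(a,b|x,y)=\sum_b p(a,b|x,y')$ for all $x,y,y',a$, and $\sum_a p(a,b|x,y)=\sum_a p(a,b|x',y)$ for all $x,x',y,b$. A PVM is a finite tuple of projections on a Hilbert space summing to the identity. $\mathcal{C}_{\rm q}$ is the set of correlations $p(a,b|x,y)=\langle\zeta|P_{x,a}\otimes Q_{y,b}|\zeta\rangle$ with $\mathcal{H}$ a finite-dimensional Hilbert space, $\zeta\in\mathcal{H}\otimes\mathcal{H}$ a unit vector, $(P_{x,a})_{a\in A}$, $(Q_{y,b})_{b\in B}$ PVMs on $\mathcal{H}$ for all $x,y$; $\mathcal{C}_{\rm qa}$ is the closure of $\mathcal{C}_{\rm q}$. For ${\rm x}\in\{{\rm ns},{\rm qa}\}$, $\mathcal{C}_{\rm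 x}(\lambda)=\{p\in\mathcal{C}_{\rm x}:\lambda(x,y,a,b)=0\Rightarrow p(a,b|x,y)=0\}$. *)

theory Defs
  imports
    "HOL-Analysis.Analysis"
    "HOL-Library.Poly_Mapping"
    "Jordan_Normal_Form.Schur_Decomposition"
begin

section \<open>Unital C*-algebras\<close>

class scaleC = scaleR +
  fixes scaleC :: "complex \<Rightarrow> 'a \<Rightarrow> 'a" (infixr "*\<^sub>C" 75)

class complex_vector = scaleC + ab_group_add +
  assumes scaleC_add_right: "c *\<^sub>C (x + y) = c *\<^sub>C x + c *\<^sub>C y"
    and scaleC_add_left: "(c + d) *\<^sub>C x = c *\<^sub>C x + d *\<^sub>C x"
    and scaleC_scaleC: "c *\<^sub>C d *\<^sub>C x = (c * d) *\<^sub>C x"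
    and scaleC_one: "1 *\<^sub>C x = x"
    and scaleR_scaleC: "r *\<^sub>R x = complex_of_real r *\<^sub>C x"

subclass (in complex_vector) real_vector
  by standard (simp_all add: scaleR_scaleC scaleC_add_right scaleC_add_left scaleC_scaleC scaleC_one)

global_interpretation complex_vector: vector_space "scaleC :: complex \<Rightarrow> 'a::complex_vector \<Rightarrow> 'a"
  defines cspan = complex_vector.span
  by standard (simp_all add: scaleC_add_right scaleC_add_left scaleC_scaleC scaleC_one)

class complex_normed_vector = complex_vector + real_normed_vector +
  assumes norm_scaleC: "norm (c *\<^sub>C x) = cmod c * norm x"

class star =
  fixes star :: "'a \<Rightarrow> 'a"

class cstar_algebra = complex_normed_vector + complete_space + ring_1 + zero_neq_one + star +
  assumes mult_scaleC_left: "c *\<^sub>C x * y = c *\<^sub>C (x * y)"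
    and mult_scaleC_right: "x * c *\<^sub>C y = c *\<^sub>C (x * y)"
    and star_star: "star (star x) = x"
    and star_add: "star (x + y) = star x + star y"
    and star_scaleC: "star (c *\<^sub>C x) = cnj c *\<^sub>C star x"
    and star_mult: "star (x * y) = star y * star x"
    and norm_mult_le: "norm (x * y) \<le> norm x * norm y"
    and norm_star_mult: "norm (star x * x) = (norm x)\<^sup>2"

lemma star_one: "star 1 = (1 :: 'a::cstar_algebra)"
  by (metis mult.right_neutral star_mult star_star)

lemma norm_one_eq: "norm (1 :: 'a::cstar_algebra) = 1"
proof -
  have "norm (1 :: 'a) = (norm (1 :: 'a))\<^sup>2"
    using norm_star_mult[of "1 :: 'a"] by (simp add: star_one)
  moreover have "norm (1 :: 'a) \<noteq> 0" by simp
  ultimately show ?thesis by (metis mult_cancel_left2 power2_eq_square)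
qed

instance cstar_algebra \<subseteq> real_normed_algebra_1
  by standard
    (simp_all add: scaleR_scaleC mult_scaleC_left mult_scaleC_right norm_mult_le norm_one_eq)

instance cstar_algebra \<subseteq> banach ..

instantiation complex :: cstar_algebra
begin

definition "scaleC_complex = (times :: complex \<Rightarrow> complex \<Rightarrow> complex)"
definition "star_complex = cnj"

instance
  by standard (simp_all add: scaleC_complex_def star_complex_def algebra_simps scaleR_conv_of_real
      norm_mult norm_triangle_ineq power2_eq_square)

end

definition clinear :: "('a::complex_vector \<Rightarrow> 'b::complex_vector) \<Rightarrow> bool" where
  "clinear f \<longleftrightarrow> (\<forall>x y. f (x + y) = f x + f y) \<and> (\<forall>c x. f (c *\<^sub>C x) = c *\<^sub>C f x)"

definition bounded_clinear ::
    "('a::complex_normed_vector \<Rightarrow> 'b::complex_normed_vector) \<Rightarrow> bool" where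
  "bounded_clinear f \<longleftrightarrow> clinear f \<and> (\<exists>K. \<forall>x. norm (f x) \<le> norm x * K)"

definition unital_star_hom :: "('a::cstar_algebra \<Rightarrow> 'b::cstar_algebra) \<Rightarrow> bool" where
  "unital_star_hom h \<longleftrightarrow> clinear h \<and> (\<forall>x y. h (x * y) = h x * h y) \<and>
     (\<forall>x. h (star x) = star (h x)) \<and> h 1 = 1"


section \<open>The opposite C*-algebra\<close>

typedef 'a opposite = "UNIV :: 'a set" morphisms unop opp
  by simp

setup_lifting type_definition_opposite

instantiation opposite :: (complex_vector) complex_vector
begin

lift_definition zero_opposite :: "'a opposite" is 0 .
lift_definition plus_opposite :: "'a opposite \<Rightarrow> 'a opposite \<Rightarrow> 'a opposite" is "(+)" .
lift_definition minus_opposite :: "'a opposite \<Rightarrow> 'a opposite \<Rightarrow> 'a opposite" is "(-)" .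
lift_definition uminus_opposite :: "'a opposite \<Rightarrow> 'a opposite" is uminus .
lift_definition scaleC_opposite :: "complex \<Rightarrow> 'a opposite \<Rightarrow> 'a opposite" is scaleC .
lift_definition scaleR_opposite :: "real \<Rightarrow> 'a opposite \<Rightarrow> 'a opposite" is "(*\<^sub>R)" .

instance
  by standard (transfer; simp add: scaleC_add_right scaleC_add_left scaleC_scaleC scaleC_one
      scaleR_scaleC algebra_simps)+

end

instantiation opposite :: (complex_normed_vector) complex_normed_vector
begin

lift_definition norm_opposite :: "'a opposite \<Rightarrow> real" is norm .
definition "dist_opposite x y = norm (x - y :: 'a opposite)"
definition "sgn_opposite x = inverse (norm x) *\<^sub>R (x :: 'a opposite)"
definition "(uniformity :: ('a opposite \<times> 'a opposite) filter) =
  (INF e\<in>{0<..}. principal {(x, y). dist x y < e})"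
definition "open (U :: 'a opposite set) \<longleftrightarrow>
  (\<forall>x\<in>U. eventually (\<lambda>(x', y). x' = x \<longrightarrow> y \<in> U) uniformity)"

instance
proof
  fix x y :: "'a opposite" and c :: complex
  show "norm x = 0 \<longleftrightarrow> x = 0" by transfer simp
  show "norm (x + y) \<le> norm x + norm y" by transfer (rule norm_triangle_ineq)
  show "norm (c *\<^sub>C x) = cmod c * norm x" by transfer (rule norm_scaleC)
  show "norm (r *\<^sub>R x) = \<bar>r\<bar> * norm x" for r by transfer simp
qed (simp_all add: dist_opposite_def sgn_opposite_def uniformity_opposite_def open_opposite_def)

end

instantiation opposite :: (cstar_algebra) cstar_algebra
begin

lift_definition one_opposite :: "'a opposite" is 1 .
lift_definition times_opposite :: "'a opposite \<Rightarrow> 'a opposite \<Rightarrow> 'a opposite" is "\<lambda>x y. y * x" .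
lift_definition star_opposite :: "'a opposite \<Rightarrow> 'a opposite" is star .

lemma norm_star_eq: "norm (star x) = norm (x :: 'a)"
proof -
  have le: "norm y \<le> norm (star y)" for y :: 'a
  proof (cases "norm y = 0")
    case False
    have "norm y * norm y \<le> norm (star y) * norm y"
      using norm_star_mult[of y] norm_mult_le[of "star y" y] by (simp add: power2_eq_square)
    then show ?thesis using False by (simp add: mult_le_cancel_right)
  qed simp
  show ?thesis using le[of x] le[of "star x"] by (simp add: star_star)
qed

instance
proof
  fix X :: "nat \<Rightarrow> 'a opposite"
  assume "Cauchy X"
  have d: "dist (unop x) (unop y) = dist x y" for x y :: "'a opposite"
    unfolding dist_opposite_def dist_norm by transfer simp
  have "Cauchy (\<lambda>n. unop (X n))"
    using \<open>Cauchy X\<close> unfolding Cauchy_def d .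
  then obtain l where "(\<lambda>n. unop (X n)) \<longlonglongrightarrow> l"
    using Cauchy_convergent convergent_def by blast
  moreover have "dist (unop (X n)) l = dist (X n) (opp l)" for n
    by (metis d opp_inverse UNIV_I)
  ultimately have "X \<longlonglongrightarrow> opp l"
    unfolding tendsto_iff by simp
  then show "convergent X" by (auto simp: convergent_def)
next
  fix x y z :: "'a opposite" and c :: complex
  show "norm (star x * x) = (norm x)\<^sup>2"
    by transfer (metis norm_star_eq norm_star_mult star_star)
  show "norm (x * y) \<le> norm x * norm y"
    by transfer (metis norm_mult_le mult.commute)
qed (transfer; simp add: mult_scaleC_left mult_scaleC_right star_star star_add star_scaleC star_mult
      mult.assoc distrib_left distrib_right)+

end


section \<open>The Hilbert spaces \<open>\<ell>\<^sup>2(I)\<close>\<close>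

typedef 'i ell2 = "{f :: 'i \<Rightarrow> complex. (\<lambda>i. (cmod (f i))\<^sup>2) summable_on UNIV}"
  morphisms coord Abs_ell2
  by (rule exI[of _ "\<lambda>_. 0"]) simp

setup_lifting type_definition_ell2

lemma square_summable_scale:
  assumes "(\<lambda>i. (cmod (f i))\<^sup>2) summable_on UNIV"
  shows "(\<lambda>i. (cmod (c * f i))\<^sup>2) summable_on UNIV"
  using summable_on_cmult_right[OF assms, of "(cmod c)\<^sup>2"] by (simp add: norm_mult power_mult_distrib)

lemma square_summable_triangle:
  assumes f: "(\<lambda>i. (cmod (f i))\<^sup>2) summable_on UNIV" and g: "(\<lambda>i. (cmod (g i))\<^sup>2) summable_on UNIV"
  shows "(\<lambda>i. (cmod (f i + g i))\<^sup>2) summable_on UNIV"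
    and "sqrt (\<Sum>\<^sub>\<infinity>i. (cmod (f i + g i))\<^sup>2) \<le> sqrt (\<Sum>\<^sub>\<infinity>i. (cmod (f i))\<^sup>2) + sqrt (\<Sum>\<^sub>\<infinity>i. (cmod (g i))\<^sup>2)"
proof -
  define K where "K = sqrt (\<Sum>\<^sub>\<infinity>i. (cmod (f i))\<^sup>2) + sqrt (\<Sum>\<^sub>\<infinity>i. (cmod (g i))\<^sup>2)"
  have K0: "K \<ge> 0" by (simp add: K_def infsum_nonneg)
  have fin: "(\<Sum>i\<in>F. (cmod (f i + g i))\<^sup>2) \<le> K\<^sup>2" if "finite F" for F
  proof -
    have "sqrt (\<Sum>i\<in>F. (cmod (f i + g i))\<^sup>2) \<le> L2_set (\<lambda>i. cmod (f i) + cmod (g i)) F"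
      unfolding L2_set_def by (intro real_sqrt_le_mono sum_mono power_mono norm_triangle_ineq) simp
    also have "\<dots> \<le> L2_set (\<lambda>i. cmod (f i)) F + L2_set (\<lambda>i. cmod (g i)) F"
      by (rule L2_set_triangle_ineq)
    also have "\<dots> \<le> K"
      unfolding L2_set_def K_def
      by (intro add_mono real_sqrt_le_mono finite_sum_le_infsum f g that) auto
    finally show ?thesis
      by (rule sqrt_le_D)
  qed
  show summ: "(\<lambda>i. (cmod (f i + g i))\<^sup>2) summable_on UNIV"
    by (rule nonneg_bdd_above_summable_on) (auto intro!: bdd_aboveI[of _ "K\<^sup>2"] fin)
  have "(\<Sum>\<^sub>\<infinity>i. (cmod (f i + g i))\<^sup>2) \<le> K\<^sup>2"
    by (rule infsum_le_finite_sums[OF summ]) (rule fin)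
  then show "sqrt (\<Sum>\<^sub>\<infinity>i. (cmod (f i + g i))\<^sup>2) \<le> sqrt (\<Sum>\<^sub>\<infinity>i. (cmod (f i))\<^sup>2) + sqrt (\<Sum>\<^sub>\<infinity>i. (cmod (g i))\<^sup>2)"
    unfolding K_def[symmetric] by (rule real_le_lsqrt[OF K0])
qed

instantiation ell2 :: (type) complex_vector
begin

lift_definition zero_ell2 :: "'a ell2" is "\<lambda>_. 0" by simp
lift_definition plus_ell2 :: "'a ell2 \<Rightarrow> 'a ell2 \<Rightarrow> 'a ell2" is "\<lambda>f g i. f i + g i"
  by (rule square_summable_triangle)
lift_definition scaleC_ell2 :: "complex \<Rightarrow> 'a ell2 \<Rightarrow> 'a ell2" is "\<lambda>c f i. c * f i"
  by (rule square_summable_scale)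
lift_definition uminus_ell2 :: "'a ell2 \<Rightarrow> 'a ell2" is "\<lambda>f i. - f i" by simp
definition minus_ell2 :: "'a ell2 \<Rightarrow> 'a ell2 \<Rightarrow> 'a ell2" where "minus_ell2 f g = f + - g"
definition scaleR_ell2 :: "real \<Rightarrow> 'a ell2 \<Rightarrow> 'a ell2" where "scaleR_ell2 r = scaleC (complex_of_real r)"

instance
  by standard (unfold minus_ell2_def scaleR_ell2_def, (transfer; simp add: algebra_simps)+)

end

instantiation ell2 :: (type) complex_normed_vector
begin

lift_definition norm_ell2 :: "'a ell2 \<Rightarrow> real" is "\<lambda>f. sqrt (\<Sum>\<^sub>\<infinity>i. (cmod (f i))\<^sup>2)" .
definition "dist_ell2 f g = norm (f - g :: 'a ell2)"
definition "sgn_ell2 f = inverse (norm f) *\<^sub>R (f :: 'a ell2)"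
definition "(uniformity :: ('a ell2 \<times> 'a ell2) filter) = (INF e\<in>{0<..}. principal {(x, y). dist x y < e})"
definition "open (U :: 'a ell2 set) \<longleftrightarrow> (\<forall>x\<in>U. eventually (\<lambda>(x', y). x' = x \<longrightarrow> y \<in> U) uniformity)"

instance
proof
  fix f g :: "'a ell2" and c :: complex
  show "norm f = 0 \<longleftrightarrow> f = 0"
    by transfer (auto intro!: ext dest: nonneg_infsum_le_0D[OF eq_refl])
  show "norm (f + g) \<le> norm f + norm g"
    by transfer (rule square_summable_triangle)
  show *: "norm (c *\<^sub>C f) = cmod c * norm f" for c
    by transfer (simp add: norm_mult power_mult_distrib infsum_cmult_right' real_sqrt_mult)
  show "norm (r *\<^sub>R f) = \<bar>r\<bar> * norm f" for r
    by (simp add: scaleR_ell2_def *)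
qed (simp_all add: dist_ell2_def sgn_ell2_def uniformity_ell2_def open_ell2_def)

end

lift_definition cinner :: "'i ell2 \<Rightarrow> 'i ell2 \<Rightarrow> complex" is "\<lambda>f g. \<Sum>\<^sub>\<infinity>i. cnj (f i) * g i" .

lift_definition ell2_tensor :: "'i ell2 \<Rightarrow> 'j ell2 \<Rightarrow> ('i \<times> 'j) ell2" is "\<lambda>f g (i, j). f i * g j"
proof -
  fix f :: "'i \<Rightarrow> complex" and g :: "'j \<Rightarrow> complex"
  assume f: "(\<lambda>i. (cmod (f i))\<^sup>2) summable_on UNIV" and g: "(\<lambda>i. (cmod (g i))\<^sup>2) summable_on UNIV"
  define A B where "A = (\<Sum>\<^sub>\<infinity>i. (cmod (f i))\<^sup>2)" and "B = (\<Sum>\<^sub>\<infinity>i. (cmod (g i))\<^sup>2)"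
  have "(\<Sum>(i, j)\<in>F. (cmod (f i * g j))\<^sup>2) \<le> A * B" if "finite F" for F
  proof -
    have "(\<Sum>(i, j)\<in>F. (cmod (f i * g j))\<^sup>2) \<le> (\<Sum>(i, j)\<in>fst ` F \<times> snd ` F. (cmod (f i * g j))\<^sup>2)"
      using that by (intro sum_mono2) (auto simp: subset_fst_snd)
    also have "\<dots> = (\<Sum>i\<in>fst ` F. (cmod (f i))\<^sup>2) * (\<Sum>j\<in>snd ` F. (cmod (g j))\<^sup>2)"
      by (simp add: sum_product sum.cartesian_product norm_mult power_mult_distrib)
    also have "\<dots> \<le> A * B"
      unfolding A_def B_def using that
      by (intro mult_mono finite_sum_le_infsum f g) (auto intro: sum_nonneg infsum_nonneg)
    finally show ?thesis .
  qed
  then show "(\<lambda>i. (cmod (case i of (i, j) \<Rightarrow> f i * g j))\<^sup>2) summable_on UNIV"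
    by (intro nonneg_bdd_above_summable_on) (auto intro!: bdd_aboveI[of _ "A * B"] simp: case_prod_unfold)
qed


section \<open>The minimal tensor norm and amenable traces\<close>

definition bilinear_form :: "('a::complex_vector \<Rightarrow> 'b::complex_vector \<Rightarrow> complex) \<Rightarrow> bool" where
  "bilinear_form \<beta> \<longleftrightarrow> (\<forall>a. clinear (\<beta> a)) \<and> (\<forall>b. clinear (\<lambda>a. \<beta> a b))"

text \<open>The algebraic tensor product: \<open>a \<otimes> b\<close> is the evaluation functional \<open>\<beta> \<mapsto> \<beta>(a, b)\<close> on the space
  of bilinear forms, and the tensor product is the set of finite sums of these functionals
  (scalars can be absorbed into the first leg). Functionals are extended by 0 outside the bilinear
  forms to make the representation unique.\<close>

definition eval_form :: "'a::complex_vector \<Rightarrow> 'b::complex_vector \<Rightarrow> ('a \<Rightarrow> 'b \<Rightarrow> complex) \<Rightarrow> complex" where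
  "eval_form a b \<beta> = (if bilinear_form \<beta> then \<beta> a b else 0)"

typedef (overloaded) ('a::complex_vector, 'b::complex_vector) tensor =
  "{t :: ('a \<Rightarrow> 'b \<Rightarrow> complex) \<Rightarrow> complex. \<exists>xs. t = (\<lambda>\<beta>. \<Sum>(a, b)\<leftarrow>xs. eval_form a b \<beta>)}"
  by blast

setup_lifting type_definition_tensor

lemma eval_form_scale: "eval_form (c *\<^sub>C a) b \<beta> = c * eval_form a b \<beta>"
  by (simp add: eval_form_def bilinear_form_def clinear_def scaleC_complex_def)

lemma tensor_scale:
  "c * (\<Sum>(a, b)\<leftarrow>xs. eval_form a b \<beta>) = (\<Sum>(a, b)\<leftarrow>map (\<lambda>(a, b). (c *\<^sub>C a, b)) xs. eval_form a b \<beta>)"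
  by (induction xs) (auto simp: eval_form_scale algebra_simps)

instantiation tensor :: (complex_vector, complex_vector) complex_vector
begin

lift_definition zero_tensor :: "('a, 'b) tensor" is "\<lambda>_. 0"
  by (rule exI[of _ "[]"]) simp
lift_definition plus_tensor :: "('a, 'b) tensor \<Rightarrow> ('a, 'b) tensor \<Rightarrow> ('a, 'b) tensor" is "\<lambda>s t \<beta>. s \<beta> + t \<beta>"
proof (elim exE)
  fix s t :: "('a \<Rightarrow> 'b \<Rightarrow> complex) \<Rightarrow> complex" and xs ys
  assume "s = (\<lambda>\<beta>. \<Sum>(a, b)\<leftarrow>xs. eval_form a b \<beta>)" "t = (\<lambda>\<beta>. \<Sum>(a, b)\<leftarrow>ys. eval_form a b \<beta>)"
  then show "\<exists>xs. (\<lambda>\<beta>. s \<beta> + t \<beta>) = (\<lambda>\<beta>. \<Sum>(a, b)\<leftarrow>xs. eval_form a b \<beta>)"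
    by (intro exI[of _ "xs @ ys"]) simp
qed
lift_definition scaleC_tensor :: "complex \<Rightarrow> ('a, 'b) tensor \<Rightarrow> ('a, 'b) tensor" is "\<lambda>c t \<beta>. c * t \<beta>"
proof (elim exE)
  fix c and t :: "('a \<Rightarrow> 'b \<Rightarrow> complex) \<Rightarrow> complex" and xs
  assume "t = (\<lambda>\<beta>. \<Sum>(a, b)\<leftarrow>xs. eval_form a b \<beta>)"
  then show "\<exists>xs. (\<lambda>\<beta>. c * t \<beta>) = (\<lambda>\<beta>. \<Sum>(a, b)\<leftarrow>xs. eval_form a b \<beta>)"
    by (intro exI[of _ "map (\<lambda>(a, b). (c *\<^sub>C a, b)) xs"]) (simp only: tensor_scale)
qed
definition uminus_tensor :: "('a, 'b) tensor \<Rightarrow> ('a, 'b) tensor" where "uminus_tensor t = (-1) *\<^sub>C t"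
definition minus_tensor :: "('a, 'b) tensor \<Rightarrow> ('a, 'b) tensor \<Rightarrow> ('a, 'b) tensor"
  where "minus_tensor s t = s + - t"
definition scaleR_tensor :: "real \<Rightarrow> ('a, 'b) tensor \<Rightarrow> ('a, 'b) tensor"
  where "scaleR_tensor r = scaleC (complex_of_real r)"

instance
  by standard (unfold minus_tensor_def uminus_tensor_def scaleR_tensor_def, (transfer; simp add: algebra_simps)+)

end

lift_definition tensor_prod :: "'a::complex_vector \<Rightarrow> 'b::complex_vector \<Rightarrow> ('a, 'b) tensor" (infixl "\<otimes>\<^sub>T" 70)
  is eval_form
proof -
  fix a :: 'a and b :: 'b
  show "\<exists>xs. eval_form a b = (\<lambda>\<beta>. \<Sum>(a, b)\<leftarrow>xs. eval_form a b \<beta>)"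
    by (rule exI[of _ "[(a, b)]"]) simp
qed

definition star_representation :: "('a::cstar_algebra \<Rightarrow> 'i ell2 \<Rightarrow> 'i ell2) \<Rightarrow> bool" where
  "star_representation \<pi> \<longleftrightarrow>
     (\<forall>a. bounded_clinear (\<pi> a)) \<and> (\<forall>\<xi>. clinear (\<lambda>a. \<pi> a \<xi>)) \<and>
     (\<forall>a b \<xi>. \<pi> (a * b) \<xi> = \<pi> a (\<pi> b \<xi>)) \<and>
     (\<forall>a \<xi> \<eta>. cinner (\<pi> (star a) \<xi>) \<eta> = cinner \<xi> (\<pi> a \<eta>))"

text \<open>\<open>tensor_representation \<pi> \<sigma> F\<close> says that \<open>F\<close> is \<open>\<pi> \<otimes> \<sigma>\<close>, i.e. the linear map into the bounded operators
  with \<open>F(a \<otimes> b) = \<pi>(a) \<otimes> \<sigma>(b)\<close>; the latter operator is determined by its values on elementary tensors.\<close>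

definition tensor_representation ::
    "('a::cstar_algebra \<Rightarrow> 'i ell2 \<Rightarrow> 'i ell2) \<Rightarrow> ('b::cstar_algebra \<Rightarrow> 'j ell2 \<Rightarrow> 'j ell2) \<Rightarrow>
     (('a, 'b) tensor \<Rightarrow> ('i \<times> 'j) ell2 \<Rightarrow> ('i \<times> 'j) ell2) \<Rightarrow> bool" where
  "tensor_representation \<pi> \<sigma> F \<longleftrightarrow>
     (\<forall>t. bounded_clinear (F t)) \<and> (\<forall>\<zeta>. clinear (\<lambda>t. F t \<zeta>)) \<and>
     (\<forall>a b \<xi> \<eta>. F (a \<otimes>\<^sub>T b) (ell2_tensor \<xi> \<eta>) = ell2_tensor (\<pi> a \<xi>) (\<sigma> b \<eta>))"

text \<open>The spatial norm \<open>\<parallel>t\<parallel> = sup \<parallel>(\<pi> \<otimes> \<sigma>)(t)\<parallel>\<close> over all *-representations. A Hilbert space of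
  dimension at most the cardinality of the algebra suffices for every cyclic representation, so it is
  no restriction to represent \<open>'a\<close> on \<open>\<ell>\<^sup>2('a)\<close> and \<open>'b\<close> on \<open>\<ell>\<^sup>2('b)\<close>; as *-representations may
  be degenerate, smaller dimensions are included.\<close>

definition min_tensor_norm :: "('a::cstar_algebra, 'b::cstar_algebra) tensor \<Rightarrow> real" where
  "min_tensor_norm t =
     Sup {onorm (F t) | F (\<pi> :: 'a \<Rightarrow> 'a ell2 \<Rightarrow> 'a ell2) (\<sigma> :: 'b \<Rightarrow> 'b ell2 \<Rightarrow> 'b ell2).
       star_representation \<pi> \<and> star_representation \<sigma> \<and> tensor_representation \<pi> \<sigma> F}"

definition is_trace :: "('a::cstar_algebra \<Rightarrow> complex) \<Rightarrow> bool" where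
  "is_trace \<tau> \<longleftrightarrow> clinear \<tau> \<and> (\<forall>z. \<tau> (star z * z) \<in> \<real>\<^sub>\<ge>\<^sub>0) \<and> (\<forall>z w. \<tau> (z * w) = \<tau> (w * z))"

definition amenable_trace :: "('a::cstar_algebra \<Rightarrow> complex) \<Rightarrow> bool" where
  "amenable_trace \<tau> \<longleftrightarrow> is_trace \<tau> \<and>
     (\<exists>\<phi> :: ('a, 'a opposite) tensor \<Rightarrow> complex.
        clinear \<phi> \<and> (\<forall>a b. \<phi> (a \<otimes>\<^sub>T opp b) = \<tau> (a * b)) \<and>
        (\<exists>C. \<forall>t. cmod (\<phi> t) \<le> C * min_tensor_norm t))"


section \<open>The free product of copies of \<open>\<ell>\<^sup>\<infinity>(A)\<close>\<close>

text \<open>Noncommutative polynomials: formal linear combinations of words, multiplied by concatenation.\<close>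

datatype 'g free_word = Word (letters: "'g list")

instantiation free_word :: (type) monoid_add
begin

definition "0 = Word []"
definition "u + v = Word (letters u @ letters v)"

instance
  by standard (simp_all add: zero_free_word_def plus_free_word_def)

end

type_synonym 'g ncpoly = "'g free_word \<Rightarrow>\<^sub>0 complex"

definition poly_const :: "complex \<Rightarrow> 'g ncpoly" where
  "poly_const c = Poly_Mapping.single 0 c"

definition poly_gen :: "'g \<Rightarrow> 'g ncpoly" where
  "poly_gen g = Poly_Mapping.single (Word [g]) 1"

text \<open>The involution with self-adjoint generators: conjugate the coefficients and reverse the words.\<close>

definition word_rev :: "'g free_word \<Rightarrow> 'g free_word" where
  "word_rev w = Word (rev (letters w))"

lemma word_rev_word_rev [simp]: "word_rev (word_rev w) = w"
  by (simp add: word_rev_def)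

lift_definition poly_star :: "'g ncpoly \<Rightarrow> 'g ncpoly" is "\<lambda>p w. cnj (p (word_rev w))"
proof -
  fix p :: "'g free_word \<Rightarrow> complex"
  assume "finite {w. p w \<noteq> 0}"
  moreover have "{w. cnj (p (word_rev w)) \<noteq> 0} = word_rev ` {w. p w \<noteq> 0}"
    by (auto simp: image_iff) (metis word_rev_word_rev)
  ultimately show "finite {w. cnj (p (word_rev w)) \<noteq> 0}" by simp
qed

lifting_forget poly_mapping.lifting

lemma poly_induct [case_names single add]:
  fixes p :: "'g ncpoly"
  assumes "\<And>w c. P (Poly_Mapping.single w c)" and "\<And>p q. P p \<Longrightarrow> P q \<Longrightarrow> P (p + q)"
  shows "P p"
proof (induction p rule: update_induct)
  case const
  show ?case using assms(1)[of 0 0] by simp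
next
  case (update f a b)
  have "Poly_Mapping.update a b f = f + Poly_Mapping.single a b"
    using update(1) by (intro poly_mapping_eqI) (auto simp: lookup_update lookup_add lookup_single in_keys_iff when_def)
  then show ?case using assms update by simp
qed

lemma poly_star_add: "poly_star (p + q) = poly_star p + poly_star q"
  by (rule poly_mapping_eqI) (simp add: poly_star.rep_eq lookup_add)

lemma poly_star_single: "poly_star (Poly_Mapping.single w c) = Poly_Mapping.single (word_rev w) (cnj c)"
  by (rule poly_mapping_eqI) (auto simp: poly_star.rep_eq lookup_single when_def)

lemma poly_star_star [simp]: "poly_star (poly_star p) = p"
  by (rule poly_mapping_eqI) (simp add: poly_star.rep_eq)

lemma word_rev_add: "word_rev (u + v) = word_rev v + word_rev u"
  by (simp add: word_rev_def plus_free_word_def)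

lemma poly_star_mult: "poly_star (p * q) = poly_star q * poly_star p"
proof (induction p rule: poly_induct)
  case (single w c)
  show ?case
    by (induction q rule: poly_induct)
      (simp_all add: mult_single poly_star_single word_rev_add mult.commute distrib_left distrib_right poly_star_add)
qed (simp add: distrib_left distrib_right poly_star_add)

lemma poly_star_const: "poly_star (poly_const c) = poly_const (cnj c)"
  by (simp add: poly_const_def poly_star_single zero_free_word_def word_rev_def)

lemma poly_const_commute: "p * poly_const c = poly_const c * p"
  unfolding poly_const_def
  by (induction p rule: poly_induct) (simp_all add: mult_single mult.commute distrib_left distrib_right)

lemma poly_const_mult: "poly_const c * poly_const d = poly_const (c * d)"
  by (simp add: poly_const_def mult_single)

lemma poly_const_add: "poly_const (c + d) = poly_const c + poly_const d"
  by (simp add: poly_const_def single_add)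

lemma poly_const_1: "poly_const 1 = 1"
  by (simp add: poly_const_def)

text \<open>Evaluation at elements of a C*-algebra.\<close>

definition poly_eval :: "('g \<Rightarrow> 'c::cstar_algebra) \<Rightarrow> 'g ncpoly \<Rightarrow> 'c" where
  "poly_eval q p = (\<Sum>w\<in>Poly_Mapping.keys p. Poly_Mapping.lookup p w *\<^sub>C prod_list (map q (letters w)))"

lemma scaleC_zero_left [simp]: "0 *\<^sub>C x = (0 :: 'a::complex_vector)"
  by (rule complex_vector.scale_zero_left)

lemma poly_eval_superset:
  assumes "finite S" "Poly_Mapping.keys p \<subseteq> S"
  shows "poly_eval q p = (\<Sum>w\<in>S. Poly_Mapping.lookup p w *\<^sub>C prod_list (map q (letters w)))"
  unfolding poly_eval_def using assms by (intro sum.mono_neutral_left) (auto simp: in_keys_iff)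

lemma poly_eval_single: "poly_eval q (Poly_Mapping.single w c) = c *\<^sub>C prod_list (map q (letters w))"
  by (subst poly_eval_superset[of "{w}"]) auto

lemma poly_eval_add: "poly_eval q (p + p') = poly_eval q p + poly_eval q p'"
proof -
  let ?S = "Poly_Mapping.keys p \<union> Poly_Mapping.keys p'"
  have "Poly_Mapping.keys (p + p') \<subseteq> ?S" by (rule Poly_Mapping.keys_add)
  then show ?thesis
    by (simp add: poly_eval_superset[of ?S] lookup_add scaleC_add_left sum.distrib)
qed

lemma poly_eval_mult: "poly_eval q (p * p') = poly_eval q p * poly_eval q p'"
proof (induction p rule: poly_induct)
  case (single w c)
  show ?case
    by (induction p' rule: poly_induct)
      (simp_all add: mult_single poly_eval_single poly_eval_add plus_free_word_def distrib_left
        mult_scaleC_left mult_scaleC_right scaleC_scaleC)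
qed (simp add: distrib_right poly_eval_add)

lemma poly_eval_const: "poly_eval q (poly_const c) = c *\<^sub>C 1"
  by (simp add: poly_const_def poly_eval_single zero_free_word_def)

lemma poly_eval_gen: "poly_eval q (poly_gen g) = q g"
  by (simp add: poly_gen_def poly_eval_single scaleC_one)

lemma poly_eval_uminus: "poly_eval q (- p) = - poly_eval q p"
  using poly_eval_add[of q p "- p"] by (simp add: poly_eval_def eq_neg_iff_add_eq_0 add.commute)

lemma poly_eval_sum: "poly_eval q (sum f S) = (\<Sum>i\<in>S. poly_eval q (f i))"
  by (induction S rule: infinite_finite_induct) (simp_all add: poly_eval_add, simp_all add: poly_eval_def)

lemma star_prod_list:
  fixes q :: "'g \<Rightarrow> 'c::cstar_algebra"
  shows "(\<And>g. star (q g) = q g) \<Longrightarrow> star (prod_list (map q gs)) = prod_list (map q (rev gs))"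
  by (induction gs) (simp_all add: star_one star_mult)

lemma poly_eval_star:
  assumes "\<And>g. star (q g) = q g"
  shows "poly_eval q (poly_star p) = star (poly_eval q p)"
  by (induction p rule: poly_induct)
    (simp_all add: poly_star_single poly_eval_single star_scaleC star_prod_list assms word_rev_def
      poly_star_add poly_eval_add star_add)

definition cstar_seminorm :: "('g ncpoly \<Rightarrow> real) \<Rightarrow> bool" where
  "cstar_seminorm s \<longleftrightarrow>
     (\<forall>p q. s (p + q) \<le> s p + s q) \<and> (\<forall>c p. s (poly_const c * p) = cmod c * s p) \<and>
     (\<forall>p q. s (p * q) \<le> s p * s q) \<and> (\<forall>p. s (poly_star p * p) = (s p)\<^sup>2)"

text \<open>The relations say that, for each \<open>x\<close>, the generators \<open>(x, a)\<close> multiply like the canonical basis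
  of \<open>\<ell>\<^sup>\<infinity>(A)\<close> and that the units of all copies are identified with 1. Hence these are the
  C*-seminorms on the unital algebraic free product of the copies of \<open>\<ell>\<^sup>\<infinity>(A)\<close>.\<close>

definition free_seminorm :: "(('x \<times> 'a::finite) ncpoly \<Rightarrow> real) \<Rightarrow> bool" where
  "free_seminorm s \<longleftrightarrow> cstar_seminorm s \<and>
     (\<forall>x a a'. s (poly_gen (x, a) * poly_gen (x, a') - (if a = a' then poly_gen (x, a) else 0)) = 0) \<and>
     (\<forall>x. s ((\<Sum>a\<in>UNIV. poly_gen (x, a)) - 1) = 0)"

definition max_norm :: "('x \<times> 'a::finite) ncpoly \<Rightarrow> real" where
  "max_norm p = (SUP s\<in>Collect free_seminorm. s p)"

context
  fixes s :: "'g ncpoly \<Rightarrow> real"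
  assumes s: "cstar_seminorm s"
begin

lemma cs_triangle: "s (p + q) \<le> s p + s q"
  and cs_scale: "s (poly_const c * p) = cmod c * s p"
  and cs_mult: "s (p * q) \<le> s p * s q"
  and cs_star_mult: "s (poly_star p * p) = (s p)\<^sup>2"
  using s by (simp_all add: cstar_seminorm_def)

lemma cs_zero: "s 0 = 0"
  using cs_scale[of 0 0] by simp

lemma cs_minus: "s (- p) = s p"
proof -
  have "- p = poly_const (- 1) * p"
    by (simp add: poly_const_def single_uminus)
  then show ?thesis using cs_scale[of "- 1" p] by simp
qed

lemma cs_nonneg: "0 \<le> s p"
  using cs_triangle[of p "- p"] by (simp add: cs_minus cs_zero)

lemma cs_minus_commute: "s (p - q) = s (q - p)"
  using cs_minus[of "p - q"] by simp

lemma cs_diff: "\<bar>s p - s q\<bar> \<le> s (p - q)"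
  using cs_triangle[of "p - q" q] cs_triangle[of "q - p" p] by (simp add: cs_minus_commute)

lemma cs_star: "s (poly_star p) = s p"
proof -
  have le: "s p \<le> s (poly_star p)" for p
  proof (cases "s p = 0")
    case False
    have "s p * s p \<le> s (poly_star p) * s p"
      using cs_star_mult[of p] cs_mult[of "poly_star p" p] by (simp add: power2_eq_square)
    then show ?thesis using False cs_nonneg[of p] by (simp add: mult_le_cancel_right)
  qed (simp add: cs_nonneg)
  show ?thesis using le[of p] le[of "poly_star p"] by simp
qed

end

lemma idempotent_bound: "(r :: real) = r\<^sup>2 \<Longrightarrow> r \<le> 1"
  by (cases "r = 0") (auto simp: power2_eq_square)

lemma free_seminorm_gen_le:
  assumes "free_seminorm s"
  shows "s (poly_gen g) \<le> 1"
proof -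
  obtain x a where g: "g = (x, a)" by (cases g)
  have s: "cstar_seminorm s" using assms by (simp add: free_seminorm_def)
  have "s (poly_gen (x, a) * poly_gen (x, a) - (if a = a then poly_gen (x, a) else 0)) = 0"
    using assms unfolding free_seminorm_def by blast
  then have "s (poly_gen g * poly_gen g - poly_gen g) = 0" by (simp add: g)
  then have "s (poly_gen g) = s (poly_gen g * poly_gen g)"
    using cs_diff[OF s, of "poly_gen g * poly_gen g" "poly_gen g"] by simp
  moreover have "poly_star (poly_gen g) = poly_gen g"
    by (simp add: poly_gen_def poly_star_single word_rev_def)
  ultimately show ?thesis
    using cs_star_mult[OF s, of "poly_gen g"] by (intro idempotent_bound) simp
qed

lemma cstar_seminorm_one_le:
  fixes s :: "'g ncpoly \<Rightarrow> real"
  assumes "cstar_seminorm s"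
  shows "s 1 \<le> 1"
proof -
  have "poly_star 1 = (1 :: 'g ncpoly)"
    using poly_star_const[of 1] by (simp add: poly_const_1)
  then show ?thesis
    using cs_star_mult[OF assms, of 1] by (intro idempotent_bound) simp
qed

lemma free_seminorm_bounded: "\<exists>K. \<forall>s. free_seminorm s \<longrightarrow> s p \<le> K"
proof (induction p rule: poly_induct)
  case (single w c)
  have "s (Poly_Mapping.single w c) \<le> cmod c" if f: "free_seminorm s" for s
  proof -
    have s: "cstar_seminorm s" using f by (simp add: free_seminorm_def)
    have word: "s (Poly_Mapping.single (Word gs) 1) \<le> 1" for gs
    proof (induction gs)
      case Nil
      then show ?case using cstar_seminorm_one_le[OF s] by (simp flip: zero_free_word_def)
    next
      case (Cons g gs)
      have "Poly_Mapping.single (Word (g # gs)) 1 = poly_gen g * Poly_Mapping.single (Word gs) 1"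
        by (simp add: poly_gen_def mult_single plus_free_word_def)
      then show ?case
        using cs_mult[OF s, of "poly_gen g" "Poly_Mapping.single (Word gs) 1"]
          mult_mono[OF free_seminorm_gen_le[OF f, of g] Cons] cs_nonneg[OF s] by fastforce
    qed
    have "Poly_Mapping.single w c = poly_const c * Poly_Mapping.single (Word (letters w)) 1"
      by (simp add: poly_const_def mult_single)
    then have "s (Poly_Mapping.single w c) = cmod c * s (Poly_Mapping.single (Word (letters w)) 1)"
      by (simp add: cs_scale[OF s])
    also have "\<dots> \<le> cmod c" using word[of "letters w"] by (simp add: mult_left_le)
    finally show ?thesis .
  qed
  then show ?case by blast
next
  case (add p q)
  then obtain K L where "\<And>s. free_seminorm s \<Longrightarrow> s p \<le> K" "\<And>s. free_seminorm s \<Longrightarrow> s q \<le> L"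
    by blast
  then have "s (p + q) \<le> K + L" if "free_seminorm s" for s
    using that cs_triangle[of s p q] unfolding free_seminorm_def by (smt (verit) that)
  then show ?case by blast
qed

lemma max_norm_upper:
  assumes "free_seminorm s"
  shows "s p \<le> max_norm p"
proof -
  obtain K where "\<forall>s. free_seminorm s \<longrightarrow> s p \<le> K"
    using free_seminorm_bounded by blast
  then have "bdd_above ((\<lambda>s. s p) ` Collect free_seminorm)"
    by (intro bdd_aboveI2[of _ _ K]) simp
  then show ?thesis
    unfolding max_norm_def using assms by (intro cSUP_upper) simp_all
qed

lemma free_seminorm_eval:
  fixes q :: "'x \<Rightarrow> 'a::finite \<Rightarrow> 'c::cstar_algebra"
  assumes "\<And>x a. star (q x a) = q x a"
    and "\<And>x a a'. q x a * q x a' = (if a = a' then q x a else 0)"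
    and "\<And>x. (\<Sum>a\<in>UNIV. q x a) = 1"
  shows "free_seminorm (\<lambda>p. norm (poly_eval (\<lambda>(x, a). q x a) p))"
proof -
  have zero: "poly_eval f 0 = 0" and one: "poly_eval f 1 = 1" for f :: "'x \<times> 'a \<Rightarrow> 'c"
    using poly_eval_const[of f 1] by (simp_all add: poly_eval_def[of _ 0] poly_const_1 scaleC_one)
  have diff: "poly_eval f (p - p') = poly_eval f p - poly_eval f p'" for f :: "'x \<times> 'a \<Rightarrow> 'c" and p p'
    using poly_eval_add[of f p "- p'"] by (simp add: poly_eval_uminus)
  let ?f = "\<lambda>(x, a). q x a"
  have "cstar_seminorm (\<lambda>p. norm (poly_eval ?f p))"
    unfolding cstar_seminorm_def
    by (simp add: poly_eval_add poly_eval_mult poly_eval_const mult_scaleC_left norm_scaleC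
        poly_eval_star norm_star_mult norm_triangle_ineq norm_mult_le assms(1) case_prod_unfold)
  moreover have "poly_eval ?f (poly_gen (x, a) * poly_gen (x, a') - (if a = a' then poly_gen (x, a) else 0)) = 0"
    for x a a'
    by (simp add: diff poly_eval_mult poly_eval_gen assms(2) zero)
  moreover have "poly_eval ?f ((\<Sum>a\<in>UNIV. poly_gen (x, a)) - 1) = 0" for x
    by (simp add: diff poly_eval_sum poly_eval_gen assms(3) one)
  ultimately show ?thesis
    unfolding free_seminorm_def by simp
qed

lemma ex_free_seminorm: "\<exists>s :: ('x \<times> 'a::finite) ncpoly \<Rightarrow> real. free_seminorm s \<and> s 1 = 1"
proof -
  define q :: "'x \<Rightarrow> 'a \<Rightarrow> complex" where "q x a = of_bool (a = undefined)" for x a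
  have "free_seminorm (\<lambda>p. norm (poly_eval (\<lambda>(x, a). q x a) p))"
    by (rule free_seminorm_eval) (auto simp: q_def star_complex_def of_bool_def)
  moreover have "norm (poly_eval (\<lambda>(x, a). q x a) 1) = 1"
    using poly_eval_const[of "\<lambda>(x, a). q x a" 1] by (simp add: poly_const_1 scaleC_one)
  ultimately show ?thesis by blast
qed

lemma max_norm_least:
  fixes p :: "('x \<times> 'a::finite) ncpoly"
  assumes "\<And>s. free_seminorm s \<Longrightarrow> s p \<le> K"
  shows "max_norm p \<le> K"
proof -
  have "Collect (free_seminorm :: (('x \<times> 'a) ncpoly \<Rightarrow> real) \<Rightarrow> bool) \<noteq> {}"
    using ex_free_seminorm by auto
  then show ?thesis
    unfolding max_norm_def by (rule cSUP_least) (simp add: assms)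
qed

lemma max_norm_nonneg: "0 \<le> max_norm (p :: ('x \<times> 'a::finite) ncpoly)"
proof -
  obtain s :: "('x \<times> 'a) ncpoly \<Rightarrow> real" where s: "free_seminorm s" using ex_free_seminorm by blast
  then have "0 \<le> s p" by (intro cs_nonneg) (simp add: free_seminorm_def)
  also have "\<dots> \<le> max_norm p" using s by (rule max_norm_upper)
  finally show ?thesis .
qed

lemma free_seminorm_max_norm: "free_seminorm (max_norm :: ('x \<times> 'a::finite) ncpoly \<Rightarrow> real)"
proof -
  have cs: "free_seminorm s \<Longrightarrow> cstar_seminorm s" for s :: "('x \<times> 'a) ncpoly \<Rightarrow> real"
    by (simp add: free_seminorm_def)
  have "max_norm (p + q) \<le> max_norm p + max_norm q" for p q :: "('x \<times> 'a) ncpoly"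
    by (rule max_norm_least) (smt (verit) cs cs_triangle max_norm_upper)
  moreover have "max_norm (p * q) \<le> max_norm p * max_norm q" for p q :: "('x \<times> 'a) ncpoly"
  proof (rule max_norm_least)
    fix s assume "free_seminorm (s :: ('x \<times> 'a) ncpoly \<Rightarrow> real)"
    then show "s (p * q) \<le> max_norm p * max_norm q"
      using cs_mult[OF cs, of s p q] cs_nonneg[OF cs, of s]
        mult_mono[OF max_norm_upper[of s p] max_norm_upper[of s q]] max_norm_nonneg[of p]
      by fastforce
  qed
  moreover have scale: "max_norm (poly_const c * p) = cmod c * max_norm p" for c and p :: "('x \<times> 'a) ncpoly"
  proof -
    have le: "max_norm (poly_const c * p) \<le> cmod c * max_norm p" for c and p :: "('x \<times> 'a) ncpoly"
      by (rule max_norm_least) (simp add: cs_scale[OF cs] max_norm_upper mult_left_mono)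
    show ?thesis
    proof (cases "c = 0")
      case True
      have "max_norm (0 :: ('x \<times> 'a) ncpoly) \<le> 0"
        by (rule max_norm_least) (simp add: cs_zero[OF cs])
      then show ?thesis using True max_norm_nonneg[of "0 :: ('x \<times> 'a) ncpoly"] by (simp add: poly_const_def)
    next
      case False
      have "p = poly_const (inverse c) * (poly_const c * p)"
        using False by (simp add: poly_const_mult poly_const_1 flip: mult.assoc)
      then have "max_norm p \<le> cmod (inverse c) * max_norm (poly_const c * p)"
        by (metis le)
      then have "cmod c * max_norm p \<le> cmod c * (cmod (inverse c) * max_norm (poly_const c * p))"
        by (rule mult_left_mono) simp
      also have "\<dots> = max_norm (poly_const c * p)"
        using False by (simp add: norm_inverse)
      finally have "cmod c * max_norm p \<le> max_norm (poly_const c * p)" .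
      then show ?thesis using le[of c p] by simp
    qed
  qed
  moreover have "max_norm (poly_star p * p) = (max_norm p)\<^sup>2" for p :: "('x \<times> 'a) ncpoly"
  proof (rule antisym)
    show "max_norm (poly_star p * p) \<le> (max_norm p)\<^sup>2"
      by (rule max_norm_least)
        (simp add: cs_star_mult[OF cs] power_mono[OF max_norm_upper] cs_nonneg[OF cs])
    have "max_norm p \<le> sqrt (max_norm (poly_star p * p))"
    proof (rule max_norm_least)
      fix s assume "free_seminorm (s :: ('x \<times> 'a) ncpoly \<Rightarrow> real)"
      then show "s p \<le> sqrt (max_norm (poly_star p * p))"
        using max_norm_upper[of s "poly_star p * p"] by (simp add: cs_star_mult[OF cs] real_le_rsqrt)
    qed
    then show "(max_norm p)\<^sup>2 \<le> max_norm (poly_star p * p)"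
      using max_norm_nonneg[of p] max_norm_nonneg[of "poly_star p * p"]
      by (metis power_mono real_sqrt_pow2)
  qed
  ultimately have "cstar_seminorm (max_norm :: ('x \<times> 'a) ncpoly \<Rightarrow> real)"
    unfolding cstar_seminorm_def by blast
  moreover have "max_norm p = 0" if "\<And>s. free_seminorm s \<Longrightarrow> s p = 0" for p :: "('x \<times> 'a) ncpoly"
    using max_norm_least[of p 0] max_norm_nonneg[of p] that by force
  ultimately show ?thesis
    unfolding free_seminorm_def by blast
qed


lemma cstar_seminorm_max_norm: "cstar_seminorm (max_norm :: ('x \<times> 'a::finite) ncpoly \<Rightarrow> real)"
  using free_seminorm_max_norm unfolding free_seminorm_def by blast

lemmas max_norm_triangle = cs_triangle[OF cstar_seminorm_max_norm]
  and max_norm_scale = cs_scale[OF cstar_seminorm_max_norm]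
  and max_norm_mult = cs_mult[OF cstar_seminorm_max_norm]
  and max_norm_star_mult = cs_star_mult[OF cstar_seminorm_max_norm]
  and max_norm_star = cs_star[OF cstar_seminorm_max_norm]
  and max_norm_zero = cs_zero[OF cstar_seminorm_max_norm]
  and max_norm_minus = cs_minus[OF cstar_seminorm_max_norm]
  and max_norm_minus_commute = cs_minus_commute[OF cstar_seminorm_max_norm]
  and max_norm_diff = cs_diff[OF cstar_seminorm_max_norm]

lemma max_norm_one: "max_norm (1 :: ('x \<times> 'a::finite) ncpoly) = 1"
proof (rule antisym)
  show "max_norm (1 :: ('x \<times> 'a) ncpoly) \<le> 1"
    by (rule cstar_seminorm_one_le[OF cstar_seminorm_max_norm])
  show "1 \<le> max_norm (1 :: ('x \<times> 'a) ncpoly)"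
    using ex_free_seminorm max_norm_upper by metis
qed

text \<open>\<open>\<A>(X, A)\<close> is the separation and completion of the noncommutative polynomials in the variables
  \<open>(x, a)\<close> with respect to the largest C*-seminorm, built from Cauchy sequences.\<close>

definition poly_Cauchy :: "(nat \<Rightarrow> ('x \<times> 'a::finite) ncpoly) \<Rightarrow> bool" where
  "poly_Cauchy u \<longleftrightarrow> (\<forall>e>0. \<exists>M. \<forall>m\<ge>M. \<forall>n\<ge>M. max_norm (u m - u n) < e)"

definition completion_rel :: "(nat \<Rightarrow> ('x \<times> 'a::finite) ncpoly) \<Rightarrow> (nat \<Rightarrow> ('x \<times> 'a) ncpoly) \<Rightarrow> bool" where
  "completion_rel u v \<longleftrightarrow> poly_Cauchy u \<and> poly_Cauchy v \<and> (\<lambda>n. max_norm (u n - v n)) \<longlonglongrightarrow> 0"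

lemma completion_rel_refl [simp]: "completion_rel u u \<longleftrightarrow> poly_Cauchy u"
  by (simp add: completion_rel_def max_norm_zero)

lemma max_norm_tendsto_0:
  assumes "\<And>n. max_norm (w n) \<le> f n" "f \<longlonglongrightarrow> 0"
  shows "(\<lambda>n. max_norm (w n)) \<longlonglongrightarrow> 0"
  by (rule tendsto_sandwich[OF _ _ tendsto_const assms(2)]) (simp_all add: max_norm_nonneg assms(1))

lemma completion_rel_sym: "completion_rel u v \<Longrightarrow> completion_rel v u"
  by (simp add: completion_rel_def max_norm_minus_commute)

lemma completion_rel_trans:
  assumes "completion_rel u v" "completion_rel v w"
  shows "completion_rel u w"
proof -
  have "max_norm (u n - w n) \<le> max_norm (u n - v n) + max_norm (v n - w n)" for n
    using max_norm_triangle[of "u n - v n" "v n - w n"] by simp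
  moreover have "(\<lambda>n. max_norm (u n - v n) + max_norm (v n - w n)) \<longlonglongrightarrow> 0"
    using assms tendsto_add[of "\<lambda>n. max_norm (u n - v n)" 0 sequentially "\<lambda>n. max_norm (v n - w n)" 0]
    by (simp add: completion_rel_def)
  ultimately have "(\<lambda>n. max_norm (u n - w n)) \<longlonglongrightarrow> 0"
    by (rule max_norm_tendsto_0)
  then show ?thesis
    using assms unfolding completion_rel_def by simp
qed

lemma poly_Cauchy_const: "poly_Cauchy (\<lambda>_. p)"
  by (simp add: poly_Cauchy_def max_norm_zero)

quotient_type ('x, 'a) free_cstar = "nat \<Rightarrow> ('x \<times> 'a::finite) ncpoly" / partial: completion_rel
proof (rule part_equivpI)
  show "\<exists>u. completion_rel u u"
    by (rule exI[of _ "\<lambda>_. 0"]) (simp add: poly_Cauchy_const)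
  show "symp completion_rel" by (rule sympI) (rule completion_rel_sym)
  show "transp completion_rel" by (rule transpI) (rule completion_rel_trans)
qed

lemma poly_CauchyE:
  assumes "poly_Cauchy u" "e > 0"
  obtains M where "\<And>m n. m \<ge> M \<Longrightarrow> n \<ge> M \<Longrightarrow> max_norm (u m - u n) < e"
  using assms unfolding poly_Cauchy_def by blast

lemma poly_Cauchy_of_le:
  assumes u: "poly_Cauchy u" and le: "\<And>m n. max_norm (w m - w n) \<le> K * max_norm (u m - u n)"
  shows "poly_Cauchy w"
  unfolding poly_Cauchy_def
proof (intro allI impI)
  fix e :: real assume "e > 0"
  then have "e / (\<bar>K\<bar> + 1) > 0"
    by (intro divide_pos_pos) auto
  then obtain M where M: "\<And>m n. m \<ge> M \<Longrightarrow> n \<ge> M \<Longrightarrow> max_norm (u m - u n) < e / (\<bar>K\<bar> + 1)"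
    by (rule poly_CauchyE[OF u]) blast
  have "max_norm (w m - w n) < e" if "m \<ge> M" "n \<ge> M" for m n
  proof -
    have "max_norm (w m - w n) \<le> (\<bar>K\<bar> + 1) * max_norm (u m - u n)"
      using le[of m n] mult_right_mono[of K "\<bar>K\<bar> + 1" "max_norm (u m - u n)"] max_norm_nonneg[of "u m - u n"]
      by linarith
    also have "\<dots> < e"
      using M[OF that] by (simp add: pos_less_divide_eq mult.commute)
    finally show ?thesis .
  qed
  then show "\<exists>M. \<forall>m\<ge>M. \<forall>n\<ge>M. max_norm (w m - w n) < e" by blast
qed

lemma poly_Cauchy_add:
  assumes "poly_Cauchy u" "poly_Cauchy v"
  shows "poly_Cauchy (\<lambda>n. u n + v n)"
  unfolding poly_Cauchy_def
proof (intro allI impI)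
  fix e :: real assume "e > 0"
  then have e: "e / 2 > 0" by simp
  obtain M where M: "\<And>m n. m \<ge> M \<Longrightarrow> n \<ge> M \<Longrightarrow> max_norm (u m - u n) < e / 2"
    by (rule poly_CauchyE[OF assms(1) e]) blast
  obtain N where N: "\<And>m n. m \<ge> N \<Longrightarrow> n \<ge> N \<Longrightarrow> max_norm (v m - v n) < e / 2"
    by (rule poly_CauchyE[OF assms(2) e]) blast
  have "max_norm ((u m + v m) - (u n + v n)) < e" if "m \<ge> max M N" "n \<ge> max M N" for m n
  proof -
    have "max_norm ((u m + v m) - (u n + v n)) \<le> max_norm (u m - u n) + max_norm (v m - v n)"
      using max_norm_triangle[of "u m - u n" "v m - v n"] by (simp add: algebra_simps)
    also have "\<dots> < e / 2 + e / 2"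
      using M N that by (intro add_strict_mono) auto
    finally show ?thesis by simp
  qed
  then show "\<exists>M. \<forall>m\<ge>M. \<forall>n\<ge>M. max_norm ((u m + v m) - (u n + v n)) < e" by blast
qed

lemma poly_Cauchy_scale:
  assumes "poly_Cauchy u"
  shows "poly_Cauchy (\<lambda>n. poly_const c * u n)"
  by (rule poly_Cauchy_of_le[OF assms, of _ "cmod c"])
    (simp add: max_norm_scale flip: right_diff_distrib)

lemma poly_star_minus: "poly_star (- p) = - poly_star p"
  by (rule poly_mapping_eqI) (simp add: poly_star.rep_eq)

lemma poly_star_diff: "poly_star (p - q) = poly_star p - poly_star q"
  using poly_star_add[of p "- q"] by (simp add: poly_star_minus)

lemma poly_Cauchy_star:
  assumes "poly_Cauchy u"
  shows "poly_Cauchy (\<lambda>n. poly_star (u n))"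
  by (rule poly_Cauchy_of_le[OF assms, of _ 1])
    (simp add: max_norm_star flip: poly_star_diff)

lemma poly_Cauchy_minus:
  assumes "poly_Cauchy u"
  shows "poly_Cauchy (\<lambda>n. - u n)"
proof (rule poly_Cauchy_of_le[OF assms, of _ 1])
  fix m n
  show "max_norm (- u m - - u n) \<le> 1 * max_norm (u m - u n)"
    using max_norm_minus_commute[of "u m" "u n"] by simp
qed

lemma poly_Cauchy_max_norm:
  assumes "poly_Cauchy u"
  shows "convergent (\<lambda>n. max_norm (u n))"
proof -
  have "Cauchy (\<lambda>n. max_norm (u n))"
    unfolding Cauchy_def dist_real_def
  proof (intro allI impI)
    fix e :: real assume "e > 0"
    then obtain M where "\<And>m n. m \<ge> M \<Longrightarrow> n \<ge> M \<Longrightarrow> max_norm (u m - u n) < e"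
      by (rule poly_CauchyE[OF assms]) blast
    then show "\<exists>M. \<forall>m\<ge>M. \<forall>n\<ge>M. \<bar>max_norm (u m) - max_norm (u n)\<bar> < e"
      using order_le_less_trans[OF max_norm_diff] by blast
  qed
  then show ?thesis by (simp add: Cauchy_convergent_iff)
qed

lemma poly_Cauchy_bounded:
  assumes "poly_Cauchy u"
  obtains K where "K > 0" "\<And>n. max_norm (u n) \<le> K"
proof -
  obtain K where K: "K > 0" "\<And>n. norm (max_norm (u n)) \<le> K"
    using convergent_imp_Bseq[OF poly_Cauchy_max_norm[OF assms]] by (auto elim: BseqE)
  have "max_norm (u n) \<le> K" for n using K(2)[of n] by simp
  with K(1) show ?thesis by (rule that)
qed

lemma max_norm_mult_diff:
  "max_norm (p * q - p' * q') \<le> max_norm p * max_norm (q - q') + max_norm (p - p') * max_norm q'"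
proof -
  have "p * q - p' * q' = p * (q - q') + (p - p') * q'" by (simp add: algebra_simps)
  then show ?thesis
    using max_norm_triangle[of "p * (q - q')" "(p - p') * q'"] max_norm_mult[of p "q - q'"]
      max_norm_mult[of "p - p'" q'] by simp
qed

lemma poly_Cauchy_mult:
  assumes u: "poly_Cauchy u" and v: "poly_Cauchy v"
  shows "poly_Cauchy (\<lambda>n. u n * v n)"
  unfolding poly_Cauchy_def
proof (intro allI impI)
  fix e :: real assume e: "e > 0"
  obtain K where K: "K > 0" "\<And>n. max_norm (u n) \<le> K" by (rule poly_Cauchy_bounded[OF u]) blast
  obtain L where L: "L > 0" "\<And>n. max_norm (v n) \<le> L" by (rule poly_Cauchy_bounded[OF v]) blast
  have eL: "e / (2 * L) > 0" and eK: "e / (2 * K) > 0" using e K(1) L(1) by simp_all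
  obtain M where M: "\<And>m n. m \<ge> M \<Longrightarrow> n \<ge> M \<Longrightarrow> max_norm (u m - u n) < e / (2 * L)"
    by (rule poly_CauchyE[OF u eL]) blast
  obtain N where N: "\<And>m n. m \<ge> N \<Longrightarrow> n \<ge> N \<Longrightarrow> max_norm (v m - v n) < e / (2 * K)"
    by (rule poly_CauchyE[OF v eK]) blast
  have "max_norm (u m * v m - u n * v n) < e" if "m \<ge> max M N" "n \<ge> max M N" for m n
  proof -
    have "max_norm (u m * v m - u n * v n)
        \<le> max_norm (u m) * max_norm (v m - v n) + max_norm (u m - u n) * max_norm (v n)"
      by (rule max_norm_mult_diff)
    also have "\<dots> \<le> K * max_norm (v m - v n) + max_norm (u m - u n) * L"
      using K L max_norm_nonneg by (intro add_mono mult_right_mono mult_left_mono) auto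
    also have "\<dots> < K * (e / (2 * K)) + (e / (2 * L)) * L"
      using M N that K(1) L(1) by (intro add_strict_mono mult_strict_left_mono mult_strict_right_mono) auto
    also have "\<dots> = e" using K(1) L(1) by simp
    finally show ?thesis .
  qed
  then show "\<exists>M. \<forall>m\<ge>M. \<forall>n\<ge>M. max_norm (u m * v m - u n * v n) < e" by blast
qed

lemma completion_rel_add:
  assumes "completion_rel u u'" "completion_rel v v'"
  shows "completion_rel (\<lambda>n. u n + v n) (\<lambda>n. u' n + v' n)"
proof -
  have "(\<lambda>n. max_norm ((u n + v n) - (u' n + v' n))) \<longlonglongrightarrow> 0"
  proof (rule max_norm_tendsto_0)
    show "max_norm ((u n + v n) - (u' n + v' n)) \<le> max_norm (u n - u' n) + max_norm (v n - v' n)" for n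
      using max_norm_triangle[of "u n - u' n" "v n - v' n"] by (simp add: algebra_simps)
    show "(\<lambda>n. max_norm (u n - u' n) + max_norm (v n - v' n)) \<longlonglongrightarrow> 0"
      using assms unfolding completion_rel_def by (auto intro: tendsto_add_zero)
  qed
  then show ?thesis using assms by (simp add: completion_rel_def poly_Cauchy_add)
qed

lemma completion_rel_mult:
  assumes "completion_rel u u'" "completion_rel v v'"
  shows "completion_rel (\<lambda>n. u n * v n) (\<lambda>n. u' n * v' n)"
proof -
  have C: "poly_Cauchy u" "poly_Cauchy v" "poly_Cauchy u'" "poly_Cauchy v'"
    using assms by (simp_all add: completion_rel_def)
  obtain K where K: "K > 0" "\<And>n. max_norm (u n) \<le> K" by (rule poly_Cauchy_bounded[OF C(1)]) blast
  obtain L where L: "L > 0" "\<And>n. max_norm (v' n) \<le> L" by (rule poly_Cauchy_bounded[OF C(4)]) blast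
  have "(\<lambda>n. max_norm (u n * v n - u' n * v' n)) \<longlonglongrightarrow> 0"
  proof (rule max_norm_tendsto_0)
    fix n
    show "max_norm (u n * v n - u' n * v' n) \<le> K * max_norm (v n - v' n) + max_norm (u n - u' n) * L"
      using max_norm_mult_diff[of "u n" "v n" "u' n" "v' n"]
        mult_right_mono[OF K(2)[of n] max_norm_nonneg[of "v n - v' n"]]
        mult_left_mono[OF L(2)[of n] max_norm_nonneg[of "u n - u' n"]] by linarith
  next
    show "(\<lambda>n. K * max_norm (v n - v' n) + max_norm (u n - u' n) * L) \<longlonglongrightarrow> 0"
      using tendsto_add_zero[OF tendsto_mult_right_zero[of "\<lambda>n. max_norm (v n - v' n)" sequentially K]
          tendsto_mult_left_zero[of "\<lambda>n. max_norm (u n - u' n)" sequentially L]] assms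
      by (simp add: completion_rel_def)
  qed
  then show ?thesis using C by (simp add: completion_rel_def poly_Cauchy_mult)
qed

lemma completion_rel_scale:
  assumes "completion_rel u v"
  shows "completion_rel (\<lambda>n. poly_const c * u n) (\<lambda>n. poly_const c * v n)"
  using assms tendsto_mult_right_zero[of "\<lambda>n. max_norm (u n - v n)" sequentially "cmod c"]
  by (simp add: completion_rel_def poly_Cauchy_scale max_norm_scale flip: right_diff_distrib)

lemma completion_rel_star:
  assumes "completion_rel u v"
  shows "completion_rel (\<lambda>n. poly_star (u n)) (\<lambda>n. poly_star (v n))"
  using assms by (simp add: completion_rel_def poly_Cauchy_star max_norm_star flip: poly_star_diff)

lemma completion_rel_minus:
  assumes "completion_rel u v"
  shows "completion_rel (\<lambda>n. - u n) (\<lambda>n. - v n)"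
proof -
  have "max_norm (- u n - - v n) = max_norm (u n - v n)" for n
    using max_norm_minus_commute[of "u n" "v n"] by simp
  then show ?thesis
    using assms by (simp add: completion_rel_def poly_Cauchy_minus)
qed

lemma completion_rel_norm:
  assumes "completion_rel u v"
  shows "lim (\<lambda>n. max_norm (u n)) = lim (\<lambda>n. max_norm (v n))"
proof -
  have "(\<lambda>n. max_norm (u n)) \<longlonglongrightarrow> lim (\<lambda>n. max_norm (u n))"
    using assms by (simp add: completion_rel_def poly_Cauchy_max_norm flip: convergent_LIMSEQ_iff)
  moreover have "(\<lambda>n. max_norm (u n) - max_norm (v n)) \<longlonglongrightarrow> 0"
  proof (rule Lim_null_comparison)
    show "\<forall>\<^sub>F n in sequentially. norm (max_norm (u n) - max_norm (v n)) \<le> max_norm (u n - v n)"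
      by (simp add: max_norm_diff)
    show "(\<lambda>n. max_norm (u n - v n)) \<longlonglongrightarrow> 0"
      using assms by (simp add: completion_rel_def)
  qed
  ultimately have "(\<lambda>n. max_norm (u n) - (max_norm (u n) - max_norm (v n))) \<longlonglongrightarrow> lim (\<lambda>n. max_norm (u n)) - 0"
    by (rule tendsto_diff)
  then show ?thesis by (simp add: limI)
qed

instantiation free_cstar :: (type, finite) complex_vector
begin

lift_definition zero_free_cstar :: "('a, 'b) free_cstar" is "\<lambda>_. 0"
  by (simp add: poly_Cauchy_const)
lift_definition plus_free_cstar :: "('a, 'b) free_cstar \<Rightarrow> ('a, 'b) free_cstar \<Rightarrow> ('a, 'b) free_cstar"
  is "\<lambda>u v n. u n + v n" by (rule completion_rel_add)
lift_definition uminus_free_cstar :: "('a, 'b) free_cstar \<Rightarrow> ('a, 'b) free_cstar"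
  is "\<lambda>u n. - u n" by (rule completion_rel_minus)
lift_definition scaleC_free_cstar :: "complex \<Rightarrow> ('a, 'b) free_cstar \<Rightarrow> ('a, 'b) free_cstar"
  is "\<lambda>c u n. poly_const c * u n" by (rule completion_rel_scale)
definition minus_free_cstar :: "('a, 'b) free_cstar \<Rightarrow> ('a, 'b) free_cstar \<Rightarrow> ('a, 'b) free_cstar"
  where "minus_free_cstar z w = z + - w"
definition scaleR_free_cstar :: "real \<Rightarrow> ('a, 'b) free_cstar \<Rightarrow> ('a, 'b) free_cstar"
  where "scaleR_free_cstar r = scaleC (complex_of_real r)"

instance
proof
  fix x y z :: "('a, 'b) free_cstar" and c d :: complex
  show "x + y + z = x + (y + z)"
    by transfer (simp add: add.assoc poly_Cauchy_add)
  show "x + y = y + x"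
    by transfer (simp add: add.commute[of "_ :: _ ncpoly"] poly_Cauchy_add)
  show "0 + x = x" by transfer simp
  show "- x + x = 0" by transfer (simp add: poly_Cauchy_const)
  show "c *\<^sub>C (x + y) = c *\<^sub>C x + c *\<^sub>C y"
    by transfer (simp add: distrib_left poly_Cauchy_add poly_Cauchy_scale)
  show "(c + d) *\<^sub>C x = c *\<^sub>C x + d *\<^sub>C x"
    by transfer (simp add: poly_const_add distrib_right poly_Cauchy_add poly_Cauchy_scale)
  show "c *\<^sub>C d *\<^sub>C x = (c * d) *\<^sub>C x"
    by transfer (simp add: poly_Cauchy_scale mult.assoc flip: poly_const_mult)
  show "1 *\<^sub>C x = x" by transfer (simp add: poly_const_1)
qed (simp_all add: minus_free_cstar_def scaleR_free_cstar_def)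

end

instantiation free_cstar :: (type, finite) complex_normed_vector
begin

lift_definition norm_free_cstar :: "('a, 'b) free_cstar \<Rightarrow> real" is "\<lambda>u. lim (\<lambda>n. max_norm (u n))"
  by (rule completion_rel_norm)
definition "dist_free_cstar z w = norm (z - w :: ('a, 'b) free_cstar)"
definition "sgn_free_cstar z = inverse (norm z) *\<^sub>R (z :: ('a, 'b) free_cstar)"
definition "(uniformity :: (('a, 'b) free_cstar \<times> ('a, 'b) free_cstar) filter) =
  (INF e\<in>{0<..}. principal {(x, y). dist x y < e})"
definition "open (U :: ('a, 'b) free_cstar set) \<longleftrightarrow>
  (\<forall>x\<in>U. eventually (\<lambda>(x', y). x' = x \<longrightarrow> y \<in> U) uniformity)"

lemma tendsto_norm_free_cstar:
  "poly_Cauchy u \<Longrightarrow> (\<lambda>n. max_norm (u n)) \<longlonglongrightarrow> lim (\<lambda>n. max_norm (u n))"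
  by (simp add: poly_Cauchy_max_norm flip: convergent_LIMSEQ_iff)

instance
proof
  fix z w :: "('a, 'b) free_cstar" and c :: complex
  show "norm z = 0 \<longleftrightarrow> z = 0"
  proof transfer
    fix u :: "nat \<Rightarrow> ('a \<times> 'b) ncpoly" assume "completion_rel u u"
    then have u: "poly_Cauchy u" by simp
    then have "completion_rel u (\<lambda>_. 0) \<longleftrightarrow> (\<lambda>n. max_norm (u n)) \<longlonglongrightarrow> 0"
      by (simp add: completion_rel_def poly_Cauchy_const)
    then show "lim (\<lambda>n. max_norm (u n)) = 0 \<longleftrightarrow> completion_rel u (\<lambda>_. 0)"
      using tendsto_norm_free_cstar[OF u] by (metis limI)
  qed
  show "norm (z + w) \<le> norm z + norm w"
  proof transfer
    fix u v :: "nat \<Rightarrow> ('a \<times> 'b) ncpoly" assume *: "completion_rel u u" "completion_rel v v"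
    show "lim (\<lambda>n. max_norm (u n + v n)) \<le> lim (\<lambda>n. max_norm (u n)) + lim (\<lambda>n. max_norm (v n))"
      by (rule LIMSEQ_le[OF tendsto_norm_free_cstar tendsto_add[OF tendsto_norm_free_cstar tendsto_norm_free_cstar]])
        (use * in \<open>simp_all add: poly_Cauchy_add max_norm_triangle\<close>)
  qed
  show scale: "norm (c *\<^sub>C z) = cmod c * norm z" for c
  proof transfer
    fix c and u :: "nat \<Rightarrow> ('a \<times> 'b) ncpoly" assume *: "completion_rel u u"
    then show "lim (\<lambda>n. max_norm (poly_const c * u n)) = cmod c * lim (\<lambda>n. max_norm (u n))"
      using tendsto_mult_left[OF tendsto_norm_free_cstar, of u "cmod c"] by (simp add: max_norm_scale limI)
  qed
  show "norm (r *\<^sub>R z) = \<bar>r\<bar> * norm z" for r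
    by (simp add: scaleR_free_cstar_def scale)
qed (simp_all add: dist_free_cstar_def sgn_free_cstar_def uniformity_free_cstar_def open_free_cstar_def)

end

lift_definition of_poly :: "('x \<times> 'a::finite) ncpoly \<Rightarrow> ('x, 'a) free_cstar" is "\<lambda>p _. p"
  by (simp add: poly_Cauchy_const)

lemma norm_of_poly: "norm (of_poly p) = max_norm p"
  by transfer simp

lemma of_poly_diff: "of_poly p - of_poly q = of_poly (p - q)"
  unfolding minus_free_cstar_def by transfer (simp add: poly_Cauchy_const)

lemma of_poly_tendsto:
  assumes "poly_Cauchy u"
  shows "(\<lambda>n. of_poly (u n)) \<longlonglongrightarrow> abs_free_cstar u"
  unfolding tendsto_iff dist_norm
proof (intro allI impI)
  fix e :: real assume "e > 0"
  then have e: "e / 2 > 0" by simp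
  obtain M where M: "\<And>m n. m \<ge> M \<Longrightarrow> n \<ge> M \<Longrightarrow> max_norm (u m - u n) < e / 2"
    by (rule poly_CauchyE[OF assms e]) blast
  have "norm (of_poly (u m) - abs_free_cstar u) < e" if "m \<ge> M" for m
  proof -
    have C: "poly_Cauchy (\<lambda>n. u m + - u n)"
      by (intro poly_Cauchy_add poly_Cauchy_minus poly_Cauchy_const assms)
    have "of_poly (u m) - abs_free_cstar u = abs_free_cstar (\<lambda>n. u m + - u n)"
      using assms unfolding minus_free_cstar_def of_poly.abs_eq
      by (simp add: uminus_free_cstar.abs_eq plus_free_cstar.abs_eq poly_Cauchy_const poly_Cauchy_minus)
    then have "norm (of_poly (u m) - abs_free_cstar u) = lim (\<lambda>n. max_norm (u m + - u n))"
      using C by (simp add: norm_free_cstar.abs_eq)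
    also have "\<dots> \<le> e / 2"
      using M that tendsto_norm_free_cstar[OF C]
      by (intro LIMSEQ_le_const2) (auto intro!: exI[of _ M] less_imp_le)
    finally show ?thesis using \<open>e > 0\<close> by simp
  qed
  then show "\<forall>\<^sub>F m in sequentially. norm (of_poly (u m) - abs_free_cstar u) < e"
    unfolding eventually_sequentially by blast
qed

lemma free_cstar_approx:
  obtains u where "poly_Cauchy u" "(\<lambda>n. of_poly (u n)) \<longlonglongrightarrow> z"
proof -
  obtain u where u: "completion_rel u u" "z = abs_free_cstar u"
    by (metis Quotient_free_cstar Quotient_abs_rep Quotient_rep_reflp)
  then show ?thesis using that[of u] of_poly_tendsto[of u] by simp
qed

instantiation free_cstar :: (type, finite) cstar_algebra
begin

lift_definition one_free_cstar :: "('a, 'b) free_cstar" is "\<lambda>_. 1"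
  by (simp add: poly_Cauchy_const)
lift_definition times_free_cstar :: "('a, 'b) free_cstar \<Rightarrow> ('a, 'b) free_cstar \<Rightarrow> ('a, 'b) free_cstar"
  is "\<lambda>u v n. u n * v n" by (rule completion_rel_mult)
lift_definition star_free_cstar :: "('a, 'b) free_cstar \<Rightarrow> ('a, 'b) free_cstar"
  is "\<lambda>u n. poly_star (u n)" by (rule completion_rel_star)

instance
proof
  fix X :: "nat \<Rightarrow> ('a, 'b) free_cstar" assume X: "Cauchy X"
  have "\<exists>p. norm (of_poly p - X n) < inverse (real (Suc n))" for n
  proof -
    obtain u where "(\<lambda>m. of_poly (u m)) \<longlonglongrightarrow> X n" using free_cstar_approx by blast
    then have "\<forall>\<^sub>F m in sequentially. dist (of_poly (u m)) (X n) < inverse (real (Suc n))"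
      by (rule tendstoD) simp
    then show ?thesis unfolding eventually_sequentially dist_norm by blast
  qed
  then obtain q where q: "\<And>n. norm (of_poly (q n) - X n) < inverse (real (Suc n))" by metis
  have lim0: "(\<lambda>n. of_poly (q n) - X n) \<longlonglongrightarrow> 0"
    by (rule Lim_null_comparison[OF _ LIMSEQ_inverse_real_of_nat])
      (use q in \<open>auto intro!: always_eventually less_imp_le\<close>)
  have "poly_Cauchy q"
    unfolding poly_Cauchy_def
  proof (intro allI impI)
    fix e :: real assume "e > 0"
    then have e: "e / 3 > 0" by simp
    obtain M where M: "\<And>m n. m \<ge> M \<Longrightarrow> n \<ge> M \<Longrightarrow> dist (X m) (X n) < e / 3"
      using X e unfolding Cauchy_def by blast
    obtain N where N: "\<And>n. n \<ge> N \<Longrightarrow> norm (of_poly (q n) - X n) < e / 3"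
      using LIMSEQ_D[OF lim0 e] by auto
    have "max_norm (q m - q n) < e" if "m \<ge> max M N" "n \<ge> max M N" for m n
    proof -
      have "max_norm (q m - q n) = norm ((of_poly (q m) - X m) + (X m - X n) - (of_poly (q n) - X n))"
        by (simp add: of_poly_diff norm_of_poly)
      also have "\<dots> \<le> norm (of_poly (q m) - X m) + norm (X m - X n) + norm (of_poly (q n) - X n)"
        by (meson add_right_mono norm_triangle_ineq norm_triangle_ineq4 order_trans)
      also have "\<dots> < e / 3 + e / 3 + e / 3"
        using M[of m n] N[of m] N[of n] that by (intro add_strict_mono) (auto simp: dist_norm)
      finally show ?thesis by simp
    qed
    then show "\<exists>M. \<forall>m\<ge>M. \<forall>n\<ge>M. max_norm (q m - q n) < e" by blast
  qed
  then have "(\<lambda>n. of_poly (q n)) \<longlonglongrightarrow> abs_free_cstar q" by (rule of_poly_tendsto)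
  then have "(\<lambda>n. of_poly (q n) - (of_poly (q n) - X n)) \<longlonglongrightarrow> abs_free_cstar q - 0"
    using lim0 by (rule tendsto_diff)
  then show "convergent X" by (auto simp: convergent_def)
next
  fix x y z :: "('a, 'b) free_cstar" and c :: complex
  show "x * y * z = x * (y * z)" by transfer (simp add: mult.assoc poly_Cauchy_mult)
  show "1 * x = x" "x * 1 = x" by (transfer; simp)+
  show "(x + y) * z = x * z + y * z"
    by transfer (simp add: distrib_right poly_Cauchy_mult poly_Cauchy_add)
  show "x * (y + z) = x * y + x * z"
    by transfer (simp add: distrib_left poly_Cauchy_mult poly_Cauchy_add)
  show "(0 :: ('a, 'b) free_cstar) \<noteq> 1"
    by transfer (simp add: completion_rel_def max_norm_minus max_norm_one LIMSEQ_const_iff)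
  show "c *\<^sub>C x * y = c *\<^sub>C (x * y)"
    by transfer (simp add: mult.assoc poly_Cauchy_mult poly_Cauchy_scale)
  show "x * c *\<^sub>C y = c *\<^sub>C (x * y)"
  proof transfer
    fix c and u v :: "nat \<Rightarrow> ('a \<times> 'b) ncpoly"
    assume "completion_rel u u" "completion_rel v v"
    moreover have "u n * (poly_const c * v n) = poly_const c * (u n * v n)" for n
      by (metis mult.assoc poly_const_commute)
    ultimately show "completion_rel (\<lambda>n. u n * (poly_const c * v n)) (\<lambda>n. poly_const c * (u n * v n))"
      by (simp add: poly_Cauchy_mult poly_Cauchy_scale)
  qed
  show "star (star x) = x" by transfer simp
  show "star (x + y) = star x + star y"
    by transfer (simp add: poly_star_add poly_Cauchy_star poly_Cauchy_add)
  show "star (c *\<^sub>C x) = cnj c *\<^sub>C star x"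
    by transfer (simp add: poly_star_mult poly_star_const poly_const_commute poly_Cauchy_star poly_Cauchy_scale)
  show "star (x * y) = star y * star x"
    by transfer (simp add: poly_star_mult poly_Cauchy_star poly_Cauchy_mult)
  show "norm (x * y) \<le> norm x * norm y"
  proof transfer
    fix u v :: "nat \<Rightarrow> ('a \<times> 'b) ncpoly" assume *: "completion_rel u u" "completion_rel v v"
    show "lim (\<lambda>n. max_norm (u n * v n)) \<le> lim (\<lambda>n. max_norm (u n)) * lim (\<lambda>n. max_norm (v n))"
      by (rule LIMSEQ_le[OF tendsto_norm_free_cstar tendsto_mult[OF tendsto_norm_free_cstar tendsto_norm_free_cstar]])
        (use * in \<open>simp_all add: poly_Cauchy_mult max_norm_mult\<close>)
  qed
  show "norm (star x * x) = (norm x)\<^sup>2"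
  proof transfer
    fix u :: "nat \<Rightarrow> ('a \<times> 'b) ncpoly" assume *: "completion_rel u u"
    then have "(\<lambda>n. (max_norm (u n))\<^sup>2) \<longlonglongrightarrow> (lim (\<lambda>n. max_norm (u n)))\<^sup>2"
      by (intro tendsto_power tendsto_norm_free_cstar) simp
    then show "lim (\<lambda>n. max_norm (poly_star (u n) * u n)) = (lim (\<lambda>n. max_norm (u n)))\<^sup>2"
      by (simp add: max_norm_star_mult limI)
  qed
qed

end


lemma of_poly_add: "of_poly (p + q) = of_poly p + of_poly q"
  by transfer (simp add: poly_Cauchy_const)

lemma of_poly_mult: "of_poly (p * q) = of_poly p * of_poly q"
  by transfer (simp add: poly_Cauchy_const)

lemma of_poly_star: "of_poly (poly_star p) = star (of_poly p)"
  by transfer (simp add: poly_Cauchy_const)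

lemma of_poly_scale: "of_poly (poly_const c * p) = c *\<^sub>C of_poly p"
  by transfer (simp add: poly_Cauchy_const)

lemma of_poly_one: "of_poly 1 = 1"
  by transfer (simp add: poly_Cauchy_const)

lemma of_poly_zero: "of_poly 0 = 0"
  by transfer (simp add: poly_Cauchy_const)

lemma of_poly_sum: "of_poly (sum f S) = (\<Sum>i\<in>S. of_poly (f i))"
  by (induction S rule: infinite_finite_induct) (simp_all add: of_poly_add of_poly_zero)

text \<open>The canonical basis element \<open>e\<^bsub>x,a\<^esub>\<close> of the copy of \<open>\<ell>\<^sup>\<infinity>(A)\<close> indexed by \<open>x\<close>.\<close>

definition free_gen :: "'x \<Rightarrow> 'a::finite \<Rightarrow> ('x, 'a) free_cstar" where
  "free_gen x a = of_poly (poly_gen (x, a))"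

definition gen_span :: "('x, 'a::finite) free_cstar set" where
  "gen_span = cspan {free_gen x a | x a. True}"

text \<open>The generators satisfy the defining relations, and \<open>free_cstar\<close> has the universal property of
  the free product. (Continuity is automatic for *-homomorphisms between C*-algebras; it is only listed
  to keep the uniqueness proof elementary.)\<close>

lemma star_free_gen: "star (free_gen x a) = free_gen x a"
  unfolding free_gen_def
  by (simp add: poly_gen_def poly_star_single word_rev_def flip: of_poly_star)

lemma free_gen_mult: "free_gen x a * free_gen x a' = (if a = a' then free_gen x a else 0)"
proof -
  let ?d = "poly_gen (x, a) * poly_gen (x, a') - (if a = a' then poly_gen (x, a) else 0)"
  have "max_norm ?d = 0"
    by (rule free_seminorm_max_norm[unfolded free_seminorm_def, THEN conjunct2, THEN conjunct1, rule_format])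
  then have "of_poly ?d = 0" using norm_of_poly[of ?d] by simp
  then show ?thesis
    by (simp add: free_gen_def of_poly_mult of_poly_zero flip: of_poly_diff split: if_splits)
qed

lemma sum_free_gen: "(\<Sum>a\<in>UNIV. free_gen x (a :: 'a::finite)) = 1"
proof -
  let ?d = "(\<Sum>a\<in>UNIV. poly_gen (x, a :: 'a)) - 1"
  have "max_norm ?d = 0"
    by (rule free_seminorm_max_norm[unfolded free_seminorm_def, THEN conjunct2, THEN conjunct2, rule_format])
  then have "of_poly ?d = 0" using norm_of_poly[of ?d] by simp
  then show ?thesis
    by (simp add: free_gen_def of_poly_sum of_poly_one flip: of_poly_diff)
qed

lemma tendsto_star:
  fixes l :: "'c::cstar_algebra"
  assumes "w \<longlonglongrightarrow> l"
  shows "(\<lambda>n. star (w n)) \<longlonglongrightarrow> star l"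
proof -
  have "star (w n) - star l = star (w n - l)" for n
    using star_add[of "w n - l" l] by simp
  then have "dist (star (w n)) (star l) = dist (w n) l" for n
    by (simp add: dist_norm norm_star_eq)
  then show ?thesis using assms by (simp add: tendsto_iff)
qed

lemma hom_of_poly:
  assumes "unital_star_hom h" "\<And>x a. h (free_gen x a) = q x a"
  shows "h (of_poly p) = poly_eval (\<lambda>(x, a). q x a) p"
proof (induction p rule: poly_induct)
  case (single w c)
  have word: "h (of_poly (Poly_Mapping.single (Word gs) 1)) = prod_list (map (\<lambda>(x, a). q x a) gs)" for gs
  proof (induction gs)
    case Nil
    then show ?case
      using assms(1) by (simp add: unital_star_hom_def of_poly_one flip: zero_free_word_def)
  next
    case (Cons g gs)
    obtain x a where g: "g = (x, a)" by (cases g)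
    have "Poly_Mapping.single (Word (g # gs)) 1 = poly_gen (x, a) * Poly_Mapping.single (Word gs) 1"
      by (simp add: poly_gen_def mult_single plus_free_word_def g)
    then show ?case
      using assms Cons by (simp add: unital_star_hom_def of_poly_mult g flip: free_gen_def)
  qed
  have "Poly_Mapping.single w c = poly_const c * Poly_Mapping.single (Word (letters w)) 1"
    by (simp add: poly_const_def mult_single)
  then have "h (of_poly (Poly_Mapping.single w c)) = c *\<^sub>C prod_list (map (\<lambda>(x, a). q x a) (letters w))"
    using assms(1) word[of "letters w"] by (simp only: unital_star_hom_def clinear_def of_poly_scale)
  then show ?case by (simp add: poly_eval_single)
next
  case (add p q)
  then show ?case using assms(1) by (simp add: unital_star_hom_def clinear_def of_poly_add poly_eval_add)
qed

theorem free_cstar_universal: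
  fixes q :: "'x \<Rightarrow> 'a::finite \<Rightarrow> 'c::cstar_algebra"
  assumes q: "\<And>x a. star (q x a) = q x a"
    "\<And>x a a'. q x a * q x a' = (if a = a' then q x a else 0)"
    "\<And>x. (\<Sum>a\<in>UNIV. q x a) = 1"
  shows "\<exists>!h. unital_star_hom h \<and> continuous_on UNIV h \<and> (\<forall>x a. h (free_gen x a) = q x a)"
proof -
  define f where "f = poly_eval (\<lambda>(x, a). q x a)"
  have le: "norm (f p) \<le> max_norm p" for p
    unfolding f_def by (rule max_norm_upper[OF free_seminorm_eval[OF q]])
  have f_diff: "f (p - p') = f p - f p'" for p p'
    using poly_eval_add[of _ p "- p'"] by (simp add: f_def poly_eval_uminus)
  have conv: "convergent (\<lambda>n. f (u n))" if u: "poly_Cauchy u" for u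
  proof -
    have "Cauchy (\<lambda>n. f (u n))"
      unfolding Cauchy_def dist_norm
    proof (intro allI impI)
      fix e :: real assume "e > 0"
      then obtain M where "\<And>m n. m \<ge> M \<Longrightarrow> n \<ge> M \<Longrightarrow> max_norm (u m - u n) < e"
        by (rule poly_CauchyE[OF u]) blast
      then show "\<exists>M. \<forall>m\<ge>M. \<forall>n\<ge>M. norm (f (u m) - f (u n)) < e"
        unfolding f_diff[symmetric] using order_le_less_trans[OF le] by blast
    qed
    then show ?thesis by (rule Cauchy_convergent)
  qed
  define h where "h z = lim (\<lambda>n. f (rep_free_cstar z n))" for z
  have h_lim: "(\<lambda>n. f (u n)) \<longlonglongrightarrow> h z" if u: "poly_Cauchy u" "(\<lambda>n. of_poly (u n)) \<longlonglongrightarrow> z" for u z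
  proof -
    define v where "v = rep_free_cstar z"
    have v: "poly_Cauchy v" "abs_free_cstar v = z"
      using Quotient_rep_reflp[OF Quotient_free_cstar, of z] Quotient_abs_rep[OF Quotient_free_cstar, of z]
      by (simp_all add: v_def)
    have "(\<lambda>n. of_poly (u n) - of_poly (v n)) \<longlonglongrightarrow> z - z"
      using of_poly_tendsto[OF v(1)] v(2) by (intro tendsto_diff u) simp
    then have "(\<lambda>n. max_norm (u n - v n)) \<longlonglongrightarrow> 0"
      using tendsto_norm_zero[of "\<lambda>n. of_poly (u n) - of_poly (v n)"] by (simp add: of_poly_diff norm_of_poly)
    then have "(\<lambda>n. f (u n) - f (v n)) \<longlonglongrightarrow> 0"
      by (rule Lim_null_comparison[rotated]) (simp add: le flip: f_diff)
    moreover have "(\<lambda>n. f (v n)) \<longlonglongrightarrow> h z"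
      using conv[OF v(1)] by (simp add: h_def v_def convergent_LIMSEQ_iff)
    ultimately have "(\<lambda>n. f (u n) - f (v n) + f (v n)) \<longlonglongrightarrow> 0 + h z"
      by (rule tendsto_add)
    then show ?thesis by simp
  qed
  have h_poly: "h (of_poly p) = f p" for p
    using LIMSEQ_unique[OF h_lim[OF poly_Cauchy_const tendsto_const] tendsto_const] .
  have h_add: "h (z + w) = h z + h w" for z w
  proof -
    obtain u v where u: "poly_Cauchy u" "(\<lambda>n. of_poly (u n)) \<longlonglongrightarrow> z"
      and v: "poly_Cauchy v" "(\<lambda>n. of_poly (v n)) \<longlonglongrightarrow> w" by (metis free_cstar_approx)
    have "(\<lambda>n. f (u n + v n)) \<longlonglongrightarrow> h (z + w)"
      by (intro h_lim poly_Cauchy_add u v) (simp add: of_poly_add tendsto_add u v)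
    moreover have "(\<lambda>n. f (u n + v n)) \<longlonglongrightarrow> h z + h w"
      unfolding f_def poly_eval_add using tendsto_add[OF h_lim[OF u] h_lim[OF v]] by (simp add: f_def)
    ultimately show ?thesis by (rule LIMSEQ_unique)
  qed
  have h_mult: "h (z * w) = h z * h w" for z w
  proof -
    obtain u v where u: "poly_Cauchy u" "(\<lambda>n. of_poly (u n)) \<longlonglongrightarrow> z"
      and v: "poly_Cauchy v" "(\<lambda>n. of_poly (v n)) \<longlonglongrightarrow> w" by (metis free_cstar_approx)
    have "(\<lambda>n. f (u n * v n)) \<longlonglongrightarrow> h (z * w)"
      by (intro h_lim poly_Cauchy_mult u v) (simp add: of_poly_mult tendsto_mult u v)
    moreover have "(\<lambda>n. f (u n * v n)) \<longlonglongrightarrow> h z * h w"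
      unfolding f_def poly_eval_mult using tendsto_mult[OF h_lim[OF u] h_lim[OF v]] by (simp add: f_def)
    ultimately show ?thesis by (rule LIMSEQ_unique)
  qed
  have h_scale: "h (c *\<^sub>C z) = c *\<^sub>C h z" for c z
  proof -
    have "h (c *\<^sub>C 1) = f (poly_const c * 1)"
      by (simp only: of_poly_scale of_poly_one flip: h_poly)
    also have "\<dots> = c *\<^sub>C 1" by (simp add: f_def poly_eval_const)
    finally have one: "h (c *\<^sub>C 1) = c *\<^sub>C 1" .
    have "h (c *\<^sub>C z) = h ((c *\<^sub>C 1) * z)" by (simp add: mult_scaleC_left)
    also have "\<dots> = c *\<^sub>C h z" unfolding h_mult one by (simp add: mult_scaleC_left)
    finally show ?thesis .
  qed
  have h_star: "h (star z) = star (h z)" for z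
  proof -
    obtain u where u: "poly_Cauchy u" "(\<lambda>n. of_poly (u n)) \<longlonglongrightarrow> z" by (metis free_cstar_approx)
    have "(\<lambda>n. f (poly_star (u n))) \<longlonglongrightarrow> h (star z)"
      by (intro h_lim poly_Cauchy_star u) (simp add: of_poly_star tendsto_star u)
    moreover have "f (poly_star (u n)) = star (f (u n))" for n
      unfolding f_def by (rule poly_eval_star) (auto simp: q(1))
    ultimately show ?thesis using LIMSEQ_unique tendsto_star[OF h_lim[OF u]] by simp
  qed
  have h_one: "h 1 = 1"
    using h_poly[of 1] poly_eval_const[of "\<lambda>(x, a). q x a" 1]
    by (simp add: of_poly_one f_def poly_const_1 scaleC_one)
  have h_norm: "norm (h z) \<le> norm z" for z
  proof -
    obtain u where u: "poly_Cauchy u" "(\<lambda>n. of_poly (u n)) \<longlonglongrightarrow> z" by (metis free_cstar_approx)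
    show ?thesis
      by (rule LIMSEQ_le[OF tendsto_norm[OF h_lim[OF u]] tendsto_norm[OF u(2)]]) (simp add: norm_of_poly le)
  qed
  have hom: "unital_star_hom h"
    by (simp add: unital_star_hom_def clinear_def h_add h_scale h_mult h_star h_one)
  have "h (z - w) = h z - h w" for z w
    using h_add[of "z - w" w] by simp
  then have "dist (h z) (h w) \<le> dist z w" for z w
    unfolding dist_norm by (metis h_norm)
  then have cont: "continuous_on UNIV h"
    unfolding continuous_on_iff by (meson order_le_less_trans)
  have gen: "h (free_gen x a) = q x a" for x a
    by (simp add: free_gen_def h_poly f_def poly_eval_gen)
  show ?thesis
  proof (rule ex1I[of _ h])
    fix g assume g: "unital_star_hom g \<and> continuous_on UNIV g \<and> (\<forall>x a. g (free_gen x a) = q x a)"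
    show "g = h"
    proof
      fix z :: "('x, 'a) free_cstar"
      obtain u where u: "poly_Cauchy u" "(\<lambda>n. of_poly (u n)) \<longlonglongrightarrow> z" by (metis free_cstar_approx)
      have "(\<lambda>n. g (of_poly (u n))) \<longlonglongrightarrow> g z"
        using g u(2) by (intro continuous_on_tendsto_compose[of UNIV g]) auto
      moreover have "g (of_poly (u n)) = f (u n)" for n
        unfolding f_def using g by (intro hom_of_poly) auto
      ultimately show "g z = h z"
        using LIMSEQ_unique h_lim[OF u] by simp
    qed
  qed (use hom cont gen in blast)
qed


section \<open>Correlations and mirror games\<close>

text \<open>Throughout, \<open>p x y a b\<close> stands for \<open>p(a,b|x,y)\<close>, and a rule \<open>\<lambda> : X \<times> Y \<times> A \<times> B \<rightarrow> {0,1}\<close> is a predicate.\<close>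

type_synonym ('x, 'y, 'a, 'b) correlation = "'x \<Rightarrow> 'y \<Rightarrow> 'a \<Rightarrow> 'b \<Rightarrow> real"

definition C_ns :: "('x, 'y, 'a::finite, 'b::finite) correlation set" where
  "C_ns = {p. (\<forall>x y a b. 0 \<le> p x y a b) \<and> (\<forall>x y. (\<Sum>a\<in>UNIV. \<Sum>b\<in>UNIV. p x y a b) = 1) \<and>
     (\<forall>x y y' a. (\<Sum>b\<in>UNIV. p x y a b) = (\<Sum>b\<in>UNIV. p x y' a b)) \<and>
     (\<forall>x x' y b. (\<Sum>a\<in>UNIV. p x y a b) = (\<Sum>a\<in>UNIV. p x' y a b))}"

definition projection :: "nat \<Rightarrow> complex mat \<Rightarrow> bool" where
  "projection n P \<longleftrightarrow> P \<in> carrier_mat n n \<and> mat_adjoint P = P \<and> P * P = P"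

text \<open>The sum is stated entrywise because matrices of varying size form no additive monoid.\<close>

definition PVM :: "nat \<Rightarrow> ('a::finite \<Rightarrow> complex mat) \<Rightarrow> bool" where
  "PVM n P \<longleftrightarrow> (\<forall>a. projection n (P a)) \<and>
     (\<forall>i<n. \<forall>j<n. (\<Sum>a\<in>UNIV. P a $$ (i, j)) = 1\<^sub>m n $$ (i, j))"

definition kronecker :: "complex mat \<Rightarrow> complex mat \<Rightarrow> complex mat" where
  "kronecker P Q = Matrix.mat (dim_row P * dim_row Q) (dim_col P * dim_col Q)
     (\<lambda>(i, j). P $$ (i div dim_row Q, j div dim_col Q) * Q $$ (i mod dim_row Q, j mod dim_col Q))"

text \<open>\<open>H = \<complex>\<^sup>n\<close>, and \<open>H \<otimes> H\<close> is identified with \<open>\<complex>\<^bsup>n\<^sup>2\<^esup>\<close> in the lexicographic order of the basis.\<close>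

definition C_q :: "('x, 'y, 'a::finite, 'b::finite) correlation set" where
  "C_q = {p. \<exists>n P Q \<zeta>. (\<forall>x. PVM n (P x)) \<and> (\<forall>y. PVM n (Q y)) \<and>
     \<zeta> \<in> carrier_vec (n * n) \<and> \<zeta> \<bullet>c \<zeta> = 1 \<and>
     (\<forall>x y a b. complex_of_real (p x y a b) = (kronecker (P x a) (Q y b) *\<^sub>v \<zeta>) \<bullet>c \<zeta>)}"

text \<open>Closure in the product topology, which is the usual topology as the index sets are finite.\<close>

definition C_qa :: "('x::finite, 'y::finite, 'a::finite, 'b::finite) correlation set" where
  "C_qa = closure C_q"

definition perfect_for ::
    "('x \<Rightarrow> 'y \<Rightarrow> 'a \<Rightarrow> 'b \<Rightarrow> bool) \<Rightarrow> ('x, 'y, 'a, 'b) correlation set \<Rightarrow> ('x, 'y, 'a, 'b) correlation set" where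
  "perfect_for lam C = {p \<in> C. \<forall>x y a b. \<not> lam x y a b \<longrightarrow> p x y a b = 0}"

definition mirror_game :: "('x \<Rightarrow> 'y \<Rightarrow> 'a \<Rightarrow> 'b \<Rightarrow> bool) \<Rightarrow> bool" where
  "mirror_game lam \<longleftrightarrow> (\<exists>(\<xi> :: 'x \<Rightarrow> 'y) (\<eta> :: 'y \<Rightarrow> 'x).
     (\<forall>x b a a'. a \<noteq> a' \<longrightarrow> \<not> (lam x (\<xi> x) a b \<and> lam x (\<xi> x) a' b)) \<and>
     (\<forall>y a b b'. b \<noteq> b' \<longrightarrow> \<not> (lam (\<eta> y) y a b \<and> lam (\<eta> y) y a b')))"

end

theory Submission
  imports Defs
begin

text \<open>
  Both conditions say that \<open>p\<close> is a limit of vector states on tensor products of finite-dimensional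
  representations; the mirror property lets one algebra play the part of both parties.

  Write \<open>e\<^sub>x\<^sub>a\<close>, \<open>f\<^sub>y\<^sub>b\<close> for the generators of \<open>\<A> = \<A>(X, A)\<close> and of \<open>\<A>(Y, B)\<close>. Suppose first that \<open>p\<close> is a limit
  of quantum correlations, given by unit vectors \<open>\<Omega>\<close> and projections \<open>P\<^sub>x\<^sub>a\<close>, \<open>Q\<^sub>y\<^sub>b\<close>. For the input pair \<open>(x, \<xi> x)\<close>
  every answer \<open>b\<close> determines the only answer \<open>a = g x b\<close> of positive probability. Hence \<open>P\<^sub>x\<^sub>a \<Omega>\<close> is close to
  \<open>Q'\<^sub>x\<^sub>a \<Omega>\<close>, where \<open>Q'\<^sub>x\<^sub>a\<close> is the sum of \<open>Q\<close> at input \<open>\<xi> x\<close> over all \<open>b\<close> with \<open>g x b = a\<close>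
  (\<open>coarse_graining_close\<close>), and likewise \<open>Q\<^sub>y\<^sub>b \<Omega>\<close> is close to a coarse-graining of the \<open>P\<close> at input \<open>\<eta> y\<close>. The
  second coarse-graining makes sense inside \<open>\<A>\<close> and defines \<open>\<rho>\<close>. The first one makes the second party represent
  \<open>\<A>\<^sup>o\<^sup>p\<close>, so that the vector states live on \<open>\<A> \<otimes> \<A>\<^sup>o\<^sup>p\<close> (\<open>C_q_tensor_representation\<close>). They are bounded by the
  minimal tensor norm, thus they have a pointwise cluster point \<open>\<phi>\<close>, which is bounded as well. In the limit the
  left action of \<open>w\<close> and the right action of \<open>w\<close> on \<open>\<Omega>\<close> agree, first for the generators and then for all \<open>w \<in> \<A>\<close>
  (\<open>defect_tendsto_zero\<close>), and this gives both the trace property of \<open>\<tau>(z) = \<phi>(z \<otimes> 1)\<close> and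
  \<open>\<phi>(z \<otimes> w\<^sup>o\<^sup>p) = \<tau>(zw)\<close> (\<open>C_qa_imp_amenable_trace\<close>).

  Conversely, let \<open>\<tau>\<close> be an amenable trace with functional \<open>\<phi>\<close>, and suppose that \<open>p\<close> is not a limit of quantum
  correlations. These form a convex set, so some linear functional \<open>c\<close> is at most \<open>s\<close> on them and larger than
  \<open>s\<close> at \<open>p\<close>. Let \<open>T\<close> be the element \<open>\<Sum> c(x, y, a, b) e\<^sub>x\<^sub>a \<otimes> \<rho>(f\<^sub>y\<^sub>b)\<^sup>o\<^sup>p + K 1 \<otimes> 1\<close> with a large constant \<open>K\<close>. In every tensor
  representation a unit vector of the algebraic tensor product involves only finitely many vectors on either
  side, and each measurement leaves a finite-dimensional space that contains them invariant. So it defines a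
  quantum correlation (\<open>vector_state_C_q\<close>), and therefore \<open>0 \<le> T \<le> s + K\<close> as operators
  (\<open>projections_norm_bound\<close>). On the other hand \<open>\<phi>\<close> is positive and bounded, hence contractive
  (\<open>amenable_trace_contractive\<close>), which forces \<open>c(p) + K = \<phi>(T) \<le> s + K\<close>, a contradiction.
\<close>

section \<open>Complex linear maps and positive sesquilinear forms\<close>

lemma clinear_zero: "clinear f \<Longrightarrow> f 0 = 0"
  unfolding clinear_def by (metis add_cancel_right_left)

lemma clinear_diff: "clinear f \<Longrightarrow> f (x - y) = f x - f y"
  unfolding clinear_def by (metis add_diff_cancel_right' diff_add_cancel)

lemma clinear_sum: "clinear f \<Longrightarrow> f (sum g S) = (\<Sum>i\<in>S. f (g i))"
  by (induction S rule: infinite_finite_induct) (auto simp: clinear_zero, simp add: clinear_def)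

lemma clinear_sum_list: "clinear f \<Longrightarrow> f (sum_list xs) = sum_list (map f xs)"
  by (induction xs) (auto simp: clinear_zero, simp add: clinear_def)

lemma clinear_add: "clinear f \<Longrightarrow> f (x + y) = f x + f y"
  and clinear_scaleC: "clinear f \<Longrightarrow> f (c *\<^sub>C x) = c *\<^sub>C f x"
  by (simp_all add: clinear_def)

lemma bounded_clinear_clinear: "bounded_clinear f \<Longrightarrow> clinear f"
  by (simp add: bounded_clinear_def)

lemma bounded_clinear_bounded_linear: "bounded_clinear f \<Longrightarrow> bounded_linear f"
  unfolding bounded_clinear_def clinear_def
  by (auto simp: bounded_linear_def bounded_linear_axioms_def scaleR_scaleC intro!: linearI)

lemma bounded_clinear_compose:
  assumes "bounded_clinear f" "bounded_clinear g"
  shows "bounded_clinear (\<lambda>x. f (g x))"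
proof -
  obtain K where "\<And>x. norm (f (g x)) \<le> norm x * K"
    using bounded_linear.bounded[OF bounded_linear_compose[OF assms[THEN bounded_clinear_bounded_linear]]]
    by blast
  then show ?thesis
    using assms by (auto simp: bounded_clinear_def clinear_def)
qed

lemma bounded_clinear_continuous: "bounded_clinear f \<Longrightarrow> continuous_on S f"
  by (rule linear_continuous_on[OF bounded_clinear_bounded_linear])

text \<open>For \<open>t = r cnj (B x y)\<close> with \<open>r\<close> real, positivity of \<open>B (x - t y) (x - t y)\<close> is a quadratic inequality in \<open>r\<close>.
  If \<open>B y y = 0\<close>, then a large \<open>r\<close> forces \<open>B x y = 0\<close>; otherwise \<open>r = 1 / B y y\<close> is the optimal choice.\<close>

lemma Cauchy_Schwarz_form:
  fixes B :: "'v::complex_vector \<Rightarrow> 'v \<Rightarrow> complex"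
  assumes lin: "\<And>x. clinear (B x)" and herm: "\<And>x y. B y x = cnj (B x y)"
    and pos: "\<And>x. 0 \<le> Re (B x x)"
  shows "(cmod (B x y))\<^sup>2 \<le> Re (B x x) * Re (B y y)"
proof -
  define b where "b = B x y"
  have lin1: "B (u - v) w = B u w - B v w" for u v w
    using herm[of "u - v" w] herm[of u w] herm[of v w] by (simp add: clinear_diff[OF lin])
  have scal1: "B (c *\<^sub>C u) w = cnj c * B u w" for c u w
    using herm[of "c *\<^sub>C u" w] herm[of u w] clinear_scaleC[OF lin, of w c u] by (simp add: scaleC_complex_def)
  have scal2: "B w (c *\<^sub>C u) = c * B w u" for c u w
    using clinear_scaleC[OF lin, of w c u] by (simp add: scaleC_complex_def)
  have bb: "b * cnj b = complex_of_real ((cmod b)\<^sup>2)"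
    by (rule complex_norm_square[symmetric])
  have q: "0 \<le> Re (B x x) - 2 * r * (cmod b)\<^sup>2 + r\<^sup>2 * (cmod b)\<^sup>2 * Re (B y y)" for r :: real
  proof -
    define t where "t = complex_of_real r * cnj b"
    have "B (x - t *\<^sub>C y) (x - t *\<^sub>C y) = B x x - t * b - cnj t * cnj b + cnj t * t * B y y"
      unfolding lin1 scal1 scal2 clinear_diff[OF lin] using herm[of x y]
      by (simp add: b_def algebra_simps)
    also have "\<dots> = B x x - 2 * complex_of_real r * (b * cnj b) + (complex_of_real r)\<^sup>2 * (b * cnj b) * B y y"
      by (simp add: t_def algebra_simps power2_eq_square)
    also have "\<dots> = B x x - complex_of_real (2 * r * (cmod b)\<^sup>2) + complex_of_real (r\<^sup>2 * (cmod b)\<^sup>2) * B y y"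
      by (simp add: bb)
    finally show ?thesis using pos[of "x - t *\<^sub>C y"] by simp
  qed
  have "(cmod b)\<^sup>2 \<le> Re (B x x) * Re (B y y)"
  proof (cases "Re (B y y) = 0")
    case True
    have "(cmod b)\<^sup>2 = 0"
    proof (rule ccontr)
      assume "(cmod b)\<^sup>2 \<noteq> 0"
      then show False
        using q[of "(Re (B x x) + 1) / (2 * (cmod b)\<^sup>2)"] True by (simp add: field_simps)
    qed
    then show ?thesis using True by simp
  next
    case False
    then have "Re (B y y) > 0" using pos[of y] by simp
    then show ?thesis
      using q[of "1 / Re (B y y)"] by (simp add: field_simps power2_eq_square)
  qed
  then show ?thesis by (simp add: b_def)
qed

section \<open>Geometry of \<open>\<ell>\<^sup>2(I)\<close>\<close>

lemma coord_add [simp]: "coord (f + g) i = coord f i + coord g i"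
  and coord_scaleC [simp]: "coord (c *\<^sub>C f) i = c * coord f i"
  and coord_zero [simp]: "coord 0 i = 0"
  by (simp_all add: plus_ell2.rep_eq scaleC_ell2.rep_eq zero_ell2.rep_eq)

lemma coord_diff [simp]: "coord (f - g) i = coord f i - coord g i"
  unfolding minus_ell2_def plus_ell2.rep_eq uminus_ell2.rep_eq by simp

lemma coord_sum: "coord (sum f S) i = (\<Sum>k\<in>S. coord (f k) i)"
  by (induction S rule: infinite_finite_induct) auto

lemma ell2_eqI: "(\<And>i. coord f i = coord g i) \<Longrightarrow> f = g"
  by (simp add: coord_inject[symmetric] fun_eq_iff)

lemma coord_square_summable: "(\<lambda>i. (cmod (coord f i))\<^sup>2) summable_on UNIV"
  using coord by blast

lemma norm_ell2_square: "(norm f)\<^sup>2 = (\<Sum>\<^sub>\<infinity>i. (cmod (coord f i))\<^sup>2)"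
  by (simp add: norm_ell2.rep_eq infsum_nonneg)

lemma norm_coord_le: "cmod (coord f i) \<le> norm f"
proof -
  have "(cmod (coord f i))\<^sup>2 \<le> (norm f)\<^sup>2"
    using finite_sum_le_infsum[OF coord_square_summable[of f], of "{i}"] by (simp add: norm_ell2_square)
  then show ?thesis by (rule power2_le_imp_le) simp
qed

lemma cinner_abs_summable: "(\<lambda>i. norm (cnj (coord f i) * coord g i)) summable_on UNIV"
proof (rule summable_on_comparison_test)
  show "(\<lambda>i. (cmod (coord f i))\<^sup>2 + (cmod (coord g i))\<^sup>2) summable_on UNIV"
    by (intro summable_on_add coord_square_summable)
  show "cmod (cnj (coord f i) * coord g i) \<le> (cmod (coord f i))\<^sup>2 + (cmod (coord g i))\<^sup>2" for i
  proof -
    have "2 * (cmod (coord f i) * cmod (coord g i)) \<le> (cmod (coord f i))\<^sup>2 + (cmod (coord g i))\<^sup>2"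
      using sum_squares_bound[of "cmod (coord f i)" "cmod (coord g i)"] by (simp add: mult.assoc)
    moreover have "0 \<le> cmod (coord f i) * cmod (coord g i)" by simp
    ultimately have "cmod (coord f i) * cmod (coord g i) \<le> (cmod (coord f i))\<^sup>2 + (cmod (coord g i))\<^sup>2"
      by linarith
    then show ?thesis by (simp add: norm_mult)
  qed
qed simp

lemma cinner_summable: "(\<lambda>i. cnj (coord f i) * coord g i) summable_on UNIV"
  by (rule abs_summable_summable[OF cinner_abs_summable])

lemma clinear_cinner: "clinear (cinner f)"
proof -
  have "cinner f (g + h) = cinner f g + cinner f h" for g h
    by (simp add: cinner.rep_eq distrib_left infsum_add cinner_summable)
  moreover have "cinner f (c *\<^sub>C g) = c *\<^sub>C cinner f g" for c g
    by (simp add: cinner.rep_eq scaleC_complex_def mult.left_commute[of _ c] infsum_cmult_right')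
  ultimately show ?thesis by (simp add: clinear_def)
qed

lemma cinner_commute: "cinner g f = cnj (cinner f g)"
  by (simp add: cinner.rep_eq mult.commute flip: infsum_cnj)

lemma cinner_self: "cinner f f = complex_of_real ((norm f)\<^sup>2)"
proof -
  have "cinner f f = (\<Sum>\<^sub>\<infinity>i. complex_of_real ((cmod (coord f i))\<^sup>2))"
    unfolding cinner.rep_eq complex_norm_square by (simp only: mult.commute)
  also have "\<dots> = complex_of_real ((norm f)\<^sup>2)"
    unfolding norm_ell2_square
    by (rule infsumI) (rule has_sum_of_real, rule has_sum_infsum, rule coord_square_summable)
  finally show ?thesis .
qed

lemmas cinner_add_right = clinear_add[OF clinear_cinner]
  and cinner_diff_right = clinear_diff[OF clinear_cinner]
  and cinner_sum_right = clinear_sum[OF clinear_cinner]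
  and cinner_zero_right = clinear_zero[OF clinear_cinner]

lemma cinner_scaleC_right: "cinner f (c *\<^sub>C g) = c * cinner f g"
  using clinear_scaleC[OF clinear_cinner] by (simp add: scaleC_complex_def)

lemma cinner_add_left: "cinner (f + g) h = cinner f h + cinner g h"
  by (subst (1 2 3) cinner_commute) (simp add: cinner_add_right)

lemma cinner_diff_left: "cinner (f - g) h = cinner f h - cinner g h"
  by (subst (1 2 3) cinner_commute) (simp add: cinner_diff_right)

lemma cinner_zero_left: "cinner 0 h = 0"
  by (subst cinner_commute) (simp add: cinner_zero_right)

lemma cinner_scaleC_left: "cinner (c *\<^sub>C f) h = cnj c * cinner f h"
  by (subst (1 2) cinner_commute) (simp add: cinner_scaleC_right)

lemma cinner_sum_left: "cinner (sum u S) h = (\<Sum>k\<in>S. cinner (u k) h)"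
  by (subst (1 2) cinner_commute) (simp add: cinner_sum_right)

lemma cmod_cinner_le: "cmod (cinner f g) \<le> norm f * norm g"
proof -
  have "(cmod (cinner f g))\<^sup>2 \<le> (norm f)\<^sup>2 * (norm g)\<^sup>2"
    using Cauchy_Schwarz_form[of cinner f g, OF clinear_cinner cinner_commute]
    by (simp add: cinner_self)
  then have "(cmod (cinner f g))\<^sup>2 \<le> (norm f * norm g)\<^sup>2"
    by (simp add: power_mult_distrib)
  then show ?thesis by (rule power2_le_imp_le) simp
qed

lemma tendsto_cinner:
  fixes f g :: "'i ell2"
  assumes "(u \<longlongrightarrow> f) F" "(v \<longlongrightarrow> g) F"
  shows "((\<lambda>n. cinner (u n) (v n)) \<longlongrightarrow> cinner f g) F"
proof -
  have "bounded_bilinear (cinner :: 'i ell2 \<Rightarrow> 'i ell2 \<Rightarrow> complex)"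
    by (unfold_locales)
      (auto simp: cinner_add_left cinner_add_right scaleR_scaleC cinner_scaleC_left cinner_scaleC_right
        scaleC_complex_def intro!: exI[of _ 1] cmod_cinner_le)
  from bounded_bilinear.tendsto[OF this assms] show ?thesis .
qed

lemma cinner_tensor: "cinner (ell2_tensor \<xi> \<eta>) (ell2_tensor \<xi>' \<eta>') = cinner \<xi> \<xi>' * cinner \<eta> \<eta>'"
proof -
  let ?f = "\<lambda>x. cnj (coord (ell2_tensor \<xi> \<eta>) x) * coord (ell2_tensor \<xi>' \<eta>') x"
  have "(\<Sum>\<^sub>\<infinity>x. ?f x) = (\<Sum>\<^sub>\<infinity>i. \<Sum>\<^sub>\<infinity>j. ?f (i, j))"
    using infsum_Sigma_banach[of ?f UNIV "\<lambda>_. UNIV"] cinner_summable[of "ell2_tensor \<xi> \<eta>" "ell2_tensor \<xi>' \<eta>'"]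
    by simp
  also have "\<dots> = (\<Sum>\<^sub>\<infinity>i. (cnj (coord \<xi> i) * coord \<xi>' i) * cinner \<eta> \<eta>')"
  proof (rule infsum_cong)
    fix i
    have "(\<Sum>\<^sub>\<infinity>j. ?f (i, j)) = (\<Sum>\<^sub>\<infinity>j. (cnj (coord \<xi> i) * coord \<xi>' i) * (cnj (coord \<eta> j) * coord \<eta>' j))"
      by (simp add: ell2_tensor.rep_eq mult_ac)
    then show "(\<Sum>\<^sub>\<infinity>j. ?f (i, j)) = (cnj (coord \<xi> i) * coord \<xi>' i) * cinner \<eta> \<eta>'"
      by (simp add: infsum_cmult_right' cinner.rep_eq)
  qed
  also have "\<dots> = cinner \<xi> \<xi>' * cinner \<eta> \<eta>'"
    by (simp add: infsum_cmult_left' cinner.rep_eq)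
  finally show ?thesis by (simp add: cinner.rep_eq)
qed

lemma clinear_tensor_left: "clinear (\<lambda>\<xi>. ell2_tensor \<xi> \<eta>)"
  by (auto simp: clinear_def ell2_tensor.rep_eq algebra_simps intro!: ell2_eqI split: prod.splits)

lemmas tensor_scaleC_left = clinear_scaleC[OF clinear_tensor_left]
  and tensor_zero_left = clinear_zero[OF clinear_tensor_left]

lift_definition fin_vec :: "'i set \<Rightarrow> ('i \<Rightarrow> complex) \<Rightarrow> 'i ell2" is
  "\<lambda>I f i. if finite I \<and> i \<in> I then f i else 0"
proof -
  fix I :: "'i set" and f
  show "(\<lambda>i. (cmod (if finite I \<and> i \<in> I then f i else 0))\<^sup>2) summable_on UNIV"
  proof (cases "finite I")
    case True
    then have "(\<lambda>i. (cmod (f i))\<^sup>2) summable_on I" by (rule summable_on_finite)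
    then show ?thesis
      by (rule summable_on_cong_neutral[THEN iffD1, rotated -1]) (use True in auto)
  qed simp
qed

lemma coord_fin_vec: "finite I \<Longrightarrow> coord (fin_vec I f) i = (if i \<in> I then f i else 0)"
  by (simp add: fin_vec.rep_eq)

definition basis_vec :: "'i \<Rightarrow> 'i ell2" where
  "basis_vec i = fin_vec {i} (\<lambda>_. 1)"

lemma coord_basis_vec: "coord (basis_vec i) j = (if j = i then 1 else 0)"
  by (simp add: basis_vec_def coord_fin_vec)

lemma tensor_basis_vec: "ell2_tensor (basis_vec i) (basis_vec j) = basis_vec (i, j)"
  by (rule ell2_eqI) (auto simp: ell2_tensor.rep_eq coord_basis_vec split: prod.splits)

lemma fin_vec_sum: "finite I \<Longrightarrow> fin_vec I f = (\<Sum>i\<in>I. f i *\<^sub>C basis_vec i)"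
  by (rule ell2_eqI) (simp add: coord_fin_vec coord_sum coord_basis_vec if_distrib[of "\<lambda>x. _ * x"] cong: if_cong)

lemma cinner_basis_vec: "cinner (basis_vec i) f = coord f i"
proof -
  have "cinner (basis_vec i) f = (\<Sum>\<^sub>\<infinity>j\<in>{i}. coord f j)"
    unfolding cinner.rep_eq by (rule infsum_cong_neutral) (auto simp: coord_basis_vec)
  then show ?thesis by simp
qed

lemma cinner_fin_vec: "finite I \<Longrightarrow> cinner (fin_vec I f) g = (\<Sum>i\<in>I. cnj (f i) * coord g i)"
  by (simp add: fin_vec_sum cinner_sum_left cinner_scaleC_left cinner_basis_vec)

lemma norm_basis_vec: "norm (basis_vec i) = 1"
proof -
  have "complex_of_real ((norm (basis_vec i))\<^sup>2) = complex_of_real 1"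
    using cinner_self[of "basis_vec i"] by (simp add: cinner_basis_vec coord_basis_vec)
  then have "(norm (basis_vec i))\<^sup>2 = 1" by (simp only: of_real_eq_iff)
  then show ?thesis using norm_ge_zero[of "basis_vec i"] by (auto simp: power2_eq_1_iff)
qed

lemma fin_vec_dense: "f \<in> closure {fin_vec I c | I c. finite I}"
  unfolding closure_approachable
proof (intro allI impI)
  fix e :: real assume e: "e > 0"
  let ?g = "\<lambda>i. (cmod (coord f i))\<^sup>2"
  obtain I where I: "finite I" "dist (sum ?g I) (infsum ?g UNIV) < e\<^sup>2"
    using tendstoD[OF has_sum_infsum[OF coord_square_summable[of f], unfolded has_sum_def], of "e\<^sup>2"] e
    by (auto simp: eventually_finite_subsets_at_top)
  have "(norm (f - fin_vec I (coord f)))\<^sup>2 = infsum ?g (UNIV - I)"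
    unfolding norm_ell2_square
    by (rule infsum_cong_neutral) (auto simp: coord_fin_vec I)
  also have "\<dots> = infsum ?g UNIV - sum ?g I"
    by (subst infsum_Diff) (auto intro: coord_square_summable simp: I summable_on_finite)
  also have "\<dots> < e\<^sup>2"
    using I(2) by (simp add: dist_real_def)
  finally have "norm (f - fin_vec I (coord f)) < e"
    using e by (metis power_less_imp_less_base less_imp_le)
  then show "\<exists>y\<in>{fin_vec I c | I c. finite I}. dist y f < e"
    using I(1) by (intro bexI[of _ "fin_vec I (coord f)"]) (auto simp: dist_norm norm_minus_commute)
qed

text \<open>Finite sums of elementary tensors are dense, since they include all vectors with finite support.\<close>

lemma ell2_pair_induct:
  fixes \<zeta> :: "('i \<times> 'j) ell2"
  assumes cl: "closed {\<zeta>. P \<zeta>}"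
    and fin: "\<And>S \<xi> \<eta>. finite S \<Longrightarrow> P (\<Sum>k\<in>(S :: ('i \<times> 'j) set). ell2_tensor (\<xi> k) (\<eta> k))"
  shows "P \<zeta>"
proof -
  have "P (fin_vec S c)" if "finite S" for S and c :: "'i \<times> 'j \<Rightarrow> complex"
  proof -
    have "fin_vec S c = (\<Sum>k\<in>S. ell2_tensor (c k *\<^sub>C basis_vec (fst k)) (basis_vec (snd k)))"
      using that by (simp add: fin_vec_sum tensor_scaleC_left tensor_basis_vec)
    then show ?thesis using fin[OF that] by simp
  qed
  then have "closure {fin_vec I c | I c. finite I} \<subseteq> {\<zeta>. P \<zeta>}"
    by (intro closure_minimal cl) auto
  then show ?thesis using fin_vec_dense[of \<zeta>] by auto
qed

lemma bounded_clinear_eq_on_tensors: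
  assumes S: "bounded_clinear S" and T: "bounded_clinear T"
    and eq: "\<And>\<xi> \<eta>. S (ell2_tensor \<xi> \<eta>) = T (ell2_tensor \<xi> \<eta>)"
  shows "S \<zeta> = T \<zeta>"
proof (induction \<zeta> rule: ell2_pair_induct)
  case 1
  show ?case by (intro closed_Collect_eq bounded_clinear_continuous S T)
next
  case (2 A \<xi> \<eta>)
  show ?case using S T by (simp add: clinear_sum bounded_clinear_def eq)
qed

section \<open>Finite models of quantum correlations\<close>

text \<open>Projection valued measures are given by their matrix entries over an arbitrary index set. This makes direct
  sums, enlargements and changes of basis easy to write down.\<close>

definition pvm :: "'i set \<Rightarrow> ('a::finite \<Rightarrow> 'i \<Rightarrow> 'i \<Rightarrow> complex) \<Rightarrow> bool" where
  "pvm I E \<longleftrightarrow>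
     (\<forall>a. \<forall>i\<in>I. \<forall>j\<in>I. E a j i = cnj (E a i j)) \<and>
     (\<forall>a. \<forall>i\<in>I. \<forall>j\<in>I. (\<Sum>k\<in>I. E a i k * E a k j) = E a i j) \<and>
     (\<forall>i\<in>I. \<forall>j\<in>I. (\<Sum>a\<in>UNIV. E a i j) = of_bool (i = j))"

lemma pvm_herm: "pvm I E \<Longrightarrow> i \<in> I \<Longrightarrow> j \<in> I \<Longrightarrow> E a j i = cnj (E a i j)"
  and pvm_idem: "pvm I E \<Longrightarrow> i \<in> I \<Longrightarrow> j \<in> I \<Longrightarrow> (\<Sum>k\<in>I. E a i k * E a k j) = E a i j"
  and pvm_one: "pvm I E \<Longrightarrow> i \<in> I \<Longrightarrow> j \<in> I \<Longrightarrow> (\<Sum>a\<in>UNIV. E a i j) = of_bool (i = j)"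
  unfolding pvm_def by blast+

text \<open>The number \<open>\<langle>z| P \<otimes> Q |z\<rangle>\<close> in coordinates.\<close>

definition fin_corr ::
    "'i set \<Rightarrow> 'j set \<Rightarrow> ('i \<Rightarrow> 'i \<Rightarrow> complex) \<Rightarrow> ('j \<Rightarrow> 'j \<Rightarrow> complex) \<Rightarrow> ('i \<Rightarrow> 'j \<Rightarrow> complex) \<Rightarrow> complex" where
  "fin_corr I J P Q z = (\<Sum>i\<in>I. \<Sum>j\<in>J. \<Sum>k\<in>I. \<Sum>l\<in>J. cnj (z i j) * P i k * Q j l * z k l)"

definition fin_model ::
    "'i set \<Rightarrow> 'j set \<Rightarrow> ('x \<Rightarrow> 'a::finite \<Rightarrow> 'i \<Rightarrow> 'i \<Rightarrow> complex) \<Rightarrow> ('y \<Rightarrow> 'b::finite \<Rightarrow> 'j \<Rightarrow> 'j \<Rightarrow> complex) \<Rightarrow>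
     ('i \<Rightarrow> 'j \<Rightarrow> complex) \<Rightarrow> ('x, 'y, 'a, 'b) correlation \<Rightarrow> bool" where
  "fin_model I J P Q z q \<longleftrightarrow> finite I \<and> finite J \<and> (\<forall>x. pvm I (P x)) \<and> (\<forall>y. pvm J (Q y)) \<and>
     (\<Sum>i\<in>I. \<Sum>j\<in>J. (cmod (z i j))\<^sup>2) = 1 \<and>
     (\<forall>x y a b. complex_of_real (q x y a b) = fin_corr I J (P x a) (Q y b) z)"

lemma square_index_less:
  assumes "i < n" "j < n"
  shows "i * n + j < n * (n :: nat)"
proof -
  have "Suc i * n \<le> n * n"
    using assms by (intro mult_le_mono1) simp
  then show ?thesis using assms by simp
qed

lemma sum_square_index: "(\<Sum>m<n * n. f m) = (\<Sum>i<n. \<Sum>j<n. f (i * n + j :: nat))"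
proof -
  have "bij_betw (\<lambda>(i, j). i * n + j) ({..<n} \<times> {..<n}) {..<n * n}"
  proof (rule bij_betw_byWitness[where f' = "\<lambda>m. (m div n, m mod n)"])
    show "(\<lambda>(i, j). i * n + j) ` ({..<n} \<times> {..<n}) \<subseteq> {..<n * n}"
      by (auto simp: square_index_less)
    show "(\<lambda>m. (m div n, m mod n)) ` {..<n * n} \<subseteq> {..<n} \<times> {..<n}"
      by (auto simp: less_mult_imp_div_less) (metis mod_less_divisor mult_0_right not_less_zero gr0I)
  qed auto
  from sum.reindex_bij_betw[OF this, of f, symmetric] show ?thesis
    by (simp add: sum.cartesian_product case_prod_unfold)
qed

lemma kronecker_cinner:
  assumes P: "P \<in> carrier_mat n n" and Q: "Q \<in> carrier_mat n n" and \<zeta>: "\<zeta> \<in> carrier_vec (n * n)"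
  shows "(kronecker P Q *\<^sub>v \<zeta>) \<bullet>c \<zeta> =
    fin_corr {..<n} {..<n} (\<lambda>i k. P $$ (i, k)) (\<lambda>j l. Q $$ (j, l)) (\<lambda>i j. \<zeta> $ (i * n + j))"
proof -
  have "(kronecker P Q *\<^sub>v \<zeta>) \<bullet>c \<zeta> =
      (\<Sum>m<n * n. (\<Sum>m'<n * n. P $$ (m div n, m' div n) * Q $$ (m mod n, m' mod n) * \<zeta> $ m') * cnj (\<zeta> $ m))"
    using assms by (simp add: kronecker_def scalar_prod_def mult_mat_vec_def atLeast0LessThan row_def)
  also have "\<dots> = (\<Sum>i<n. \<Sum>j<n. (\<Sum>k<n. \<Sum>l<n. P $$ (i, k) * Q $$ (j, l) * \<zeta> $ (k * n + l)) * cnj (\<zeta> $ (i * n + j)))"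
    unfolding sum_square_index by (intro sum.cong refl) auto
  also have "\<dots> = fin_corr {..<n} {..<n} (\<lambda>i k. P $$ (i, k)) (\<lambda>j l. Q $$ (j, l)) (\<lambda>i j. \<zeta> $ (i * n + j))"
    unfolding fin_corr_def sum_distrib_right by (intro sum.cong refl) (simp add: mult_ac)
  finally show ?thesis .
qed

lemma vec_norm_square_sum:
  assumes "\<zeta> \<in> carrier_vec (n * n)"
  shows "\<zeta> \<bullet>c \<zeta> = complex_of_real (\<Sum>i<n. \<Sum>j<n. (cmod (\<zeta> $ (i * n + j)))\<^sup>2)"
proof -
  have "\<zeta> \<bullet>c \<zeta> = (\<Sum>m<n * n. complex_of_real ((cmod (\<zeta> $ m))\<^sup>2))"
    using assms unfolding complex_norm_square by (simp add: scalar_prod_def atLeast0LessThan)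
  then show ?thesis by (simp add: sum_square_index)
qed

lemma pvm_PVM:
  assumes "\<And>a. P a \<in> carrier_mat n n"
  shows "PVM n P \<longleftrightarrow> pvm {..<n} (\<lambda>a i j. P a $$ (i, j))"
proof -
  have d: "dim_row (P a) = n" "dim_col (P a) = n" for a using assms[of a] by auto
  have adj: "mat_adjoint (P a) = P a \<longleftrightarrow> (\<forall>i\<in>{..<n}. \<forall>j\<in>{..<n}. P a $$ (j, i) = cnj (P a $$ (i, j)))" for a
  proof -
    have "mat_adjoint (P a) = P a \<longleftrightarrow> (\<forall>i<n. \<forall>j<n. cnj (P a $$ (j, i)) = P a $$ (i, j))"
      by (simp add: mat_eq_iff d mat_adjoint_def mat_of_rows_def)
    then show ?thesis by (metis complex_cnj_cnj lessThan_iff)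
  qed
  have idem: "P a * P a = P a \<longleftrightarrow>
      (\<forall>i\<in>{..<n}. \<forall>j\<in>{..<n}. (\<Sum>k<n. P a $$ (i, k) * P a $$ (k, j)) = P a $$ (i, j))" for a
    unfolding mat_eq_iff by (simp add: d scalar_prod_def row_def col_def atLeast0LessThan Ball_def)
  have one: "(\<forall>i<n. \<forall>j<n. (\<Sum>a\<in>UNIV. P a $$ (i, j)) = 1\<^sub>m n $$ (i, j)) \<longleftrightarrow>
      (\<forall>i\<in>{..<n}. \<forall>j\<in>{..<n}. (\<Sum>a\<in>UNIV. P a $$ (i, j)) = of_bool (i = j))"
    by (simp add: Ball_def of_bool_def)
  show ?thesis
    unfolding PVM_def projection_def pvm_def adj idem one using assms by blast
qed

lemma C_q_fin_model:
  assumes "q \<in> C_q"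
  obtains n P Q z where "fin_model {..<n :: nat} {..<n :: nat} P Q z q"
proof -
  obtain n P Q \<zeta> where P: "\<And>x. PVM n (P x)" and Q: "\<And>y. PVM n (Q y)" and \<zeta>: "\<zeta> \<in> carrier_vec (n * n)"
    "\<zeta> \<bullet>c \<zeta> = 1" and q: "\<And>x y a b. complex_of_real (q x y a b) = (kronecker (P x a) (Q y b) *\<^sub>v \<zeta>) \<bullet>c \<zeta>"
    using assms unfolding C_q_def by blast
  have c: "P x a \<in> carrier_mat n n" "Q y b \<in> carrier_mat n n" for x y a b
    using P[of x] Q[of y] by (simp_all add: PVM_def projection_def)
  have "complex_of_real (\<Sum>i<n. \<Sum>j<n. (cmod (\<zeta> $ (i * n + j)))\<^sup>2) = 1"
    using \<zeta> by (simp only: vec_norm_square_sum)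
  then have "(\<Sum>i<n. \<Sum>j<n. (cmod (\<zeta> $ (i * n + j)))\<^sup>2) = 1"
    by (simp only: of_real_eq_1_iff)
  then have "fin_model {..<n} {..<n} (\<lambda>x a i j. P x a $$ (i, j)) (\<lambda>y b i j. Q y b $$ (i, j))
      (\<lambda>i j. \<zeta> $ (i * n + j)) q"
    using P Q c unfolding fin_model_def
    by (simp add: pvm_PVM[symmetric] q kronecker_cinner[OF c(1) c(2) \<zeta>(1)])
  then show ?thesis by (rule that)
qed

lemma fin_model_square_C_q:
  assumes "fin_model {..<n :: nat} {..<n :: nat} P Q z q"
  shows "q \<in> C_q"
proof -
  define P' where "P' x a = Matrix.mat n n (\<lambda>(i, j). P x a i j)" for x a
  define Q' where "Q' y b = Matrix.mat n n (\<lambda>(i, j). Q y b i j)" for y b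
  define \<zeta> where "\<zeta> = Matrix.vec (n * n) (\<lambda>m. z (m div n) (m mod n))"
  have c: "P' x a \<in> carrier_mat n n" "Q' y b \<in> carrier_mat n n" "\<zeta> \<in> carrier_vec (n * n)" for x y a b
    by (simp_all add: P'_def Q'_def \<zeta>_def)
  have zz: "\<zeta> $ (i * n + j) = z i j" if "i < n" "j < n" for i j
    using that by (simp add: \<zeta>_def square_index_less)
  have "pvm {..<n} (\<lambda>a i j. P' x a $$ (i, j)) \<longleftrightarrow> pvm {..<n} (P x)" for x
    unfolding pvm_def P'_def by simp
  moreover have "pvm {..<n} (\<lambda>b i j. Q' y b $$ (i, j)) \<longleftrightarrow> pvm {..<n} (Q y)" for y
    unfolding pvm_def Q'_def by simp
  moreover have "\<zeta> \<bullet>c \<zeta> = 1"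
    using assms by (simp add: vec_norm_square_sum[OF c(3)] zz fin_model_def flip: of_real_sum of_real_power)
  moreover have "complex_of_real (q x y a b) = (kronecker (P' x a) (Q' y b) *\<^sub>v \<zeta>) \<bullet>c \<zeta>" for x y a b
  proof -
    have "fin_corr {..<n} {..<n} (\<lambda>i k. P' x a $$ (i, k)) (\<lambda>j l. Q' y b $$ (j, l)) (\<lambda>i j. \<zeta> $ (i * n + j))
        = fin_corr {..<n} {..<n} (P x a) (Q y b) z"
      unfolding fin_corr_def by (intro sum.cong refl) (simp add: zz P'_def Q'_def)
    then show ?thesis using assms by (simp add: kronecker_cinner[OF c] fin_model_def)
  qed
  ultimately show ?thesis
    using assms c unfolding C_q_def fin_model_def
    by (intro CollectI exI[of _ n] exI[of _ P'] exI[of _ Q'] exI[of _ \<zeta>]) (auto simp: pvm_PVM)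
qed

lemma pvm_reindex:
  assumes e: "bij_betw e I' I" and E: "pvm I E"
  shows "pvm I' (\<lambda>a i j. E a (e i) (e j))"
proof -
  have i: "e i \<in> I" if "i \<in> I'" for i using e that by (auto simp: bij_betw_def)
  show ?thesis
    unfolding pvm_def
  proof (intro conjI allI ballI)
    fix a i j assume ij: "i \<in> I'" "j \<in> I'"
    show "E a (e j) (e i) = cnj (E a (e i) (e j))"
      by (rule pvm_herm[OF E]) (use i ij in auto)
    have "(\<Sum>k\<in>I'. E a (e i) (e k) * E a (e k) (e j)) = (\<Sum>k\<in>I. E a (e i) k * E a k (e j))"
      by (rule sum.reindex_bij_betw[OF e])
    then show "(\<Sum>k\<in>I'. E a (e i) (e k) * E a (e k) (e j)) = E a (e i) (e j)"
      using i ij by (simp add: pvm_idem[OF E])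
    have "e i = e j \<longleftrightarrow> i = j"
      using e ij by (auto simp: bij_betw_def inj_on_def)
    then show "(\<Sum>a\<in>UNIV. E a (e i) (e j)) = of_bool (i = j)"
      using i ij by (simp add: pvm_one[OF E])
  qed
qed

lemma fin_model_reindex:
  assumes e: "bij_betw e I' I" and d: "bij_betw d J' J" and m: "fin_model I J P Q z q"
  shows "fin_model I' J' (\<lambda>x a i k. P x a (e i) (e k)) (\<lambda>y b j l. Q y b (d j) (d l)) (\<lambda>i j. z (e i) (d j)) q"
proof -
  note re = sum.reindex_bij_betw[OF e, symmetric] and rd = sum.reindex_bij_betw[OF d, symmetric]
  have "finite I'" "finite J'"
    using m bij_betw_finite[OF e] bij_betw_finite[OF d] by (auto simp: fin_model_def)
  moreover have "(\<Sum>i\<in>I'. \<Sum>j\<in>J'. (cmod (z (e i) (d j)))\<^sup>2) = 1"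
    using m by (simp add: fin_model_def re rd)
  moreover have "fin_corr I J (P x a) (Q y b) z =
      fin_corr I' J' (\<lambda>i k. P x a (e i) (e k)) (\<lambda>j l. Q y b (d j) (d l)) (\<lambda>i j. z (e i) (d j))" for x y a b
    unfolding fin_corr_def by (simp only: re rd)
  moreover have "pvm I' (\<lambda>a i k. P x a (e i) (e k))" "pvm J' (\<lambda>b j l. Q y b (d j) (d l))" for x y
    using m by (auto simp: fin_model_def intro!: pvm_reindex[OF e] pvm_reindex[OF d])
  ultimately show ?thesis
    using m by (simp add: fin_model_def)
qed

text \<open>Enlarging the space: the outcome \<open>undefined\<close> absorbs the identity on the complement.\<close>

definition pad :: "'i set \<Rightarrow> ('a \<Rightarrow> 'i \<Rightarrow> 'i \<Rightarrow> complex) \<Rightarrow> 'a \<Rightarrow> 'i \<Rightarrow> 'i \<Rightarrow> complex" where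
  "pad I E a i j = (if i \<in> I \<and> j \<in> I then E a i j else of_bool (i = j \<and> a = undefined))"

lemma pvm_pad:
  assumes E: "pvm I E" and I: "I \<subseteq> I'" "finite I'"
  shows "pvm I' (pad I E)"
  unfolding pvm_def
proof (intro conjI allI ballI)
  fix a i j assume ij: "i \<in> I'" "j \<in> I'"
  show "pad I E a j i = cnj (pad I E a i j)"
  proof (cases "i \<in> I \<and> j \<in> I")
    case True
    then show ?thesis by (simp add: pad_def) (rule pvm_herm[OF E]; simp)
  qed (auto simp: pad_def)
  show "(\<Sum>a\<in>UNIV. pad I E a i j) = of_bool (i = j)"
  proof (cases "i \<in> I \<and> j \<in> I")
    case True
    then show ?thesis using pvm_one[OF E, of i j] by (simp add: pad_def)
  next
    case False
    then have "pad I E a i j = of_bool (i = j \<and> a = undefined)" for a by (auto simp: pad_def)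
    then show ?thesis by (simp add: of_bool_def)
  qed
  show "(\<Sum>k\<in>I'. pad I E a i k * pad I E a k j) = pad I E a i j"
  proof (cases "i \<in> I \<and> j \<in> I")
    case True
    have "(\<Sum>k\<in>I'. pad I E a i k * pad I E a k j) = (\<Sum>k\<in>I. E a i k * E a k j)"
      by (rule sum.mono_neutral_cong_right) (use I True in \<open>auto simp: pad_def\<close>)
    then show ?thesis using True pvm_idem[OF E, of i j] by (simp add: pad_def)
  next
    case False
    then consider "i \<notin> I" | "j \<notin> I" by blast
    then show ?thesis
    proof cases
      case 1
      have "(\<Sum>k\<in>I'. pad I E a i k * pad I E a k j) = (\<Sum>k\<in>{i}. pad I E a i k * pad I E a k j)"
        by (rule sum.mono_neutral_right) (use I 1 ij in \<open>auto simp: pad_def\<close>)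
      then show ?thesis using 1 by (auto simp: pad_def)
    next
      case 2
      have "(\<Sum>k\<in>I'. pad I E a i k * pad I E a k j) = (\<Sum>k\<in>{j}. pad I E a i k * pad I E a k j)"
        by (rule sum.mono_neutral_right) (use I 2 ij in \<open>auto simp: pad_def\<close>)
      then show ?thesis using 2 by (auto simp: pad_def)
    qed
  qed
qed

lemma fin_corr_mono_neutral:
  assumes "I \<subseteq> I'" "J \<subseteq> J'" "finite I'" "finite J'"
    and z: "\<And>i j. \<not> (i \<in> I \<and> j \<in> J) \<Longrightarrow> z i j = 0"
  shows "fin_corr I' J' P Q z = fin_corr I J P Q z"
  unfolding fin_corr_def
  by (intro sum.mono_neutral_cong_right assms) (auto simp: z intro!: sum.neutral)

lemma fin_corr_cong:
  assumes "\<And>i k. i \<in> I \<Longrightarrow> k \<in> I \<Longrightarrow> P i k = P' i k" "\<And>j l. j \<in> J \<Longrightarrow> l \<in> J \<Longrightarrow> Q j l = Q' j l"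
    "\<And>i j. i \<in> I \<Longrightarrow> j \<in> J \<Longrightarrow> z i j = z' i j"
  shows "fin_corr I J P Q z = fin_corr I J P' Q' z'"
  unfolding fin_corr_def by (intro sum.cong refl) (simp add: assms)

text \<open>Measurements for different inputs may act on different spaces \<open>I x\<close>, \<open>J y\<close>, as long as the state lives on
  spaces \<open>I0\<close>, \<open>J0\<close> that are contained in all of them: outside of these it cannot see the measurements.\<close>

lemma fin_model_padI:
  fixes P :: "'x::finite \<Rightarrow> 'a::finite \<Rightarrow> 'i \<Rightarrow> 'i \<Rightarrow> complex"
    and Q :: "'y::finite \<Rightarrow> 'b::finite \<Rightarrow> 'j \<Rightarrow> 'j \<Rightarrow> complex"
  assumes P: "\<And>x. pvm (I x) (P x)" and Q: "\<And>y. pvm (J y) (Q y)"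
    and sub: "\<And>x. I0 \<subseteq> I x" "\<And>y. J0 \<subseteq> J y" "\<And>x. I x \<subseteq> I'" "\<And>y. J y \<subseteq> J'"
    and fin: "finite I'" "finite J'"
    and z: "(\<Sum>i\<in>I0. \<Sum>j\<in>J0. (cmod (z i j))\<^sup>2) = 1"
    and q: "\<And>x y a b. complex_of_real (q x y a b) = fin_corr I0 J0 (P x a) (Q y b) z"
  shows "fin_model I' J' (\<lambda>x. pad (I x) (P x)) (\<lambda>y. pad (J y) (Q y))
    (\<lambda>i j. if i \<in> I0 \<and> j \<in> J0 then z i j else 0) q"
proof -
  let ?z = "\<lambda>i j. if i \<in> I0 \<and> j \<in> J0 then z i j else 0"
  have sub': "I0 \<subseteq> I'" "J0 \<subseteq> J'" using sub by blast+
  have "fin_corr I' J' (pad (I x) (P x) a) (pad (J y) (Q y) b) ?z = fin_corr I0 J0 (P x a) (Q y b) z" for x y a b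
    using sub(1)[of x] sub(2)[of y]
    by (subst fin_corr_mono_neutral[OF sub' fin]) (auto simp: pad_def intro!: fin_corr_cong)
  moreover have "(\<Sum>i\<in>I'. \<Sum>j\<in>J'. (cmod (?z i j))\<^sup>2) = (\<Sum>i\<in>I0. \<Sum>j\<in>J0. (cmod (z i j))\<^sup>2)"
    by (intro sum.mono_neutral_cong_right sub' fin) (auto intro!: sum.neutral)
  ultimately show ?thesis
    using z q P Q sub fin by (simp add: fin_model_def pvm_pad)
qed

lemma fin_model_C_q:
  fixes q :: "('x::finite, 'y::finite, 'a::finite, 'b::finite) correlation"
  assumes m: "fin_model I J P Q z q"
  shows "q \<in> C_q"
proof -
  define n where "n = max (card I) (card J)"
  have "finite I" "finite J" using m by (auto simp: fin_model_def)
  then obtain e d where e: "bij_betw e {..<card I} I" and d: "bij_betw d {..<card J} J"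
    by (metis ex_bij_betw_nat_finite atLeast0LessThan)
  define P' where "P' x a i k = P x a (e i) (e k)" for x a i k
  define Q' where "Q' y b j l = Q y b (d j) (d l)" for y b j l
  have m': "fin_model {..<card I} {..<card J} P' Q' (\<lambda>i j. z (e i) (d j)) q"
    unfolding P'_def Q'_def by (rule fin_model_reindex[OF e d m])
  have "\<exists>P Q w. fin_model {..<n} {..<n} P Q w q"
    by (intro exI)
      (rule fin_model_padI[of "\<lambda>_. {..<card I}" P' "\<lambda>_. {..<card J}" Q' "{..<card I}" "{..<card J}"],
        use m' in \<open>auto simp: fin_model_def n_def\<close>)
  then show ?thesis using fin_model_square_C_q by blast
qed

lemma C_q_fin_model_infinite:
  assumes q: "q \<in> C_q" and "infinite (UNIV :: 'i set)" "infinite (UNIV :: 'j set)"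
  obtains I :: "'i set" and J :: "'j set" and P Q z where "fin_model I J P Q z q"
proof -
  obtain n P Q z where m: "fin_model {..<n :: nat} {..<n :: nat} P Q z q"
    by (rule C_q_fin_model[OF q])
  obtain f :: "nat \<Rightarrow> 'i" and g :: "nat \<Rightarrow> 'j" where f: "inj f" and g: "inj g"
    using infinite_countable_subset assms(2,3) by metis
  have "bij_betw (inv_into UNIV f) (f ` {..<n}) {..<n}" "bij_betw (inv_into UNIV g) (g ` {..<n}) {..<n}"
    using f g by (auto intro!: bij_betw_imageI simp: inj_on_def image_image)
  from that[OF fin_model_reindex[OF this m]] show ?thesis .
qed

definition dsum :: "('a \<Rightarrow> 'i \<Rightarrow> 'i \<Rightarrow> complex) \<Rightarrow> ('a \<Rightarrow> 'j \<Rightarrow> 'j \<Rightarrow> complex) \<Rightarrow> 'a \<Rightarrow> 'i + 'j \<Rightarrow> 'i + 'j \<Rightarrow> complex"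
  where "dsum E E' a i j =
    (case (i, j) of (Inl i, Inl j) \<Rightarrow> E a i j | (Inr i, Inr j) \<Rightarrow> E' a i j | _ \<Rightarrow> 0)"

lemma pvm_dsum:
  assumes E: "pvm I E" "finite I" and E': "pvm J E'" "finite J"
  shows "pvm (I <+> J) (dsum E E')"
  unfolding pvm_def
proof (intro conjI allI ballI)
  fix a i j assume ij: "i \<in> I <+> J" "j \<in> I <+> J"
  show "dsum E E' a j i = cnj (dsum E E' a i j)"
    using ij pvm_herm[OF E(1), of _ _ a] pvm_herm[OF E'(1), of _ _ a] by (auto simp: dsum_def split: sum.splits)
  show "(\<Sum>k\<in>I <+> J. dsum E E' a i k * dsum E E' a k j) = dsum E E' a i j"
    using ij E(2) E'(2) by (auto simp: dsum_def sum.Plus pvm_idem[OF E(1)] pvm_idem[OF E'(1)])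
  show "(\<Sum>a\<in>UNIV. dsum E E' a i j) = of_bool (i = j)"
    using ij by (auto simp: dsum_def pvm_one[OF E(1)] pvm_one[OF E'(1)])
qed

text \<open>The convex combination is realised by the state \<open>s\<^sup>1\<^sup>/\<^sup>2 z + t\<^sup>1\<^sup>/\<^sup>2 z'\<close> on the direct sum; its mixed components
  vanish, so there are no cross terms.\<close>

lemma C_q_convex:
  fixes q q' :: "('x::finite, 'y::finite, 'a::finite, 'b::finite) correlation"
  assumes "q \<in> C_q" "q' \<in> C_q" and s: "0 \<le> s" "0 \<le> t" "s + t = 1"
  shows "(\<lambda>x y a b. s * q x y a b + t * q' x y a b) \<in> C_q"
proof -
  obtain n P Q z where m: "fin_model {..<n :: nat} {..<n :: nat} P Q z q"
    by (rule C_q_fin_model[OF assms(1)])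
  obtain n' P' Q' z' where m': "fin_model {..<n' :: nat} {..<n' :: nat} P' Q' z' q'"
    by (rule C_q_fin_model[OF assms(2)])
  define w where "w i j = (case (i, j) of (Inl i, Inl j) \<Rightarrow> complex_of_real (sqrt s) * z i j
    | (Inr i, Inr j) \<Rightarrow> complex_of_real (sqrt t) * z' i j | _ \<Rightarrow> 0)" for i j
  let ?K = "{..<n} <+> {..<n'}"
  have w: "(\<Sum>i\<in>?K. \<Sum>j\<in>?K. (cmod (w i j))\<^sup>2) = 1"
    using m m' s
    by (simp add: w_def sum.Plus o_def norm_mult power_mult_distrib fin_model_def flip: sum_distrib_left)
  have "fin_corr ?K ?K (dsum (P x) (P' x) a) (dsum (Q y) (Q' y) b) w =
      complex_of_real s * fin_corr {..<n} {..<n} (P x a) (Q y b) z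
      + complex_of_real t * fin_corr {..<n'} {..<n'} (P' x a) (Q' y b) z'" for x y a b
  proof -
    have s2: "complex_of_real (sqrt r) * u * v * v' * (complex_of_real (sqrt r) * u') = complex_of_real r * (u * v * v' * u')"
      if "0 \<le> r" for r u v v' u'
    proof -
      have "complex_of_real r = complex_of_real (sqrt r) * complex_of_real (sqrt r)"
        using that by (simp flip: of_real_mult)
      then show ?thesis by (simp only: mult_ac)
    qed
    show ?thesis
      by (simp add: fin_corr_def sum.Plus o_def dsum_def w_def s2[OF s(1)] s2[OF s(2)] sum_distrib_left)
  qed
  then have "fin_model ?K ?K (\<lambda>x. dsum (P x) (P' x)) (\<lambda>y. dsum (Q y) (Q' y)) w
      (\<lambda>x y a b. s * q x y a b + t * q' x y a b)"
    using m m' w by (simp add: fin_model_def pvm_dsum)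
  then show ?thesis by (rule fin_model_C_q)
qed

section \<open>Positive functionals and square roots\<close>

lemma star_power: "star (h ^ n) = star h ^ n" for h :: "'a::cstar_algebra"
  by (induction n) (simp_all add: star_one star_mult power_commutes)

lemma star_zero: "star 0 = (0 :: 'a::cstar_algebra)"
  using star_add[of 0 "0 :: 'a"] by simp

lemma star_sum: "star (sum f S) = (\<Sum>i\<in>S. star (f i :: 'a::cstar_algebra))"
  by (induction S rule: infinite_finite_induct) (simp_all add: star_zero star_add)

lemma star_scaleR: "star (r *\<^sub>R x) = r *\<^sub>R star (x :: 'a::cstar_algebra)"
  by (simp add: scaleR_scaleC star_scaleC)

lemma abs_gbinomial_half_le: "\<bar>(1 / 2 :: real) gchoose n\<bar> \<le> 1"
proof (induction n)
  case (Suc n)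
  have "(1 / 2 :: real) gchoose Suc n = (1 / 2 gchoose n) * ((1 / 2 - real n) / real (Suc n))"
    using gbinomial_absorption'[of "Suc n" "1 / 2 :: real"] gbinomial_mult_1[of "1 / 2 :: real" n]
    by (simp add: field_simps)
  moreover have "\<bar>(1 / 2 - real n) / real (Suc n)\<bar> \<le> 1"
    by (auto simp: field_simps abs_if)
  ultimately show ?case
    using Suc mult_mono[OF Suc, of "\<bar>(1 / 2 - real n) / real (Suc n)\<bar>" 1] by (simp add: abs_mult)
qed simp

text \<open>The binomial series of \<open>(1 - h)\<^sup>1\<^sup>/\<^sup>2\<close> has coefficients of absolute value at most 1, so that it converges absolutely,
  and Vandermonde's identity identifies its Cauchy square with \<open>1 - h\<close>.\<close>

lemma square_root_one_minus:
  fixes h :: "'a::cstar_algebra"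
  assumes h: "star h = h" "norm h < 1"
  shows "\<exists>b. star b = b \<and> b * b = 1 - h"
proof -
  define c :: "nat \<Rightarrow> real" where "c n = (- 1) ^ n * ((1 / 2) gchoose n)" for n
  define u where "u n = c n *\<^sub>R h ^ n" for n
  have conv: "(\<Sum>i\<le>n. c i * c (n - i)) = (- 1) ^ n * (1 gchoose n)" for n
  proof -
    have "(\<Sum>i\<le>n. c i * c (n - i)) = (\<Sum>i\<le>n. (- 1) ^ n * (((1 / 2) gchoose i) * ((1 / 2) gchoose (n - i))))"
      by (intro sum.cong refl) (simp add: c_def mult_ac flip: power_add)
    also have "\<dots> = (- 1) ^ n * (1 gchoose n)"
      using gbinomial_Vandermonde[of "1 / 2 :: real" "1 / 2" n]
      by (simp add: atLeast0AtMost flip: sum_distrib_left)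
    finally show ?thesis .
  qed
  have "norm (u n) \<le> norm h ^ n" for n
  proof -
    have "norm (u n) \<le> 1 * norm h ^ n"
      unfolding u_def norm_scaleR
      by (intro mult_mono norm_power_ineq) (auto simp: c_def abs_mult abs_gbinomial_half_le power_abs)
    then show ?thesis by simp
  qed
  then have summ: "summable (\<lambda>n. norm (u n))"
    using h(2) by (intro summable_comparison_test[OF _ summable_geometric[of "norm h"]]) auto
  have "(\<lambda>k. \<Sum>i\<le>k. u i * u (k - i)) sums (suminf u * suminf u)"
    by (rule Cauchy_product_sums[OF summ summ])
  moreover have "(\<Sum>i\<le>k. u i * u (k - i)) = ((- 1) ^ k * (1 gchoose k :: real)) *\<^sub>R h ^ k" for k
  proof -
    have "(\<Sum>i\<le>k. u i * u (k - i)) = (\<Sum>i\<le>k. c i * c (k - i)) *\<^sub>R h ^ k"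
      unfolding scaleR_sum_left by (intro sum.cong refl) (simp add: u_def mult_ac flip: power_add)
    then show ?thesis by (simp add: conv)
  qed
  moreover have "(\<lambda>k. ((- 1) ^ k * (1 gchoose k :: real)) *\<^sub>R h ^ k) sums
      (\<Sum>k\<in>{0, 1}. ((- 1) ^ k * (1 gchoose k :: real)) *\<^sub>R h ^ k)"
  proof (rule sums_finite)
    fix k :: nat assume "k \<notin> {0, 1}"
    then have "k > 1" by auto
    then have "(1 :: real) gchoose k = 0"
      using binomial_gbinomial[of 1 k, where ?'a = real] by (simp add: binomial_eq_0)
    then show "((- 1) ^ k * (1 gchoose k :: real)) *\<^sub>R h ^ k = 0" by simp
  qed simp
  ultimately have "(suminf u) * (suminf u) = 1 - h"
    by (simp add: sums_unique2)
  moreover have "star (suminf u) = suminf u"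
  proof -
    have lim: "(\<lambda>n. \<Sum>k<n. u k) \<longlonglongrightarrow> suminf u"
      by (rule summable_LIMSEQ[OF summable_norm_cancel[OF summ]])
    have "star (\<Sum>k<n. u k) = (\<Sum>k<n. u k)" for n
      by (simp add: star_sum u_def star_scaleR star_power h(1))
    then show ?thesis using LIMSEQ_unique[OF tendsto_star[OF lim]] lim by simp
  qed
  ultimately show ?thesis by blast
qed

text \<open>For \<open>K > \<parallel>a\<parallel>\<^sup>2\<close> the element \<open>1 - a\<^sup>* a / K\<close> is a square \<open>b\<^sup>* b\<close>, so that \<open>f(a\<^sup>* a) \<le> K f(1)\<close>.\<close>

lemma positive_functional_le:
  fixes f :: "'a::cstar_algebra \<Rightarrow> complex"
  assumes lin: "clinear f" and pos: "\<And>z. 0 \<le> Re (f (star z * z))"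
  shows "Re (f (star a * a)) \<le> (norm a)\<^sup>2 * Re (f 1)"
proof -
  have le: "Re (f (star a * a)) \<le> K * Re (f 1)" if K: "(norm a)\<^sup>2 < K" for K
  proof -
    have K0: "K > 0" using K by (smt (verit) zero_le_power2)
    define h where "h = complex_of_real (1 / K) *\<^sub>C (star a * a)"
    have "norm h < 1"
      unfolding h_def norm_scaleC norm_star_mult norm_of_real using K K0 by simp
    moreover have "star h = h"
      by (simp add: h_def star_scaleC star_mult star_star)
    ultimately obtain b where "star b = b" "b * b = 1 - h"
      using square_root_one_minus by blast
    then have "0 \<le> Re (f (1 - h))" using pos[of b] by simp
    also have "f (1 - h) = f 1 - complex_of_real (1 / K) * f (star a * a)"
      using clinear_diff[OF lin, of 1 h] clinear_scaleC[OF lin, of "complex_of_real (1 / K)" "star a * a"]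
      by (simp only: h_def scaleC_complex_def)
    finally show ?thesis using K0 by (simp add: field_simps)
  qed
  show ?thesis
  proof (rule field_le_epsilon)
    fix e :: real assume e: "e > 0"
    define d where "d = e / (\<bar>Re (f 1)\<bar> + 1)"
    have d: "d > 0" using e by (simp add: d_def add_nonneg_pos)
    have "Re (f (star a * a)) \<le> ((norm a)\<^sup>2 + d) * Re (f 1)"
      by (rule le) (use d in simp)
    also have "\<dots> \<le> (norm a)\<^sup>2 * Re (f 1) + d * (\<bar>Re (f 1)\<bar> + 1)"
      using d by (simp add: distrib_right mult_left_mono)
    also have "d * (\<bar>Re (f 1)\<bar> + 1) = e"
      by (simp add: d_def add_nonneg_pos field_simps)
    finally show "Re (f (star a * a)) \<le> (norm a)\<^sup>2 * Re (f 1) + e" .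
  qed
qed

lemma positive_functional_norm_le:
  fixes f :: "'a::cstar_algebra \<Rightarrow> complex"
  assumes lin: "clinear f" and f: "\<And>c. f (star c * c) = complex_of_real ((n c)\<^sup>2)" and n: "\<And>c. 0 \<le> n c"
  shows "n a \<le> norm a * n 1"
proof -
  have "Re (f (star a * a)) \<le> (norm a)\<^sup>2 * Re (f 1)"
    by (rule positive_functional_le[OF lin]) (simp add: f)
  then have "(n a)\<^sup>2 \<le> (norm a * n 1)\<^sup>2"
    using f[of a] f[of 1] by (simp add: star_one power_mult_distrib)
  then show ?thesis by (rule power2_le_imp_le) (simp add: n)
qed

section \<open>Tensor products of representations\<close>

lemma clinear_tensor_prod_left:
  fixes b :: "'b::complex_vector"
  shows "clinear (\<lambda>a :: 'a::complex_vector. a \<otimes>\<^sub>T b)"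
proof -
  have "(a + a') \<otimes>\<^sub>T b = a \<otimes>\<^sub>T b + a' \<otimes>\<^sub>T b" for a a' :: 'a
    by transfer (auto simp: eval_form_def bilinear_form_def clinear_def)
  moreover have "(c *\<^sub>C a) \<otimes>\<^sub>T b = c *\<^sub>C (a \<otimes>\<^sub>T b)" for c and a :: 'a
    by transfer (auto simp: eval_form_def bilinear_form_def clinear_def scaleC_complex_def)
  ultimately show ?thesis by (simp add: clinear_def)
qed

lemma clinear_tensor_prod_right:
  fixes a :: "'a::complex_vector"
  shows "clinear (\<lambda>b :: 'b::complex_vector. a \<otimes>\<^sub>T b)"
proof -
  have "a \<otimes>\<^sub>T (b + b') = a \<otimes>\<^sub>T b + a \<otimes>\<^sub>T b'" for b b' :: 'b
    by transfer (auto simp: eval_form_def bilinear_form_def clinear_def)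
  moreover have "a \<otimes>\<^sub>T (c *\<^sub>C b) = c *\<^sub>C (a \<otimes>\<^sub>T b)" for c and b :: 'b
    by transfer (auto simp: eval_form_def bilinear_form_def clinear_def scaleC_complex_def)
  ultimately show ?thesis by (simp add: clinear_def)
qed

lemma tensor_list_rep: "\<exists>xs. t = (\<Sum>(a, b)\<leftarrow>xs. a \<otimes>\<^sub>T b)"
proof -
  obtain xs where xs: "Rep_tensor t = (\<lambda>\<beta>. \<Sum>(a, b)\<leftarrow>xs. eval_form a b \<beta>)"
    using Rep_tensor[of t] by blast
  have "Rep_tensor (\<Sum>(a, b)\<leftarrow>xs. a \<otimes>\<^sub>T b) = (\<lambda>\<beta>. \<Sum>(a, b)\<leftarrow>xs. eval_form a b \<beta>)" for xs :: "('a \<times> 'b) list"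
    by (induction xs) (auto simp: zero_tensor.rep_eq plus_tensor.rep_eq tensor_prod.rep_eq)
  then show ?thesis using xs by (metis Rep_tensor_inject)
qed

lemma star_representation_bounded: "star_representation \<pi> \<Longrightarrow> bounded_clinear (\<pi> a)"
  and star_representation_linear: "star_representation \<pi> \<Longrightarrow> clinear (\<lambda>a. \<pi> a \<xi>)"
  and star_representation_mult: "star_representation \<pi> \<Longrightarrow> \<pi> (a * b) \<xi> = \<pi> a (\<pi> b \<xi>)"
  and star_representation_star: "star_representation \<pi> \<Longrightarrow> cinner (\<pi> (star a) \<xi>) \<eta> = cinner \<xi> (\<pi> a \<eta>)"
  unfolding star_representation_def by blast+

lemma continuous_on_cinner:
  assumes "continuous_on S f" "continuous_on S g"
  shows "continuous_on S (\<lambda>x. cinner (f x) (g x))"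
  using assms unfolding continuous_on_def by (auto intro: tendsto_cinner)

context
  fixes \<pi> :: "'a::cstar_algebra \<Rightarrow> 'i ell2 \<Rightarrow> 'i ell2" and \<sigma> :: "'b::cstar_algebra \<Rightarrow> 'j ell2 \<Rightarrow> 'j ell2"
    and F :: "('a, 'b) tensor \<Rightarrow> ('i \<times> 'j) ell2 \<Rightarrow> ('i \<times> 'j) ell2"
  assumes \<pi>: "star_representation \<pi>" and \<sigma>: "star_representation \<sigma>" and F: "tensor_representation \<pi> \<sigma> F"
begin

lemma trep_bounded: "bounded_clinear (F t)"
  and trep_linear: "clinear (\<lambda>t. F t \<zeta>)"
  and trep_tensor: "F (a \<otimes>\<^sub>T b) (ell2_tensor \<xi> \<eta>) = ell2_tensor (\<pi> a \<xi>) (\<sigma> b \<eta>)"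
  using F unfolding tensor_representation_def by blast+

lemma trep_mult: "F ((a * a') \<otimes>\<^sub>T (b * b')) \<zeta> = F (a \<otimes>\<^sub>T b) (F (a' \<otimes>\<^sub>T b') \<zeta>)"
  by (rule bounded_clinear_eq_on_tensors[OF trep_bounded bounded_clinear_compose[OF trep_bounded trep_bounded]])
    (simp add: trep_tensor star_representation_mult[OF \<pi>] star_representation_mult[OF \<sigma>])

lemma trep_star: "cinner (F (star a \<otimes>\<^sub>T star b) \<zeta>) \<zeta>' = cinner \<zeta> (F (a \<otimes>\<^sub>T b) \<zeta>')"
proof (induction \<zeta> rule: ell2_pair_induct)
  case 1
  show ?case
    by (intro closed_Collect_eq continuous_on_cinner bounded_clinear_continuous trep_bounded continuous_intros)
next
  case (2 S \<xi> \<eta>)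
  show ?case
  proof (induction \<zeta>' rule: ell2_pair_induct)
    case 1
    show ?case
      by (intro closed_Collect_eq continuous_on_cinner bounded_clinear_continuous trep_bounded continuous_intros)
  next
    case (2 S' \<xi>' \<eta>')
    show ?case
      by (simp add: clinear_sum[OF bounded_clinear_clinear[OF trep_bounded]] cinner_sum_left cinner_sum_right
          trep_tensor cinner_tensor star_representation_star[OF \<pi>] star_representation_star[OF \<sigma>])
  qed
qed

lemma trep_norm_square: "complex_of_real ((norm (F (a \<otimes>\<^sub>T b) \<zeta>))\<^sup>2) = cinner \<zeta> (F ((star a * a) \<otimes>\<^sub>T (star b * b)) \<zeta>)"
  by (simp only: trep_mult trep_star[of "star a" "star b" \<zeta>, unfolded star_star, symmetric] flip: cinner_self)

text \<open>For fixed \<open>b\<close> the map \<open>c \<mapsto> \<langle>\<zeta>, F(c \<otimes> b\<^sup>* b) \<zeta>\<rangle>\<close> is a positive functional, and its value at \<open>a\<^sup>* a\<close> is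
  \<open>\<parallel>F(a \<otimes> b) \<zeta>\<parallel>\<^sup>2\<close>.\<close>

lemma trep_norm_left: "norm (F (a \<otimes>\<^sub>T b) \<zeta>) \<le> norm a * norm (F (1 \<otimes>\<^sub>T b) \<zeta>)"
proof (rule positive_functional_norm_le)
  show "clinear (\<lambda>c. cinner \<zeta> (F (c \<otimes>\<^sub>T (star b * b)) \<zeta>))"
    unfolding clinear_def clinear_add[OF clinear_tensor_prod_left] clinear_scaleC[OF clinear_tensor_prod_left]
      clinear_add[OF trep_linear] clinear_scaleC[OF trep_linear]
    by (simp add: cinner_add_right cinner_scaleC_right scaleC_complex_def)
qed (simp_all only: trep_norm_square norm_ge_zero)

lemma trep_norm_right: "norm (F (a \<otimes>\<^sub>T b) \<zeta>) \<le> norm b * norm (F (a \<otimes>\<^sub>T 1) \<zeta>)"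
proof (rule positive_functional_norm_le)
  show "clinear (\<lambda>c. cinner \<zeta> (F ((star a * a) \<otimes>\<^sub>T c) \<zeta>))"
    unfolding clinear_def clinear_add[OF clinear_tensor_prod_right] clinear_scaleC[OF clinear_tensor_prod_right]
      clinear_add[OF trep_linear] clinear_scaleC[OF trep_linear]
    by (simp add: cinner_add_right cinner_scaleC_right scaleC_complex_def)
qed (simp_all only: trep_norm_square norm_ge_zero)

text \<open>The representations may be degenerate, so \<open>F(1 \<otimes> 1)\<close> is only a projection.\<close>

lemma trep_one_norm: "norm (F (1 \<otimes>\<^sub>T 1) \<zeta>) \<le> norm \<zeta>"
proof -
  have "(norm (F (1 \<otimes>\<^sub>T 1) \<zeta>))\<^sup>2 = cmod (cinner \<zeta> (F (1 \<otimes>\<^sub>T 1) \<zeta>))"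
    using arg_cong[OF trep_norm_square[of 1 1 \<zeta>], of cmod] unfolding norm_of_real by (simp add: star_one)
  also have "\<dots> \<le> norm \<zeta> * norm (F (1 \<otimes>\<^sub>T 1) \<zeta>)"
    by (rule cmod_cinner_le)
  finally show ?thesis
    by (cases "norm (F (1 \<otimes>\<^sub>T 1) \<zeta>) = 0") (simp_all add: power2_eq_square)
qed

lemma trep_contractive: "norm (F (a \<otimes>\<^sub>T b) \<zeta>) \<le> norm a * norm b * norm \<zeta>"
proof -
  have "norm (F (a \<otimes>\<^sub>T b) \<zeta>) \<le> norm a * norm (F (1 \<otimes>\<^sub>T b) \<zeta>)" by (rule trep_norm_left)
  also have "\<dots> \<le> norm a * (norm b * norm (F (1 \<otimes>\<^sub>T 1) \<zeta>))"
    by (intro mult_left_mono trep_norm_right) simp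
  also have "\<dots> \<le> norm a * (norm b * norm \<zeta>)"
    by (intro mult_left_mono trep_one_norm) simp_all
  finally show ?thesis by (simp add: mult.assoc)
qed

lemma trep_list_norm: "norm (F (\<Sum>(a, b)\<leftarrow>xs. a \<otimes>\<^sub>T b) \<zeta>) \<le> (\<Sum>(a, b)\<leftarrow>xs. norm a * norm b) * norm \<zeta>"
proof (induction xs)
  case Nil
  show ?case by (simp add: clinear_zero[OF trep_linear])
next
  case (Cons ab xs)
  obtain a b where ab: "ab = (a, b)" by (cases ab)
  have "norm (F (\<Sum>(a, b)\<leftarrow>ab # xs. a \<otimes>\<^sub>T b) \<zeta>)
      \<le> norm (F (a \<otimes>\<^sub>T b) \<zeta>) + norm (F (\<Sum>(a, b)\<leftarrow>xs. a \<otimes>\<^sub>T b) \<zeta>)"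
    by (simp add: ab clinear_add[OF trep_linear] norm_triangle_ineq)
  also have "\<dots> \<le> norm a * norm b * norm \<zeta> + (\<Sum>(a, b)\<leftarrow>xs. norm a * norm b) * norm \<zeta>"
    by (intro add_mono trep_contractive Cons.IH)
  finally show ?case by (simp add: ab distrib_right)
qed

end

text \<open>The supremum that defines the minimal norm is finite, because elementary tensors act with norm at most
  \<open>\<parallel>a\<parallel> \<parallel>b\<parallel>\<close> in every representation.\<close>

lemma min_tensor_norm_upper:
  fixes \<pi> :: "'a::cstar_algebra \<Rightarrow> 'a ell2 \<Rightarrow> 'a ell2" and \<sigma> :: "'b::cstar_algebra \<Rightarrow> 'b ell2 \<Rightarrow> 'b ell2"
  assumes "star_representation \<pi>" "star_representation \<sigma>" "tensor_representation \<pi> \<sigma> F"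
  shows "onorm (F t) \<le> min_tensor_norm t"
proof -
  obtain xs where t: "t = (\<Sum>(a, b)\<leftarrow>xs. a \<otimes>\<^sub>T b)" using tensor_list_rep by blast
  have "onorm (F t) \<le> (\<Sum>(a, b)\<leftarrow>xs. norm a * norm b)"
    if "star_representation \<pi>" "star_representation \<sigma>" "tensor_representation \<pi> \<sigma> F"
    for \<pi> :: "'a \<Rightarrow> 'a ell2 \<Rightarrow> 'a ell2" and \<sigma> :: "'b \<Rightarrow> 'b ell2 \<Rightarrow> 'b ell2" and F
    unfolding t by (rule onorm_bound)
      (auto intro!: trep_list_norm[OF that] sum_list_nonneg)
  then have "bdd_above {onorm (F t) | F (\<pi> :: 'a \<Rightarrow> 'a ell2 \<Rightarrow> 'a ell2) (\<sigma> :: 'b \<Rightarrow> 'b ell2 \<Rightarrow> 'b ell2).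
       star_representation \<pi> \<and> star_representation \<sigma> \<and> tensor_representation \<pi> \<sigma> F}"
    by (auto intro!: bdd_aboveI[of _ "\<Sum>(a, b)\<leftarrow>xs. norm a * norm b"])
  then show ?thesis
    unfolding min_tensor_norm_def using assms by (intro cSup_upper) auto
qed

lemma zero_representation:
  "star_representation (\<lambda>(_ :: 'a::cstar_algebra) (_ :: 'i ell2). 0)"
  "tensor_representation (\<lambda>(_ :: 'a) (_ :: 'i ell2). 0) (\<lambda>(_ :: 'b::cstar_algebra) (_ :: 'j ell2). 0)
    (\<lambda>(_ :: ('a, 'b) tensor) _. 0)"
  by (auto simp: star_representation_def tensor_representation_def bounded_clinear_def clinear_def
      cinner_zero_left cinner_zero_right tensor_zero_left intro!: exI[of _ 0])

lemma min_tensor_norm_nonneg: "0 \<le> min_tensor_norm t"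
  using min_tensor_norm_upper[OF zero_representation(1) zero_representation(1) zero_representation(2), of t]
  by (simp add: onorm_zero)

lemma min_tensor_norm_least:
  fixes t :: "('a::cstar_algebra, 'b::cstar_algebra) tensor"
  assumes "\<And>(\<pi> :: 'a \<Rightarrow> 'a ell2 \<Rightarrow> 'a ell2) (\<sigma> :: 'b \<Rightarrow> 'b ell2 \<Rightarrow> 'b ell2) F.
    star_representation \<pi> \<Longrightarrow> star_representation \<sigma> \<Longrightarrow> tensor_representation \<pi> \<sigma> F \<Longrightarrow> onorm (F t) \<le> K"
  shows "min_tensor_norm t \<le> K"
  unfolding min_tensor_norm_def
proof (rule cSup_least)
  show "{onorm (F t) | F (\<pi> :: 'a \<Rightarrow> 'a ell2 \<Rightarrow> 'a ell2) (\<sigma> :: 'b \<Rightarrow> 'b ell2 \<Rightarrow> 'b ell2).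
       star_representation \<pi> \<and> star_representation \<sigma> \<and> tensor_representation \<pi> \<sigma> F} \<noteq> {}"
    using zero_representation(1)[where 'a = 'a and 'i = 'a] zero_representation(1)[where 'a = 'b and 'i = 'b]
      zero_representation(2)[where 'a = 'a and 'i = 'a and 'b = 'b and 'j = 'b] by blast
qed (use assms in auto)

section \<open>Vector states on infinite-dimensional tensor products\<close>

definition orthonormal :: "'i ell2 set \<Rightarrow> bool" where
  "orthonormal B \<longleftrightarrow> (\<forall>u\<in>B. \<forall>v\<in>B. cinner u v = of_bool (u = v))"

lemma orthonormalD: "orthonormal B \<Longrightarrow> u \<in> B \<Longrightarrow> v \<in> B \<Longrightarrow> cinner u v = of_bool (u = v)"
  by (simp add: orthonormal_def)

lemma cspan_subset:
  assumes "S \<subseteq> {v. P v}" "P 0" "\<And>u v. P u \<Longrightarrow> P v \<Longrightarrow> P (u + v)" "\<And>c u. P u \<Longrightarrow> P (c *\<^sub>C u)"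
    and "v \<in> cspan S"
  shows "P v"
proof -
  have "cspan S \<subseteq> {v. P v}"
    using assms(1-4) by (intro complex_vector.span_minimal complex_vector.subspaceI) auto
  then show ?thesis using assms(5) by blast
qed

lemma orthonormal_expand:
  assumes "orthonormal B" "finite B" "v \<in> cspan B"
  shows "(\<Sum>u\<in>B. cinner u v *\<^sub>C u) = v"
proof (rule cspan_subset[OF _ _ _ _ assms(3)])
  show "B \<subseteq> {v. (\<Sum>u\<in>B. cinner u v *\<^sub>C u) = v}"
  proof clarify
    fix v assume v: "v \<in> B"
    have "(\<Sum>u\<in>B. cinner u v *\<^sub>C u) = (\<Sum>u\<in>B. if u = v then v else 0)"
      using v by (intro sum.cong refl) (auto simp: orthonormalD[OF assms(1)] scaleC_one)
    then show "(\<Sum>u\<in>B. cinner u v *\<^sub>C u) = v" using v assms(2) by simp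
  qed
  show "(\<Sum>u\<in>B. cinner u 0 *\<^sub>C u) = 0" by (simp add: cinner_zero_right)
next
  fix v w assume "(\<Sum>u\<in>B. cinner u v *\<^sub>C u) = v" "(\<Sum>u\<in>B. cinner u w *\<^sub>C u) = w"
  then show "(\<Sum>u\<in>B. cinner u (v + w) *\<^sub>C u) = v + w"
    by (simp add: cinner_add_right scaleC_add_left sum.distrib)
next
  fix c v assume *: "(\<Sum>u\<in>B. cinner u v *\<^sub>C u) = v"
  have "(\<Sum>u\<in>B. cinner u (c *\<^sub>C v) *\<^sub>C u) = c *\<^sub>C (\<Sum>u\<in>B. cinner u v *\<^sub>C u)"
    by (simp add: cinner_scaleC_right scaleC_scaleC complex_vector.scale_sum_right)
  then show "(\<Sum>u\<in>B. cinner u (c *\<^sub>C v) *\<^sub>C u) = c *\<^sub>C v" by (simp add: *)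
qed

lemma Gram_Schmidt:
  assumes "finite S" "finite B" "orthonormal B"
  shows "\<exists>C. B \<subseteq> C \<and> finite C \<and> orthonormal C \<and> S \<subseteq> cspan C \<and> C \<subseteq> cspan (B \<union> S)"
  using assms(1)
proof (induction S)
  case empty
  show ?case using assms by (intro exI[of _ B]) (auto intro: complex_vector.span_base)
next
  case (insert v S)
  then obtain C where C: "B \<subseteq> C" "finite C" "orthonormal C" "S \<subseteq> cspan C" "C \<subseteq> cspan (B \<union> S)" by blast
  define r where "r = v - (\<Sum>u\<in>C. cinner u v *\<^sub>C u)"
  have mono: "cspan (B \<union> S) \<subseteq> cspan (B \<union> insert v S)" by (rule complex_vector.span_mono) auto
  show ?case
  proof (cases "r = 0")
    case True
    then have "v = (\<Sum>u\<in>C. cinner u v *\<^sub>C u)" by (simp add: r_def)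
    then have "v \<in> cspan C"
      by (metis (no_types, lifting) complex_vector.span_base complex_vector.span_scale complex_vector.span_sum)
    then show ?thesis using C mono by (intro exI[of _ C]) auto
  next
    case False
    define w where "w = complex_of_real (1 / norm r) *\<^sub>C r"
    have r0: "cinner u r = 0" if "u \<in> C" for u
    proof -
      have "cinner u (\<Sum>t\<in>C. cinner t v *\<^sub>C t) = (\<Sum>t\<in>C. if t = u then cinner t v else 0)"
        unfolding cinner_sum_right cinner_scaleC_right
        using that by (intro sum.cong refl) (auto simp: orthonormalD[OF C(3)])
      then show ?thesis using that C(2) by (simp add: r_def cinner_diff_right)
    qed
    have w0: "cinner u w = 0" "cinner w u = 0" if "u \<in> C" for u
      using r0[OF that] cinner_commute[of r u] by (simp_all add: w_def cinner_scaleC_right cinner_scaleC_left)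
    have "norm w = 1" using False unfolding w_def norm_scaleC norm_of_real by simp
    then have w1: "cinner w w = 1" by (simp add: cinner_self)
    then have wC: "w \<notin> C" using w0 by auto
    have "orthonormal (insert w C)"
      using C(3) w0 w1 wC by (auto simp: orthonormal_def)
    moreover have "v \<in> cspan (insert w C)"
    proof -
      have "v = complex_of_real (norm r) *\<^sub>C w + (\<Sum>u\<in>C. cinner u v *\<^sub>C u)"
        using False by (simp add: w_def scaleC_scaleC scaleC_one r_def flip: of_real_mult)
      moreover have "complex_of_real (norm r) *\<^sub>C w \<in> cspan (insert w C)"
        "(\<Sum>u\<in>C. cinner u v *\<^sub>C u) \<in> cspan (insert w C)"
        by (auto intro!: complex_vector.span_scale complex_vector.span_sum intro: complex_vector.span_base)
      ultimately show ?thesis by (metis complex_vector.span_add)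
    qed
    moreover have "cspan C \<subseteq> cspan (insert w C)" by (rule complex_vector.span_mono) auto
    moreover have "w \<in> cspan (B \<union> insert v S)"
      unfolding w_def r_def using C(5) mono
      by (intro complex_vector.span_scale complex_vector.span_diff complex_vector.span_sum)
        (auto intro: complex_vector.span_base)
    ultimately show ?thesis using C mono by (intro exI[of _ "insert w C"]) auto
  qed
qed

text \<open>The span of \<open>B\<close> and of all \<open>E a u\<close> with \<open>u \<in> B\<close> is invariant, because \<open>E a (E a' u)\<close> is \<open>E a u\<close> or 0, and the \<open>E a\<close> sum to
  the identity on it, as they do on \<open>B\<close>. An orthonormal basis \<open>C\<close> of this span yields the matrices.\<close>

lemma invariant_subspace_pvm:
  fixes E :: "'a::finite \<Rightarrow> 'i ell2 \<Rightarrow> 'i ell2"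
  assumes lin: "\<And>a. clinear (E a)" and herm: "\<And>a u v. cinner (E a u) v = cinner u (E a v)"
    and mult: "\<And>a a' u. E a (E a' u) = (if a = a' then E a u else 0)"
    and B: "finite B" "orthonormal B" "\<And>u. u \<in> B \<Longrightarrow> (\<Sum>a\<in>UNIV. E a u) = u"
  obtains C where "B \<subseteq> C" "finite C" "pvm C (\<lambda>a u v. cinner u (E a v))"
proof -
  define S where "S = (\<lambda>(a, u). E a u) ` (UNIV \<times> B)"
  have "finite S" using B(1) by (simp add: S_def)
  from Gram_Schmidt[OF this B(1,2)] obtain C where C: "B \<subseteq> C" "finite C" "orthonormal C" "S \<subseteq> cspan C"
    "C \<subseteq> cspan (B \<union> S)" by blast
  have ES: "E a u \<in> cspan C" if "u \<in> B" for a u using C(4) that by (force simp: S_def)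
  have one: "(\<Sum>a\<in>UNIV. E a v) = v" if "v \<in> C" for v
  proof (rule cspan_subset)
    show "v \<in> cspan (B \<union> S)" using C(5) that by blast
    show "B \<union> S \<subseteq> {v. (\<Sum>a\<in>UNIV. E a v) = v}"
      using B(3) by (auto simp: S_def mult)
  qed (simp_all add: clinear_zero[OF lin] clinear_add[OF lin] clinear_scaleC[OF lin] sum.distrib
      flip: complex_vector.scale_sum_right)
  have inv: "\<forall>a. E a v \<in> cspan C" if "v \<in> C" for v
  proof (rule cspan_subset)
    show "v \<in> cspan (B \<union> S)" using C(5) that by blast
    show "B \<union> S \<subseteq> {v. \<forall>a. E a v \<in> cspan C}"
      using ES by (auto simp: S_def mult complex_vector.span_zero)
  qed (auto simp: clinear_zero[OF lin] clinear_add[OF lin] clinear_scaleC[OF lin]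
      intro: complex_vector.span_zero complex_vector.span_add complex_vector.span_scale)
  have "pvm C (\<lambda>a u v. cinner u (E a v))"
    unfolding pvm_def
  proof (intro conjI allI ballI)
    fix a u v assume uv: "u \<in> C" "v \<in> C"
    show "cinner v (E a u) = cnj (cinner u (E a v))"
      by (subst cinner_commute) (simp add: herm)
    have "(\<Sum>w\<in>C. cinner u (E a w) * cinner w (E a v)) = cinner u (E a (\<Sum>w\<in>C. cinner w (E a v) *\<^sub>C w))"
      by (simp add: clinear_sum[OF lin] clinear_scaleC[OF lin] cinner_sum_right cinner_scaleC_right mult.commute)
    also have "\<dots> = cinner u (E a v)"
      using inv uv by (simp add: orthonormal_expand[OF C(3,2)] mult)
    finally show "(\<Sum>w\<in>C. cinner u (E a w) * cinner w (E a v)) = cinner u (E a v)" .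
    show "(\<Sum>a\<in>UNIV. cinner u (E a v)) = of_bool (u = v)"
      using one[OF uv(2)] orthonormalD[OF C(3) uv] by (simp flip: cinner_sum_right)
  qed
  then show ?thesis using that C by blast
qed

lemma fin_corr_sum:
  assumes "finite S"
  shows "fin_corr I J P Q (\<lambda>i j. \<Sum>k\<in>S. \<alpha> k i * \<beta> k j) =
    (\<Sum>k\<in>S. \<Sum>l\<in>S. (\<Sum>i\<in>I. \<Sum>i'\<in>I. cnj (\<alpha> k i) * P i i' * \<alpha> l i') * (\<Sum>j\<in>J. \<Sum>j'\<in>J. cnj (\<beta> k j) * Q j j' * \<beta> l j'))"
proof -
  define G where "G z w = (\<Sum>i\<in>I. \<Sum>j\<in>J. \<Sum>k\<in>I. \<Sum>l\<in>J. cnj (z i j) * P i k * Q j l * w k l)" for z w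
  have left: "G (\<lambda>i j. \<Sum>k\<in>S. f k i j) w = (\<Sum>k\<in>S. G (f k) w)" for f w
    using assms by (induction S) (simp_all add: G_def algebra_simps sum.distrib)
  have right: "G z (\<lambda>i j. \<Sum>k\<in>S. f k i j) = (\<Sum>k\<in>S. G z (f k))" for f z
    using assms by (induction S) (simp_all add: G_def algebra_simps sum.distrib)
  have prod: "G (\<lambda>i j. u i * v j) (\<lambda>i j. u' i * v' j) =
      (\<Sum>i\<in>I. \<Sum>i'\<in>I. cnj (u i) * P i i' * u' i') * (\<Sum>j\<in>J. \<Sum>j'\<in>J. cnj (v j) * Q j j' * v' j')" for u v u' v'
    unfolding G_def sum_product by (intro sum.cong refl) (simp add: mult_ac)
  have "fin_corr I J P Q z = G z z" for z by (simp add: fin_corr_def G_def)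
  then show ?thesis by (simp add: left right prod)
qed

text \<open>Only the finitely many vectors \<open>\<xi> k\<close> and \<open>\<eta> k\<close> matter. Each input gets its own finite-dimensional invariant space
  that contains their span, and these spaces are enlarged to a common one. The index sets are orthonormal sets of
  vectors, used as mere labels after the enlargement.\<close>

lemma vector_state_C_q:
  fixes E :: "'x::finite \<Rightarrow> 'a::finite \<Rightarrow> 'i ell2 \<Rightarrow> 'i ell2" and G :: "'y::finite \<Rightarrow> 'b::finite \<Rightarrow> 'j ell2 \<Rightarrow> 'j ell2"
  assumes E: "\<And>x a. clinear (E x a)" "\<And>x a u v. cinner (E x a u) v = cinner u (E x a v)"
      "\<And>x a a' u. E x a (E x a' u) = (if a = a' then E x a u else 0)"
    and G: "\<And>y b. clinear (G y b)" "\<And>y b u v. cinner (G y b u) v = cinner u (G y b v)"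
      "\<And>y b b' u. G y b (G y b' u) = (if b = b' then G y b u else 0)"
    and S: "finite S" "\<And>x k. k \<in> S \<Longrightarrow> (\<Sum>a\<in>UNIV. E x a (\<xi> k)) = \<xi> k"
      "\<And>y k. k \<in> S \<Longrightarrow> (\<Sum>b\<in>UNIV. G y b (\<eta> k)) = \<eta> k"
    and unit: "norm (\<Sum>k\<in>S. ell2_tensor (\<xi> k) (\<eta> k)) = 1"
    and q: "\<And>x y a b. complex_of_real (q x y a b) =
      (\<Sum>k\<in>S. \<Sum>l\<in>S. cinner (\<xi> k) (E x a (\<xi> l)) * cinner (\<eta> k) (G y b (\<eta> l)))"
  shows "q \<in> C_q"
proof -
  have ortho_empty: "orthonormal {}" by (simp add: orthonormal_def)
  obtain B where B: "finite B" "orthonormal B" "\<xi> ` S \<subseteq> cspan B" "B \<subseteq> cspan (\<xi> ` S)"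
    using Gram_Schmidt[of "\<xi> ` S" "{}"] S(1) ortho_empty by auto
  obtain D where D: "finite D" "orthonormal D" "\<eta> ` S \<subseteq> cspan D" "D \<subseteq> cspan (\<eta> ` S)"
    using Gram_Schmidt[of "\<eta> ` S" "{}"] S(1) ortho_empty by auto
  have oneB: "(\<Sum>a\<in>UNIV. E x a u) = u" if "u \<in> B" for x u
    by (rule cspan_subset[of "\<xi> ` S"]) (use S(2) that B(4) in \<open>auto simp: clinear_zero[OF E(1)] clinear_add[OF E(1)]
      clinear_scaleC[OF E(1)] sum.distrib simp flip: complex_vector.scale_sum_right\<close>)
  have oneD: "(\<Sum>b\<in>UNIV. G y b u) = u" if "u \<in> D" for y u
    by (rule cspan_subset[of "\<eta> ` S"]) (use S(3) that D(4) in \<open>auto simp: clinear_zero[OF G(1)] clinear_add[OF G(1)]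
      clinear_scaleC[OF G(1)] sum.distrib simp flip: complex_vector.scale_sum_right\<close>)
  have "\<exists>C. B \<subseteq> C \<and> finite C \<and> pvm C (\<lambda>a u v. cinner u (E x a v))" for x
    by (rule invariant_subspace_pvm[of "E x" B]) (use E B oneB in auto)
  then obtain I where I: "\<And>x. B \<subseteq> I x" "\<And>x. finite (I x)" "\<And>x. pvm (I x) (\<lambda>a u v. cinner u (E x a v))"
    by metis
  have "\<exists>C. D \<subseteq> C \<and> finite C \<and> pvm C (\<lambda>b u v. cinner u (G y b v))" for y
    by (rule invariant_subspace_pvm[of "G y" D]) (use G D oneD in auto)
  then obtain J where J: "\<And>y. D \<subseteq> J y" "\<And>y. finite (J y)" "\<And>y. pvm (J y) (\<lambda>b u v. cinner u (G y b v))"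
    by metis
  define z where "z u v = (\<Sum>k\<in>S. cinner u (\<xi> k) * cinner v (\<eta> k))" for u v
  have form: "(\<Sum>u\<in>C. \<Sum>v\<in>C. cnj (cinner u f) * cinner u (T v) * cinner v g) = cinner f (T g)"
    if "orthonormal C" "finite C" "f \<in> cspan C" "g \<in> cspan C" and T: "clinear T" for C T and f g :: "'k ell2"
  proof -
    have "cinner f (T g) = cinner (\<Sum>u\<in>C. cinner u f *\<^sub>C u) (T (\<Sum>v\<in>C. cinner v g *\<^sub>C v))"
      using that by (simp add: orthonormal_expand)
    also have "\<dots> = (\<Sum>u\<in>C. \<Sum>v\<in>C. cnj (cinner u f) * cinner u (T v) * cinner v g)"
      by (simp add: clinear_sum[OF T] clinear_scaleC[OF T] cinner_sum_left cinner_sum_right cinner_scaleC_left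
          cinner_scaleC_right sum_distrib_left mult_ac) (rule sum.swap)
    finally show ?thesis by simp
  qed
  have corr: "fin_corr B D (\<lambda>u v. cinner u (T v)) (\<lambda>u v. cinner u (T' v)) z =
      (\<Sum>k\<in>S. \<Sum>l\<in>S. cinner (\<xi> k) (T (\<xi> l)) * cinner (\<eta> k) (T' (\<eta> l)))"
    if "clinear T" "clinear T'" for T T'
    unfolding z_def fin_corr_sum[OF S(1)] using B(3) D(3)
    by (intro sum.cong refl arg_cong2[of _ _ _ _ "(*)"] form B D that) auto
  have id: "clinear (\<lambda>v. v)" by (simp add: clinear_def)
  have "complex_of_real (\<Sum>u\<in>B. \<Sum>v\<in>D. (cmod (z u v))\<^sup>2) = fin_corr B D cinner cinner z"
  proof -
    have "fin_corr B D cinner cinner z = (\<Sum>u\<in>B. \<Sum>v\<in>D. \<Sum>u'\<in>B. \<Sum>v'\<in>D. if u' = u \<and> v' = v then cnj (z u v) * z u v else 0)"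
      unfolding fin_corr_def
      by (intro sum.cong refl) (auto simp: orthonormalD[OF B(2)] orthonormalD[OF D(2)])
    also have "\<dots> = (\<Sum>u\<in>B. \<Sum>v\<in>D. cnj (z u v) * z u v)"
    proof (intro sum.cong refl)
      fix u v assume uv: "u \<in> B" "v \<in> D"
      have "(\<Sum>u'\<in>B. \<Sum>v'\<in>D. if u' = u \<and> v' = v then cnj (z u v) * z u v else 0)
          = (\<Sum>u'\<in>B. if u' = u then cnj (z u v) * z u v else 0)"
        using uv D(1) by (intro sum.cong refl) auto
      then show "(\<Sum>u'\<in>B. \<Sum>v'\<in>D. if u' = u \<and> v' = v then cnj (z u v) * z u v else 0) = cnj (z u v) * z u v"
        using uv B(1) by simp
    qed
    finally show ?thesis by (simp add: complex_norm_square mult.commute del: of_real_power)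
  qed
  also have "\<dots> = cinner (\<Sum>k\<in>S. ell2_tensor (\<xi> k) (\<eta> k)) (\<Sum>k\<in>S. ell2_tensor (\<xi> k) (\<eta> k))"
    by (simp add: corr[OF id id] cinner_sum_left cinner_sum_right cinner_tensor) (rule sum.swap)
  also have "\<dots> = complex_of_real 1" by (simp add: cinner_self unit)
  finally have norm_z: "(\<Sum>u\<in>B. \<Sum>v\<in>D. (cmod (z u v))\<^sup>2) = 1" by (simp only: of_real_eq_iff)
  have "fin_model (\<Union>x. I x) (\<Union>y. J y) (\<lambda>x. pad (I x) (\<lambda>a u v. cinner u (E x a v)))
      (\<lambda>y. pad (J y) (\<lambda>b u v. cinner u (G y b v))) (\<lambda>u v. if u \<in> B \<and> v \<in> D then z u v else 0) q"
    by (rule fin_model_padI) (use I J norm_z in \<open>auto simp: q corr[OF E(1) G(1)]\<close>)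
  then show ?thesis by (rule fin_model_C_q)
qed

section \<open>Projections in tensor representations\<close>

lemma opp_mult: "opp (b' * b) = opp b * opp b'"
  by (simp add: times_opposite.abs_eq)

lemma opp_one: "opp 1 = 1"
  by (simp add: one_opposite.abs_eq)

lemma star_opp: "star (opp b) = opp (star b)"
  by (simp add: star_opposite.abs_eq)

lemma norm_opp: "norm (opp b) = norm b"
  by (simp add: norm_opposite.abs_eq)

lemma clinear_opp: "clinear opp"
  by (simp add: clinear_def plus_opposite.abs_eq scaleC_opposite.abs_eq)

definition alg_pvm :: "('x \<Rightarrow> 'a::finite \<Rightarrow> 'c::cstar_algebra) \<Rightarrow> bool" where
  "alg_pvm e \<longleftrightarrow> (\<forall>x a. star (e x a) = e x a) \<and>
     (\<forall>x a a'. e x a * e x a' = (if a = a' then e x a else 0)) \<and> (\<forall>x. (\<Sum>a\<in>UNIV. e x a) = 1)"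

lemma alg_pvmD:
  assumes "alg_pvm e"
  shows "star (e x a) = e x a" "e x a * e x a' = (if a = a' then e x a else 0)" "(\<Sum>a\<in>UNIV. e x a) = 1"
  using assms by (simp_all add: alg_pvm_def)

lemma norm_alg_pvm_le:
  assumes "alg_pvm e"
  shows "norm (e x a) \<le> 1"
proof (rule idempotent_bound)
  show "norm (e x a) = (norm (e x a))\<^sup>2"
    using norm_star_mult[of "e x a"] by (simp add: alg_pvmD[OF assms])
qed

context
  fixes e :: "'x::finite \<Rightarrow> 'a::finite \<Rightarrow> 'c::cstar_algebra" and f :: "'y::finite \<Rightarrow> 'b::finite \<Rightarrow> 'c"
    and \<pi> :: "'c \<Rightarrow> 'i ell2 \<Rightarrow> 'i ell2" and \<sigma> :: "'c opposite \<Rightarrow> 'j ell2 \<Rightarrow> 'j ell2"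
    and F :: "('c, 'c opposite) tensor \<Rightarrow> ('i \<times> 'j) ell2 \<Rightarrow> ('i \<times> 'j) ell2"
  assumes e: "alg_pvm e" and f: "alg_pvm f"
    and \<pi>: "star_representation \<pi>" and \<sigma>: "star_representation \<sigma>" and F: "tensor_representation \<pi> \<sigma> F"
begin

lemma norm_square_projections:
  "complex_of_real ((norm (F (e x a \<otimes>\<^sub>T opp (f y b)) \<zeta>))\<^sup>2) = cinner \<zeta> (F (e x a \<otimes>\<^sub>T opp (f y b)) \<zeta>)"
  using trep_norm_square[OF \<pi> \<sigma> F, of "e x a" "opp (f y b)" \<zeta>]
  by (simp add: star_opp alg_pvmD[OF e] alg_pvmD[OF f] flip: opp_mult)

lemma norm_square_one: "complex_of_real ((norm (F (1 \<otimes>\<^sub>T opp 1) \<zeta>))\<^sup>2) = cinner \<zeta> (F (1 \<otimes>\<^sub>T opp 1) \<zeta>)"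
  using trep_norm_square[OF \<pi> \<sigma> F, of 1 "opp 1" \<zeta>] by (simp add: star_opp star_one flip: opp_mult)

lemma projections_after_one: "F (e x a \<otimes>\<^sub>T opp (f y b)) (F (1 \<otimes>\<^sub>T opp 1) \<zeta>) = F (e x a \<otimes>\<^sub>T opp (f y b)) \<zeta>"
  using trep_mult[OF \<pi> \<sigma> F, of "e x a" 1 "opp (f y b)" "opp 1" \<zeta>] by (simp add: opp_one)

text \<open>The representations may be degenerate, but on the vectors \<open>\<xi> k\<close> and \<open>\<eta> k\<close> the images of the projections still
  sum to the identity.\<close>

lemma unit_vector_C_q:
  assumes S: "finite S" and \<zeta>: "\<zeta> = (\<Sum>k\<in>S. ell2_tensor (\<xi> k) (\<eta> k))" "norm \<zeta> = 1"
    and fix1: "\<And>k. \<pi> 1 (\<xi> k) = \<xi> k" and fix2: "\<And>k. \<sigma> (opp 1) (\<eta> k) = \<eta> k"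
  shows "(\<lambda>x y a b. (norm (F (e x a \<otimes>\<^sub>T opp (f y b)) \<zeta>))\<^sup>2) \<in> C_q"
proof (rule vector_state_C_q[of "\<lambda>x a. \<pi> (e x a)" "\<lambda>y b. \<sigma> (opp (f y b))" S \<xi> \<eta>])
  have \<pi>0: "\<pi> 0 u = 0" and \<sigma>0: "\<sigma> 0 v = 0" for u v
    using clinear_zero[OF star_representation_linear[OF \<pi>]] clinear_zero[OF star_representation_linear[OF \<sigma>]] by auto
  have opp0: "opp 0 = 0" by (rule clinear_zero[OF clinear_opp])
  fix x y a b
  show "clinear (\<pi> (e x a))" "clinear (\<sigma> (opp (f y b)))"
    using star_representation_bounded[OF \<pi>] star_representation_bounded[OF \<sigma>] by (auto simp: bounded_clinear_def)
  show "cinner (\<pi> (e x a) u) v = cinner u (\<pi> (e x a) v)" for u v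
    using star_representation_star[OF \<pi>, of "e x a"] by (simp add: alg_pvmD[OF e])
  show "cinner (\<sigma> (opp (f y b)) u) v = cinner u (\<sigma> (opp (f y b)) v)" for u v
    using star_representation_star[OF \<sigma>, of "opp (f y b)"] by (simp add: star_opp alg_pvmD[OF f])
  show "\<pi> (e x a) (\<pi> (e x a') u) = (if a = a' then \<pi> (e x a) u else 0)" for a' u
    using star_representation_mult[OF \<pi>, of "e x a" "e x a'" u] by (auto simp: alg_pvmD[OF e] \<pi>0 split: if_splits)
  show "\<sigma> (opp (f y b)) (\<sigma> (opp (f y b')) u) = (if b = b' then \<sigma> (opp (f y b)) u else 0)" for b' u
    using star_representation_mult[OF \<sigma>, of "opp (f y b)" "opp (f y b')" u]
    by (auto simp: alg_pvmD[OF f] \<sigma>0 opp0 simp flip: opp_mult split: if_splits)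
  show "(\<Sum>a\<in>UNIV. \<pi> (e x a) (\<xi> k)) = \<xi> k" for k
    using clinear_sum[OF star_representation_linear[OF \<pi>, of "\<xi> k"], of "e x" UNIV]
    by (simp add: alg_pvmD[OF e] fix1)
  have "(\<Sum>b\<in>UNIV. opp (f y b)) = opp 1"
    using clinear_sum[OF clinear_opp, of "f y" UNIV] by (simp add: alg_pvmD(3)[OF f])
  then show "(\<Sum>b\<in>UNIV. \<sigma> (opp (f y b)) (\<eta> k)) = \<eta> k" for k
    using clinear_sum[OF star_representation_linear[OF \<sigma>, of "\<eta> k"], of "\<lambda>b. opp (f y b)" UNIV]
    by (simp add: fix2)
  show "complex_of_real ((norm (F (e x a \<otimes>\<^sub>T opp (f y b)) \<zeta>))\<^sup>2) =
      (\<Sum>k\<in>S. \<Sum>l\<in>S. cinner (\<xi> k) (\<pi> (e x a) (\<xi> l)) * cinner (\<eta> k) (\<sigma> (opp (f y b)) (\<eta> l)))"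
  proof -
    have "cinner \<zeta> (F (e x a \<otimes>\<^sub>T opp (f y b)) \<zeta>) =
        (\<Sum>l\<in>S. \<Sum>k\<in>S. cinner (\<xi> k) (\<pi> (e x a) (\<xi> l)) * cinner (\<eta> k) (\<sigma> (opp (f y b)) (\<eta> l)))"
      unfolding \<zeta>(1) clinear_sum[OF bounded_clinear_clinear[OF trep_bounded[OF \<pi> \<sigma> F]]]
        trep_tensor[OF \<pi> \<sigma> F] cinner_sum_left cinner_sum_right cinner_tensor ..
    also have "\<dots> = (\<Sum>k\<in>S. \<Sum>l\<in>S. cinner (\<xi> k) (\<pi> (e x a) (\<xi> l)) * cinner (\<eta> k) (\<sigma> (opp (f y b)) (\<eta> l)))"
      by (rule sum.swap)
    finally show ?thesis unfolding norm_square_projections .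
  qed
qed (use S \<zeta> in auto)

text \<open>Both sides are continuous in \<open>\<zeta>\<close>, so \<open>\<zeta>\<close> may be taken in the algebraic tensor product. Its image
  \<open>\<zeta>' = F(1 \<otimes> 1) \<zeta>\<close> gives the same values and, once normalised, defines a quantum correlation \<open>q\<close>; the values are then
  \<open>\<parallel>\<zeta>'\<parallel>\<^sup>2 (c(q) + K)\<close>. The shift \<open>K\<close> makes them nonnegative, and \<open>\<bar>s\<bar>\<close> is included in it in order that \<open>s + K \<ge> 0\<close>.\<close>

lemma projections_form_bounds:
  fixes c :: "'x \<times> 'y \<times> 'a \<times> 'b \<Rightarrow> real"
  assumes bound: "\<And>q. q \<in> C_q \<Longrightarrow> (\<Sum>(x, y, a, b)\<in>UNIV. c (x, y, a, b) * q x y a b) \<le> s"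
    and K: "(\<Sum>i\<in>UNIV. \<bar>c i\<bar>) + \<bar>s\<bar> \<le> K"
  shows "0 \<le> (\<Sum>(x, y, a, b)\<in>UNIV. c (x, y, a, b) * (norm (F (e x a \<otimes>\<^sub>T opp (f y b)) \<zeta>))\<^sup>2)
        + K * (norm (F (1 \<otimes>\<^sub>T opp 1) \<zeta>))\<^sup>2 \<and>
      (\<Sum>(x, y, a, b)\<in>UNIV. c (x, y, a, b) * (norm (F (e x a \<otimes>\<^sub>T opp (f y b)) \<zeta>))\<^sup>2)
        + K * (norm (F (1 \<otimes>\<^sub>T opp 1) \<zeta>))\<^sup>2 \<le> (s + K) * (norm \<zeta>)\<^sup>2"
    (is "0 \<le> ?g \<zeta> \<and> ?g \<zeta> \<le> _")
proof (induction \<zeta> rule: ell2_pair_induct)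
  case 1
  show ?case
    unfolding case_prod_unfold
    by (intro closed_Collect_conj closed_Collect_le continuous_intros bounded_clinear_continuous trep_bounded[OF \<pi> \<sigma> F])
next
  case (2 S \<xi> \<eta>)
  define \<zeta> where "\<zeta> = (\<Sum>k\<in>S. ell2_tensor (\<xi> k) (\<eta> k))"
  define \<zeta>' where "\<zeta>' = F (1 \<otimes>\<^sub>T opp 1) \<zeta>"
  note lin = bounded_clinear_clinear[OF trep_bounded[OF \<pi> \<sigma> F]]
  have "0 \<le> (\<Sum>i\<in>UNIV. \<bar>c i\<bar>)" by (simp add: sum_nonneg)
  then have sK: "0 \<le> s + K" using K by linarith
  have g: "?g \<zeta> = (\<Sum>(x, y, a, b)\<in>UNIV. c (x, y, a, b) * (norm (F (e x a \<otimes>\<^sub>T opp (f y b)) \<zeta>'))\<^sup>2) + K * (norm \<zeta>')\<^sup>2"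
    by (simp add: \<zeta>'_def projections_after_one)
  have le: "norm \<zeta>' \<le> norm \<zeta>"
    unfolding \<zeta>'_def opp_one by (rule trep_one_norm[OF \<pi> \<sigma> F])
  show ?case
  proof (cases "\<zeta>' = 0")
    case True
    then show ?thesis using g sK by (simp add: clinear_zero[OF lin] flip: \<zeta>_def)
  next
    case False
    define r where "r = norm \<zeta>'"
    have r: "r > 0" using False by (simp add: r_def)
    define \<zeta>'' where "\<zeta>'' = complex_of_real (1 / r) *\<^sub>C \<zeta>'"
    have u: "norm \<zeta>'' = 1"
      unfolding \<zeta>''_def norm_scaleC norm_of_real using r by (simp add: r_def)
    have \<zeta>': "\<zeta>' = complex_of_real r *\<^sub>C \<zeta>''"
      using r by (simp add: \<zeta>''_def scaleC_scaleC scaleC_one flip: of_real_mult)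
    define q where "q x y a b = (norm (F (e x a \<otimes>\<^sub>T opp (f y b)) \<zeta>''))\<^sup>2" for x y a b
    have "\<zeta>'' = (\<Sum>k\<in>S. ell2_tensor (complex_of_real (1 / r) *\<^sub>C \<pi> 1 (\<xi> k)) (\<sigma> (opp 1) (\<eta> k)))"
      by (simp add: \<zeta>''_def \<zeta>'_def \<zeta>_def clinear_sum[OF lin] trep_tensor[OF \<pi> \<sigma> F] tensor_scaleC_left
          complex_vector.scale_sum_right)
    moreover have "\<pi> 1 (complex_of_real (1 / r) *\<^sub>C \<pi> 1 (\<xi> k)) = complex_of_real (1 / r) *\<^sub>C \<pi> 1 (\<xi> k)" for k
      using star_representation_mult[OF \<pi>, of 1 1 "\<xi> k"]
        clinear_scaleC[OF bounded_clinear_clinear[OF star_representation_bounded[OF \<pi>]], of 1]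
      by simp
    moreover have "\<sigma> (opp 1) (\<sigma> (opp 1) (\<eta> k)) = \<sigma> (opp 1) (\<eta> k)" for k
      using star_representation_mult[OF \<sigma>, of 1 1 "\<eta> k"] by (simp add: opp_one)
    ultimately have "q \<in> C_q"
      unfolding q_def using 2 u by (intro unit_vector_C_q[of S]) auto
    then have upper: "(\<Sum>(x, y, a, b)\<in>UNIV. c (x, y, a, b) * q x y a b) \<le> s" by (rule bound)
    have q1: "0 \<le> q x y a b \<and> q x y a b \<le> 1" for x y a b
    proof -
      have "norm (F (e x a \<otimes>\<^sub>T opp (f y b)) \<zeta>'') \<le> norm (e x a) * norm (opp (f y b)) * norm \<zeta>''"
        by (rule trep_contractive[OF \<pi> \<sigma> F])
      also have "\<dots> \<le> 1 * 1 * 1"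
        by (intro mult_mono) (auto simp: norm_opp norm_alg_pvm_le[OF e] norm_alg_pvm_le[OF f] u)
      finally show ?thesis by (simp add: q_def power_le_one)
    qed
    have "- (\<Sum>i\<in>UNIV. \<bar>c i\<bar>) \<le> (\<Sum>(x, y, a, b)\<in>UNIV. c (x, y, a, b) * q x y a b)"
      unfolding sum_negf[symmetric]
    proof (rule sum_mono)
      fix i :: "'x \<times> 'y \<times> 'a \<times> 'b"
      obtain x y a b where i: "i = (x, y, a, b)" by (cases i)
      have "\<bar>c i * q x y a b\<bar> \<le> \<bar>c i\<bar> * 1"
        unfolding abs_mult using q1[of x y a b] by (intro mult_left_mono) auto
      then show "- \<bar>c i\<bar> \<le> (case i of (x, y, a, b) \<Rightarrow> c (x, y, a, b) * q x y a b)"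
        by (simp add: i)
    qed
    then have lower: "0 \<le> (\<Sum>(x, y, a, b)\<in>UNIV. c (x, y, a, b) * q x y a b) + K" using K by linarith
    have "?g \<zeta> = r\<^sup>2 * ((\<Sum>(x, y, a, b)\<in>UNIV. c (x, y, a, b) * q x y a b) + K)"
      unfolding g distrib_left sum_distrib_left
      unfolding \<zeta>' clinear_scaleC[OF lin] norm_scaleC norm_of_real power_mult_distrib power2_abs u q_def
      by (simp add: case_prod_unfold mult_ac)
    moreover have "r\<^sup>2 * ((\<Sum>(x, y, a, b)\<in>UNIV. c (x, y, a, b) * q x y a b) + K) \<le> (norm \<zeta>)\<^sup>2 * (s + K)"
      using upper lower le r by (intro mult_mono power_mono) (auto simp: r_def)
    ultimately show ?thesis
      using lower by (simp add: mult.commute flip: \<zeta>_def)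
  qed
qed

text \<open>An operator with \<open>0 \<le> Z \<le> S\<close> has norm at most \<open>S\<close>: the Cauchy-Schwarz inequality of the form \<open>\<langle>u, Z v\<rangle>\<close> for
  \<open>u = Z \<zeta>\<close> and \<open>v = \<zeta>\<close> gives \<open>\<parallel>Z \<zeta>\<parallel>\<^sup>4 \<le> S \<parallel>Z \<zeta>\<parallel>\<^sup>2 S \<parallel>\<zeta>\<parallel>\<^sup>2\<close>.\<close>

lemma projections_norm_bound:
  fixes c :: "'x \<times> 'y \<times> 'a \<times> 'b \<Rightarrow> real"
  assumes bound: "\<And>q. q \<in> C_q \<Longrightarrow> (\<Sum>(x, y, a, b)\<in>UNIV. c (x, y, a, b) * q x y a b) \<le> s"
    and K: "(\<Sum>i\<in>UNIV. \<bar>c i\<bar>) + \<bar>s\<bar> \<le> K"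
  defines "Z \<equiv> \<lambda>\<zeta>. (\<Sum>(x, y, a, b)\<in>UNIV. complex_of_real (c (x, y, a, b)) *\<^sub>C F (e x a \<otimes>\<^sub>T opp (f y b)) \<zeta>)
    + complex_of_real K *\<^sub>C F (1 \<otimes>\<^sub>T opp 1) \<zeta>"
  shows "norm (Z \<zeta>) \<le> (s + K) * norm \<zeta>"
proof -
  note lin = bounded_clinear_clinear[OF trep_bounded[OF \<pi> \<sigma> F]]
  define g where "g \<zeta> = (\<Sum>(x, y, a, b)\<in>UNIV. c (x, y, a, b) * (norm (F (e x a \<otimes>\<^sub>T opp (f y b)) \<zeta>))\<^sup>2)
        + K * (norm (F (1 \<otimes>\<^sub>T opp 1) \<zeta>))\<^sup>2" for \<zeta>
  have g: "0 \<le> g \<zeta>" "g \<zeta> \<le> (s + K) * (norm \<zeta>)\<^sup>2" for \<zeta>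
    unfolding g_def using projections_form_bounds[OF bound K, of \<zeta>] by blast+
  have "0 \<le> (\<Sum>i\<in>UNIV. \<bar>c i\<bar>)" by (simp add: sum_nonneg)
  then have sK: "0 \<le> s + K" using K by linarith
  have Zg: "cinner \<zeta> (Z \<zeta>) = complex_of_real (g \<zeta>)" for \<zeta>
    unfolding Z_def g_def of_real_add of_real_sum of_real_mult cinner_add_right cinner_sum_right case_prod_unfold
      cinner_scaleC_right norm_square_one norm_square_projections ..
  have sa: "cinner (F (e x a \<otimes>\<^sub>T opp (f y b)) u) v = cinner u (F (e x a \<otimes>\<^sub>T opp (f y b)) v)"
    "cinner (F (1 \<otimes>\<^sub>T opp 1) u) v = cinner u (F (1 \<otimes>\<^sub>T opp 1) v)" for x a y b u v
    using trep_star[OF \<pi> \<sigma> F, of "e x a" "opp (f y b)" u v] trep_star[OF \<pi> \<sigma> F, of 1 "opp 1" u v]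
    by (simp_all add: star_opp star_one alg_pvmD[OF e] alg_pvmD[OF f])
  have "cinner (Z u) v = cinner u (Z v)" for u v
    unfolding Z_def cinner_add_right cinner_sum_right cinner_add_left cinner_sum_left case_prod_unfold
      cinner_scaleC_right cinner_scaleC_left sa by simp
  then have herm: "cinner v (Z u) = cnj (cinner u (Z v))" for u v
    by (metis cinner_commute)
  have Zlin: "clinear Z"
    unfolding Z_def clinear_def clinear_add[OF lin] clinear_scaleC[OF lin] case_prod_unfold
    by (auto simp: scaleC_add_right sum.distrib complex_vector.scale_sum_right scaleC_scaleC mult_ac)
  have "clinear (\<lambda>v. cinner u (Z v))" for u
    using Zlin by (simp add: clinear_def cinner_add_right cinner_scaleC_right scaleC_complex_def)
  from Cauchy_Schwarz_form[of "\<lambda>u v. cinner u (Z v)", OF this herm, of "Z \<zeta>" \<zeta>]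
  have "(cmod (cinner (Z \<zeta>) (Z \<zeta>)))\<^sup>2 \<le> g (Z \<zeta>) * g \<zeta>"
    by (simp add: Zg g)
  also have "\<dots> \<le> ((s + K) * (norm (Z \<zeta>))\<^sup>2) * ((s + K) * (norm \<zeta>)\<^sup>2)"
    using g sK by (intro mult_mono) auto
  finally have *: "((norm (Z \<zeta>))\<^sup>2)\<^sup>2 \<le> ((s + K) * norm \<zeta>)\<^sup>2 * (norm (Z \<zeta>))\<^sup>2"
    unfolding cinner_self norm_of_real by (simp add: power_mult_distrib mult_ac power2_eq_square)
  show ?thesis
  proof (cases "Z \<zeta> = 0")
    case True
    then show ?thesis using sK by simp
  next
    case False
    then have "(norm (Z \<zeta>))\<^sup>2 > 0" by simp
    then have "(norm (Z \<zeta>))\<^sup>2 \<le> ((s + K) * norm \<zeta>)\<^sup>2"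
      using * unfolding power2_eq_square[of "(norm (Z \<zeta>))\<^sup>2"] by (rule mult_right_le_imp_le[rotated])
    then show ?thesis using sK by (intro power2_le_imp_le[of "norm (Z \<zeta>)"]) auto
  qed
qed

end

section \<open>Amenable traces yield approximately finite-dimensional correlations\<close>

text \<open>A list of pairs \<open>(a, b)\<close> stands for \<open>\<Sum> a \<otimes> b\<^sup>o\<^sup>p\<close>; the order of the second factors is therefore reversed in products.\<close>

definition pair_mult :: "('c::times \<times> 'c) list \<Rightarrow> ('c \<times> 'c) list \<Rightarrow> ('c \<times> 'c) list" where
  "pair_mult xs ys = concat (map (\<lambda>(a, b). map (\<lambda>(a', b'). (a * a', b' * b)) ys) xs)"

definition pair_tensor :: "('c::cstar_algebra \<times> 'c) list \<Rightarrow> ('c, 'c opposite) tensor" where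
  "pair_tensor xs = (\<Sum>(a, b)\<leftarrow>xs. a \<otimes>\<^sub>T opp b)"

text \<open>The left-right action of \<open>\<A> \<otimes> \<A>\<^sup>o\<^sup>p\<close> on \<open>\<A>\<close>.\<close>

definition pair_act :: "('c::cstar_algebra \<times> 'c) list \<Rightarrow> 'c \<Rightarrow> 'c" where
  "pair_act xs w = (\<Sum>(a, b)\<leftarrow>xs. a * w * b)"

lemma pair_act_mult: "pair_act (pair_mult xs ys) w = pair_act xs (pair_act ys w)"
proof (induction xs)
  case (Cons ab xs)
  obtain a b where ab: "ab = (a, b)" by (cases ab)
  have "pair_act (map (\<lambda>(a', b'). (a * a', b' * b)) ys) w = a * pair_act ys w * b"
    by (induction ys) (auto simp: pair_act_def algebra_simps)
  then show ?case using Cons by (simp add: ab pair_mult_def pair_act_def)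
qed (simp add: pair_mult_def pair_act_def)

lemma pair_tensor_rep_mult:
  fixes \<pi> :: "'c::cstar_algebra \<Rightarrow> 'i ell2 \<Rightarrow> 'i ell2" and \<sigma> :: "'c opposite \<Rightarrow> 'j ell2 \<Rightarrow> 'j ell2"
  assumes rep: "star_representation \<pi>" "star_representation \<sigma>" "tensor_representation \<pi> \<sigma> F"
  shows "F (pair_tensor (pair_mult xs ys)) \<zeta> = F (pair_tensor xs) (F (pair_tensor ys) \<zeta>)"
proof (induction xs)
  case Nil
  show ?case by (simp add: pair_mult_def pair_tensor_def clinear_zero[OF trep_linear[OF rep]])
next
  case (Cons ab xs)
  obtain a b where ab: "ab = (a, b)" by (cases ab)
  note lin = bounded_clinear_clinear[OF trep_bounded[OF rep]]
  have "F (pair_tensor (map (\<lambda>(a', b'). (a * a', b' * b)) ys)) \<zeta> = F (a \<otimes>\<^sub>T opp b) (F (pair_tensor ys) \<zeta>)"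
    by (induction ys) (auto simp: pair_tensor_def clinear_zero[OF trep_linear[OF rep]] clinear_zero[OF lin]
        clinear_add[OF trep_linear[OF rep]] clinear_add[OF lin] opp_mult trep_mult[OF rep])
  then show ?case
    using Cons by (simp add: ab pair_mult_def pair_tensor_def clinear_add[OF trep_linear[OF rep]])
qed

text \<open>Polarization: \<open>\<tau>\<close> is real on \<open>(1 + z)\<^sup>* (1 + z)\<close> and on \<open>(1 + iz)\<^sup>* (1 + iz)\<close>.\<close>

lemma trace_star:
  assumes "is_trace \<tau>"
  shows "\<tau> (star z) = cnj (\<tau> z)"
proof -
  have lin: "clinear \<tau>" and pos: "\<And>z. Im (\<tau> (star z * z)) = 0"
    using assms unfolding is_trace_def complex_nonneg_Reals_iff by blast+
  have 1: "Im (\<tau> z + \<tau> (star z)) = 0" for z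
  proof -
    have "star (1 + z) * (1 + z) = star 1 * 1 + (z + star z) + star z * z"
      by (simp add: star_add star_one algebra_simps)
    then have "\<tau> (star (1 + z) * (1 + z)) = \<tau> (star 1 * 1) + (\<tau> z + \<tau> (star z)) + \<tau> (star z * z)"
      by (simp only: clinear_add[OF lin])
    then show ?thesis using pos[of "1 + z"] pos[of 1] pos[of z] by simp
  qed
  have "\<tau> (\<i> *\<^sub>C z) = \<i> * \<tau> z" "\<tau> (star (\<i> *\<^sub>C z)) = - \<i> * \<tau> (star z)"
    unfolding star_scaleC clinear_scaleC[OF lin] scaleC_complex_def by simp_all
  then show ?thesis using 1[of z] 1[of "\<i> *\<^sub>C z"] by (simp add: complex_eq_iff)
qed

lemma le_of_power_bound:
  fixes r S C :: real
  assumes "0 \<le> r" "0 \<le> S" and bound: "\<And>n. r ^ (2 ^ n) \<le> C * S ^ (2 ^ n)"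
  shows "r \<le> S"
proof (rule ccontr)
  assume "\<not> r \<le> S"
  then have rS: "r > S" by simp
  show False
  proof (cases "S = 0")
    case True
    then show False using bound[of 0] rS by simp
  next
    case False
    then have S: "S > 0" using assms by simp
    then have "r / S > 1" using rS by simp
    then obtain n where n: "C < (r / S) ^ n" using real_arch_pow by blast
    also have "\<dots> \<le> (r / S) ^ (2 ^ n)"
      using \<open>r / S > 1\<close> by (intro power_increasing) (auto simp: less_imp_le)
    also have "\<dots> \<le> C"
      using bound[of n] S by (simp add: power_divide pos_divide_le_eq)
    finally show False by simp
  qed
qed

text \<open>The left-right action of a self-adjoint tensor \<open>t\<close> is symmetric for the form \<open>\<langle>v, w\<rangle> = \<tau>(v\<^sup>* w)\<close>, and \<open>\<phi>(t)\<close> is \<open>\<langle>1, t 1\<rangle>\<close>.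
  Hence \<open>\<bar>\<phi>(t ^ k)\<bar>\<^sup>2 \<le> \<bar>\<phi>(t ^ 2k)\<bar>\<close> by the Cauchy-Schwarz inequality, so that
  \<open>\<bar>\<phi>(t)\<bar> ^ n \<le> \<bar>\<phi>(t ^ n)\<bar> \<le> C (S ^ n)\<close> for all powers \<open>n\<close> of 2, and the constant \<open>C\<close> disappears as \<open>n\<close> grows.\<close>

lemma amenable_trace_contractive:
  fixes \<tau> :: "'c::cstar_algebra \<Rightarrow> complex"
  assumes \<tau>: "amenable_trace \<tau>" "\<tau> 1 = 1"
    and sa: "\<And>a b. (a, b) \<in> set xs \<Longrightarrow> star a = a \<and> star b = b"
    and S: "0 \<le> S" and bound: "\<And>(\<pi> :: 'c \<Rightarrow> 'c ell2 \<Rightarrow> 'c ell2) (\<sigma> :: 'c opposite \<Rightarrow> 'c opposite ell2 \<Rightarrow> 'c opposite ell2) F \<zeta>.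
      star_representation \<pi> \<Longrightarrow> star_representation \<sigma> \<Longrightarrow> tensor_representation \<pi> \<sigma> F \<Longrightarrow>
      norm (F (pair_tensor xs) \<zeta>) \<le> S * norm \<zeta>"
  shows "cmod (\<Sum>(a, b)\<leftarrow>xs. \<tau> (a * b)) \<le> S"
proof -
  obtain \<phi> :: "('c, 'c opposite) tensor \<Rightarrow> complex" and C where tr: "is_trace \<tau>" and \<phi>: "clinear \<phi>"
    "\<And>a b. \<phi> (a \<otimes>\<^sub>T opp b) = \<tau> (a * b)" and C: "\<And>t. cmod (\<phi> t) \<le> C * min_tensor_norm t"
    using \<tau>(1) unfolding amenable_trace_def by blast
  have lin: "clinear \<tau>" and pos: "\<And>z. 0 \<le> Re (\<tau> (star z * z))" and comm: "\<And>z w. \<tau> (z * w) = \<tau> (w * z)"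
    using tr unfolding is_trace_def complex_nonneg_Reals_iff by blast+
  define B where "B v w = \<tau> (star v * w)" for v w
  have Blin: "clinear (B v)" for v
    using lin by (simp add: B_def clinear_def distrib_left mult_scaleC_right)
  have Bherm: "B w v = cnj (B v w)" for v w
    using trace_star[OF tr, of "star v * w"] by (simp add: B_def star_mult star_star)
  have Bpos: "0 \<le> Re (B v v)" for v by (simp add: B_def pos)
  let ?M = "pair_act xs"
  have sym: "B v (?M w) = B (?M v) w" for v w
    unfolding pair_act_def using sa
  proof (induction xs)
    case (Cons ab xs)
    obtain a b where ab: "ab = (a, b)" by (cases ab)
    have ab': "star a = a" "star b = b" using Cons.prems[of a b] by (auto simp: ab)
    have "B v (a * w * b) = B (a * v * b) w"
      using comm[of "star v * a * w" b] by (simp add: B_def star_mult ab' mult.assoc)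
    moreover have "B (u + u') w = B u w + B u' w" for u u'
      by (simp add: B_def star_add distrib_right clinear_add[OF lin])
    moreover have "B v (\<Sum>(a, b)\<leftarrow>xs. a * w * b) = B (\<Sum>(a, b)\<leftarrow>xs. a * v * b) w"
      by (rule Cons.IH) (use Cons.prems in auto)
    ultimately show ?case
      by (simp add: ab clinear_add[OF Blin])
  qed (simp add: B_def star_zero clinear_zero[OF lin])
  have symk: "B v ((?M ^^ k) w) = B ((?M ^^ k) v) w" for v w k
    by (induction k arbitrary: v w) (simp_all add: sym funpow_swap1)
  define \<alpha> where "\<alpha> k = \<tau> ((?M ^^ k) 1)" for k
  have double: "(cmod (\<alpha> k))\<^sup>2 \<le> cmod (\<alpha> (2 * k))" for k
  proof -
    have "(cmod (B 1 ((?M ^^ k) 1)))\<^sup>2 \<le> Re (B 1 1) * Re (B ((?M ^^ k) 1) ((?M ^^ k) 1))"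
      by (rule Cauchy_Schwarz_form[OF Blin Bherm Bpos])
    moreover have "B ((?M ^^ k) 1) ((?M ^^ k) 1) = \<alpha> (2 * k)"
      using symk[of 1 k "(?M ^^ k) 1"] by (simp add: \<alpha>_def B_def star_one mult_2 funpow_add)
    ultimately show ?thesis
      using complex_Re_le_cmod[of "\<alpha> (2 * k)"] by (simp add: B_def \<alpha>_def star_one \<tau>(2))
  qed
  define ys where "ys k = (pair_mult xs ^^ k) [(1, 1)]" for k
  have act: "pair_act (ys k) w = (?M ^^ k) w" for k w
    by (induction k) (simp_all add: ys_def pair_act_mult, simp add: pair_act_def)
  have val: "\<phi> (pair_tensor zs) = \<tau> (pair_act zs 1)" for zs
    by (induction zs) (auto simp: pair_tensor_def pair_act_def \<phi>(2) clinear_zero[OF lin] clinear_zero[OF \<phi>(1)]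
        clinear_add[OF lin] clinear_add[OF \<phi>(1)])
  have norm_le: "min_tensor_norm (pair_tensor (ys k)) \<le> S ^ k" for k
  proof (rule min_tensor_norm_least)
    fix \<pi> :: "'c \<Rightarrow> 'c ell2 \<Rightarrow> 'c ell2" and \<sigma> :: "'c opposite \<Rightarrow> 'c opposite ell2 \<Rightarrow> 'c opposite ell2" and F
    assume rep: "star_representation \<pi>" "star_representation \<sigma>" "tensor_representation \<pi> \<sigma> F"
    have "norm (F (pair_tensor (ys k)) \<zeta>) \<le> S ^ k * norm \<zeta>" for \<zeta>
    proof (induction k)
      case 0
      show ?case using trep_one_norm[OF rep, of \<zeta>] by (simp add: ys_def pair_tensor_def opp_one)
    next
      case (Suc k)
      have "norm (F (pair_tensor (ys (Suc k))) \<zeta>) = norm (F (pair_tensor xs) (F (pair_tensor (ys k)) \<zeta>))"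
        by (simp add: ys_def pair_tensor_rep_mult[OF rep])
      also have "\<dots> \<le> S * norm (F (pair_tensor (ys k)) \<zeta>)" by (rule bound[OF rep])
      also have "\<dots> \<le> S * (S ^ k * norm \<zeta>)" by (intro mult_left_mono Suc S)
      finally show ?case by simp
    qed
    then show "onorm (F (pair_tensor (ys k))) \<le> S ^ k"
      using S by (intro onorm_bound) auto
  qed
  have upper: "cmod (\<alpha> k) \<le> \<bar>C\<bar> * S ^ k" for k
  proof -
    have "cmod (\<alpha> k) \<le> C * min_tensor_norm (pair_tensor (ys k))"
      using C[of "pair_tensor (ys k)"] by (simp add: val act \<alpha>_def)
    also have "\<dots> \<le> \<bar>C\<bar> * S ^ k"
      using min_tensor_norm_nonneg norm_le by (intro mult_mono) auto
    finally show ?thesis .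
  qed
  have "cmod (\<alpha> 1) ^ (2 ^ n) \<le> cmod (\<alpha> (2 ^ n))" for n
  proof (induction n)
    case (Suc n)
    have "cmod (\<alpha> 1) ^ (2 ^ Suc n) = (cmod (\<alpha> 1) ^ (2 ^ n))\<^sup>2"
      by (simp only: power_Suc2 power_mult)
    also have "\<dots> \<le> (cmod (\<alpha> (2 ^ n)))\<^sup>2" by (intro power_mono Suc) simp
    also have "\<dots> \<le> cmod (\<alpha> (2 ^ Suc n))" using double[of "2 ^ n"] by simp
    finally show ?case .
  qed simp
  then have "cmod (\<alpha> 1) \<le> S"
    using upper order_trans by (intro le_of_power_bound[OF _ S, of _ "\<bar>C\<bar>"]) (auto, blast)
  moreover have "\<alpha> 1 = (\<Sum>(a, b)\<leftarrow>xs. \<tau> (a * b))"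
    by (simp add: \<alpha>_def pair_act_def clinear_sum_list[OF lin] o_def case_prod_unfold)
  ultimately show ?thesis by simp
qed

text \<open>The quantum correlations form a convex set; they are moved to a Euclidean space in order to be separated
  from \<open>p\<close>.\<close>

lemma closure_C_q_separation:
  fixes p :: "('x::finite, 'y::finite, 'a::finite, 'b::finite) correlation"
  assumes "p \<notin> closure C_q"
  obtains c s where "\<And>q. q \<in> C_q \<Longrightarrow> (\<Sum>(x, y, a, b)\<in>UNIV. c (x, y, a, b) * q x y a b) \<le> s"
    and "s < (\<Sum>(x, y, a, b)\<in>UNIV. c (x, y, a, b) * p x y a b)"
proof -
  define \<Phi> :: "(real, 'x \<times> 'y \<times> 'a \<times> 'b) Finite_Cartesian_Product.vec \<Rightarrow> ('x, 'y, 'a, 'b) correlation"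
    where "\<Phi> v x y a b = vec_nth v (x, y, a, b)" for v x y a b
  define V :: "('x, 'y, 'a, 'b) correlation \<Rightarrow> (real, 'x \<times> 'y \<times> 'a \<times> 'b) Finite_Cartesian_Product.vec"
    where "V q = vec_lambda (\<lambda>(x, y, a, b). q x y a b)" for q
  have \<Phi>V: "\<Phi> (V q) = q" for q by (simp add: \<Phi>_def V_def fun_eq_iff)
  define S where "S = {v. \<Phi> v \<in> C_q}"
  have cont: "continuous_on A \<Phi>" for A
    unfolding \<Phi>_def by (intro continuous_on_coordinatewise_then_product continuous_intros)
  have "\<Phi> ` closure S \<subseteq> closure C_q"
    by (rule image_closure_subset[OF cont closed_closure]) (auto simp: S_def intro: closure_subset[THEN subsetD])
  then have "V p \<notin> closure S" using assms \<Phi>V[of p] by (metis imageI subsetD)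
  moreover have "convex S"
    unfolding convex_def
  proof (intro ballI allI impI)
    fix v w and s t :: real assume *: "v \<in> S" "w \<in> S" "0 \<le> s" "0 \<le> t" "s + t = 1"
    have "\<Phi> (s *\<^sub>R v + t *\<^sub>R w) = (\<lambda>x y a b. s * \<Phi> v x y a b + t * \<Phi> w x y a b)"
      by (simp add: \<Phi>_def fun_eq_iff)
    then show "s *\<^sub>R v + t *\<^sub>R w \<in> S"
      using C_q_convex[of "\<Phi> v" "\<Phi> w" s t] * by (simp add: S_def)
  qed
  ultimately obtain d r where d: "inner d (V p) < r" "\<And>v. v \<in> closure S \<Longrightarrow> inner d v > r"
    using separating_hyperplane_closed_point[of "closure S" "V p"] convex_closure by blast
  have inner: "(\<Sum>(x, y, a, b)\<in>UNIV. - vec_nth d (x, y, a, b) * q x y a b) = - inner d (V q)" for q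
    by (simp add: inner_vec_def V_def case_prod_unfold sum_negf)
  show ?thesis
  proof (rule that[of "\<lambda>i. - vec_nth d i" "- r"])
    fix q :: "('x, 'y, 'a, 'b) correlation" assume "q \<in> C_q"
    then have "V q \<in> closure S" by (auto simp: S_def \<Phi>V intro: closure_subset[THEN subsetD])
    then show "(\<Sum>(x, y, a, b)\<in>UNIV. - vec_nth d (x, y, a, b) * q x y a b) \<le> - r"
      unfolding inner using d(2) by (simp add: less_imp_le)
  next
    show "- r < (\<Sum>(x, y, a, b)\<in>UNIV. - vec_nth d (x, y, a, b) * p x y a b)"
      unfolding inner using d(1) by simp
  qed
qed

text \<open>The separating functional \<open>c\<close>, shifted by \<open>K\<close>, corresponds to a tensor of norm at most \<open>s + K\<close>. The functional
  of \<open>\<tau>\<close> is contractive and maps this tensor to \<open>c(p) + K\<close>.\<close>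

lemma amenable_trace_imp_C_qa:
  fixes p :: "('x::finite, 'y::finite, 'a::finite, 'b::finite) correlation"
    and e :: "'x \<Rightarrow> 'a \<Rightarrow> 'c::cstar_algebra" and f :: "'y \<Rightarrow> 'b \<Rightarrow> 'c"
  assumes \<tau>: "amenable_trace \<tau>" and e: "alg_pvm e" and f: "alg_pvm f"
    and p: "\<And>x y a b. complex_of_real (p x y a b) = \<tau> (e x a * f y b)"
    and one: "\<And>x y. (\<Sum>a\<in>UNIV. \<Sum>b\<in>UNIV. p x y a b) = 1"
  shows "p \<in> C_qa"
proof (rule ccontr)
  assume "p \<notin> C_qa"
  then obtain c s where c: "\<And>q. q \<in> C_q \<Longrightarrow> (\<Sum>(x, y, a, b)\<in>UNIV. c (x, y, a, b) * q x y a b) \<le> s"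
    and s: "s < (\<Sum>(x, y, a, b)\<in>UNIV. c (x, y, a, b) * p x y a b)"
    unfolding C_qa_def by (rule closure_C_q_separation) blast
  define K where "K = (\<Sum>i\<in>UNIV. \<bar>c i\<bar>) + \<bar>s\<bar>"
  have "0 \<le> (\<Sum>i\<in>UNIV. \<bar>c i\<bar>)" by (simp add: sum_nonneg)
  then have sK: "0 \<le> s + K" unfolding K_def by linarith
  have lin: "clinear \<tau>" using \<tau> by (simp add: amenable_trace_def is_trace_def)
  have \<tau>1: "\<tau> 1 = 1"
  proof -
    have "\<tau> ((\<Sum>a\<in>UNIV. e x a) * (\<Sum>b\<in>UNIV. f y b)) = (\<Sum>a\<in>UNIV. \<Sum>b\<in>UNIV. complex_of_real (p x y a b))" for x y
      by (simp add: sum_product clinear_sum[OF lin] p)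
    also have "\<dots> x y = complex_of_real (\<Sum>a\<in>UNIV. \<Sum>b\<in>UNIV. p x y a b)" for x y by simp
    finally show ?thesis by (simp add: alg_pvmD(3)[OF e] alg_pvmD(3)[OF f] one)
  qed
  obtain js :: "('x \<times> 'y \<times> 'a \<times> 'b) list" where js: "distinct js" "set js = UNIV"
    using finite_distinct_list[of "UNIV :: ('x \<times> 'y \<times> 'a \<times> 'b) set"] by auto
  define xs where "xs = map (\<lambda>(x, y, a, b). (complex_of_real (c (x, y, a, b)) *\<^sub>C e x a, f y b)) js
    @ [(complex_of_real K *\<^sub>C 1, 1)]"
  have list_sum: "(\<Sum>i\<leftarrow>js. g i) = (\<Sum>i\<in>UNIV. g i)" for g :: "_ \<Rightarrow> 'z::comm_monoid_add"
    using sum_list_distinct_conv_sum_set[OF js(1), of g] by (simp add: js)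
  have "cmod (\<Sum>(a, b)\<leftarrow>xs. \<tau> (a * b)) \<le> s + K"
  proof (rule amenable_trace_contractive[OF \<tau> \<tau>1 _ sK])
    fix u v assume "(u, v) \<in> set xs"
    then show "star u = u \<and> star v = v"
      by (auto simp: xs_def star_scaleC star_one alg_pvmD[OF e] alg_pvmD[OF f])
  next
    fix \<pi> :: "'c \<Rightarrow> 'c ell2 \<Rightarrow> 'c ell2" and \<sigma> :: "'c opposite \<Rightarrow> 'c opposite ell2 \<Rightarrow> 'c opposite ell2" and F \<zeta>
    assume rep: "star_representation \<pi>" "star_representation \<sigma>" "tensor_representation \<pi> \<sigma> F"
    have t: "pair_tensor xs = (\<Sum>(x, y, a, b)\<in>UNIV. complex_of_real (c (x, y, a, b)) *\<^sub>C (e x a \<otimes>\<^sub>T opp (f y b)))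
        + complex_of_real K *\<^sub>C (1 \<otimes>\<^sub>T opp 1)"
      by (simp add: pair_tensor_def xs_def o_def case_prod_unfold list_sum clinear_scaleC[OF clinear_tensor_prod_left])
    have "F (pair_tensor xs) \<zeta> =
        (\<Sum>(x, y, a, b)\<in>UNIV. complex_of_real (c (x, y, a, b)) *\<^sub>C F (e x a \<otimes>\<^sub>T opp (f y b)) \<zeta>)
        + complex_of_real K *\<^sub>C F (1 \<otimes>\<^sub>T opp 1) \<zeta>"
      unfolding t clinear_add[OF trep_linear[OF rep]] clinear_sum[OF trep_linear[OF rep]]
        clinear_scaleC[OF trep_linear[OF rep]] case_prod_unfold ..
    then show "norm (F (pair_tensor xs) \<zeta>) \<le> (s + K) * norm \<zeta>"
      using projections_norm_bound[OF e f rep c, of K \<zeta>] by (simp add: K_def)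
  qed
  moreover have "(\<Sum>(a, b)\<leftarrow>xs. \<tau> (a * b)) =
      complex_of_real ((\<Sum>(x, y, a, b)\<in>UNIV. c (x, y, a, b) * p x y a b) + K)"
    by (simp add: xs_def o_def case_prod_unfold list_sum mult_scaleC_left clinear_scaleC[OF lin] scaleC_complex_def
        \<tau>1 p)
  ultimately have "\<bar>(\<Sum>(x, y, a, b)\<in>UNIV. c (x, y, a, b) * p x y a b) + K\<bar> \<le> s + K"
    by (simp only: norm_of_real)
  then show False using s by linarith
qed

section \<open>Finite matrices as operators\<close>

definition mat_op :: "'i set \<Rightarrow> ('i \<Rightarrow> 'i \<Rightarrow> complex) \<Rightarrow> 'i ell2 \<Rightarrow> 'i ell2" where
  "mat_op I M \<xi> = fin_vec I (\<lambda>i. \<Sum>j\<in>I. M i j * coord \<xi> j)"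

lemma coord_mat_op:
  "finite I \<Longrightarrow> coord (mat_op I M \<xi>) i = (if i \<in> I then \<Sum>j\<in>I. M i j * coord \<xi> j else 0)"
  by (simp add: mat_op_def coord_fin_vec)

lemma mat_op_cong: "(\<And>i j. i \<in> I \<Longrightarrow> j \<in> I \<Longrightarrow> M i j = N i j) \<Longrightarrow> mat_op I M = mat_op I N"
  unfolding mat_op_def by (rule ext, rule coord_inject[THEN iffD1], rule ext) (simp add: fin_vec.rep_eq)

lemma bounded_clinear_mat_op:
  assumes I: "finite I"
  shows "bounded_clinear (mat_op I M)"
proof -
  have "norm (mat_op I M \<xi>) \<le> norm \<xi> * (\<Sum>i\<in>I. \<Sum>j\<in>I. cmod (M i j))" for \<xi>
  proof -
    have "norm (mat_op I M \<xi>) \<le> (\<Sum>i\<in>I. cmod (\<Sum>j\<in>I. M i j * coord \<xi> j))"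
      unfolding mat_op_def fin_vec_sum[OF I] by (rule order_trans[OF norm_sum]) (simp add: norm_scaleC norm_basis_vec)
    also have "\<dots> \<le> (\<Sum>i\<in>I. \<Sum>j\<in>I. cmod (M i j) * norm \<xi>)"
      by (intro sum_mono order_trans[OF norm_sum]) (simp add: norm_mult mult_left_mono norm_coord_le)
    finally show ?thesis by (simp add: mult.commute[of "norm \<xi>"] flip: sum_distrib_right)
  qed
  moreover have "clinear (mat_op I M)"
    using I by (auto simp: clinear_def coord_mat_op distrib_left sum.distrib sum_distrib_left mult_ac intro!: ell2_eqI)
  ultimately show ?thesis by (auto simp: bounded_clinear_def)
qed

lemma mat_op_compose:
  assumes "finite I"
  shows "mat_op I M (mat_op I N \<xi>) = mat_op I (\<lambda>i j. \<Sum>k\<in>I. M i k * N k j) \<xi>"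
proof (rule ell2_eqI)
  fix i
  have "(\<Sum>k\<in>I. M i k * (\<Sum>j\<in>I. N k j * coord \<xi> j)) = (\<Sum>k\<in>I. \<Sum>j\<in>I. M i k * N k j * coord \<xi> j)"
    by (simp add: sum_distrib_left mult.assoc)
  also have "\<dots> = (\<Sum>j\<in>I. (\<Sum>k\<in>I. M i k * N k j) * coord \<xi> j)"
    by (subst sum.swap) (simp add: sum_distrib_right)
  finally show "coord (mat_op I M (mat_op I N \<xi>)) i = coord (mat_op I (\<lambda>i j. \<Sum>k\<in>I. M i k * N k j) \<xi>) i"
    using assms by (simp add: coord_mat_op)
qed

lemma mat_op_add: "finite I \<Longrightarrow> mat_op I (\<lambda>i j. M i j + N i j) \<xi> = mat_op I M \<xi> + mat_op I N \<xi>"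
  by (rule ell2_eqI) (simp add: coord_mat_op distrib_right sum.distrib)

lemma mat_op_scale: "finite I \<Longrightarrow> mat_op I (\<lambda>i j. c * M i j) \<xi> = c *\<^sub>C mat_op I M \<xi>"
  by (rule ell2_eqI) (simp add: coord_mat_op sum_distrib_left mult.assoc)

lemma mat_op_zero: "finite I \<Longrightarrow> mat_op I (\<lambda>_ _. 0) \<xi> = 0"
  by (rule ell2_eqI) (simp add: coord_mat_op)

lemma cinner_mat_op:
  assumes "finite I"
  shows "cinner \<xi> (mat_op I M \<eta>) = (\<Sum>i\<in>I. \<Sum>j\<in>I. cnj (coord \<xi> i) * M i j * coord \<eta> j)"
  unfolding mat_op_def using assms
  by (subst cinner_commute) (simp add: cinner_fin_vec sum_distrib_left mult_ac)

lemma mat_op_adjoint: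
  assumes I: "finite I" and N: "\<And>i j. i \<in> I \<Longrightarrow> j \<in> I \<Longrightarrow> N i j = cnj (M j i)"
  shows "cinner (mat_op I N \<xi>) \<eta> = cinner \<xi> (mat_op I M \<eta>)"
proof -
  have "cinner (mat_op I N \<xi>) \<eta> = cnj (\<Sum>i\<in>I. \<Sum>j\<in>I. cnj (coord \<eta> i) * N i j * coord \<xi> j)"
    by (subst cinner_commute) (simp add: cinner_mat_op[OF I])
  also have "\<dots> = (\<Sum>i\<in>I. \<Sum>j\<in>I. cnj (coord \<xi> j) * M j i * coord \<eta> i)"
    by (simp add: N mult_ac)
  also have "\<dots> = cinner \<xi> (mat_op I M \<eta>)"
    unfolding cinner_mat_op[OF I] by (rule sum.swap)
  finally show ?thesis .
qed

lemma onorm_scaleC: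
  assumes T: "bounded_clinear T"
  shows "onorm (\<lambda>x. c *\<^sub>C T x) = cmod c * onorm T"
proof (cases "c = 0")
  case True
  then show ?thesis by (simp add: onorm_zero)
next
  case False
  note le = onorm[OF bounded_clinear_bounded_linear[OF T]]
  have bc: "bounded_clinear (\<lambda>x. c *\<^sub>C T x)"
  proof -
    have "norm (c *\<^sub>C T x) \<le> norm x * (cmod c * onorm T)" for x
      using mult_left_mono[OF le[of x], of "cmod c"] by (simp add: norm_scaleC mult_ac)
    moreover have "clinear (\<lambda>x. c *\<^sub>C T x)"
      using T by (auto simp: bounded_clinear_def clinear_def scaleC_add_right scaleC_scaleC mult.commute)
    ultimately show ?thesis by (auto simp: bounded_clinear_def)
  qed
  show ?thesis
  proof (rule antisym)
    show "onorm (\<lambda>x. c *\<^sub>C T x) \<le> cmod c * onorm T"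
      using le by (intro onorm_bound)
        (auto simp: norm_scaleC mult.assoc mult_left_mono onorm_pos_le[OF bounded_clinear_bounded_linear[OF T]])
    have "norm (T x) \<le> onorm (\<lambda>x. c *\<^sub>C T x) / cmod c * norm x" for x
      using onorm[OF bounded_clinear_bounded_linear[OF bc], of x] False by (simp add: norm_scaleC field_simps)
    then have "onorm T \<le> onorm (\<lambda>x. c *\<^sub>C T x) / cmod c"
      by (intro onorm_bound) (auto simp: onorm_pos_le[OF bounded_clinear_bounded_linear[OF bc]])
    then show "cmod c * onorm T \<le> onorm (\<lambda>x. c *\<^sub>C T x)"
      using False by (simp add: field_simps)
  qed
qed

lemma onorm_adjoint_le:
  fixes T S :: "'i ell2 \<Rightarrow> 'i ell2"
  assumes T: "bounded_clinear T" and S: "bounded_clinear S"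
    and adj: "\<And>x y. cinner (S x) y = cinner x (T y)"
  shows "onorm S \<le> onorm T"
proof (rule onorm_bound)
  show "0 \<le> onorm T" by (rule onorm_pos_le[OF bounded_clinear_bounded_linear[OF T]])
  fix x
  have "(norm (S x))\<^sup>2 = cmod (cinner (S x) (S x))" unfolding cinner_self norm_of_real by simp
  also have "\<dots> \<le> norm x * norm (T (S x))" unfolding adj by (rule cmod_cinner_le)
  also have "\<dots> \<le> norm x * (onorm T * norm (S x))"
    by (intro mult_left_mono onorm bounded_clinear_bounded_linear[OF T]) simp
  finally show "norm (S x) \<le> onorm T * norm x"
    by (cases "norm (S x) = 0")
      (simp_all add: power2_eq_square mult_ac onorm_pos_le[OF bounded_clinear_bounded_linear[OF T]])
qed

lemma onorm_adjoint_mult: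
  fixes T S :: "'i ell2 \<Rightarrow> 'i ell2"
  assumes T: "bounded_clinear T" and S: "bounded_clinear S"
    and adj: "\<And>x y. cinner (S x) y = cinner x (T y)"
  shows "onorm (\<lambda>x. S (T x)) = (onorm T)\<^sup>2"
proof (rule antisym)
  note bT = bounded_clinear_bounded_linear[OF T] and bS = bounded_clinear_bounded_linear[OF S]
  have "onorm (S \<circ> T) \<le> onorm S * onorm T" by (rule onorm_compose[OF bS bT])
  also have "\<dots> \<le> onorm T * onorm T"
    by (intro mult_right_mono onorm_adjoint_le assms onorm_pos_le bT)
  finally show "onorm (\<lambda>x. S (T x)) \<le> (onorm T)\<^sup>2" by (simp add: o_def power2_eq_square)
  have b: "bounded_linear (\<lambda>x. S (T x))"
    by (rule bounded_clinear_bounded_linear[OF bounded_clinear_compose[OF S T]])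
  have "norm (T x) \<le> sqrt (onorm (\<lambda>x. S (T x))) * norm x" for x
  proof -
    have "(norm (T x))\<^sup>2 = cmod (cinner (S (T x)) x)" unfolding adj cinner_self norm_of_real by simp
    also have "\<dots> \<le> norm (S (T x)) * norm x" by (rule cmod_cinner_le)
    also have "\<dots> \<le> (onorm (\<lambda>x. S (T x)) * norm x) * norm x"
      by (intro mult_right_mono onorm b) simp
    also have "\<dots> = (sqrt (onorm (\<lambda>x. S (T x))) * norm x)\<^sup>2"
      using onorm_pos_le[OF b] by (simp add: power_mult_distrib power2_eq_square mult.assoc)
    finally show ?thesis by (rule power2_le_imp_le) (simp add: onorm_pos_le[OF b])
  qed
  then have "onorm T \<le> sqrt (onorm (\<lambda>x. S (T x)))"
    using onorm_pos_le[OF b] by (intro onorm_bound) auto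
  then show "(onorm T)\<^sup>2 \<le> onorm (\<lambda>x. S (T x))"
    using onorm_pos_le[OF b] onorm_pos_le[OF bT] by (metis power_mono real_sqrt_pow2)
qed

text \<open>If projections sum to the identity, then \<open>\<Sum>\<^sub>b \<parallel>E\<^sub>b v\<parallel>\<^sup>2 = \<parallel>v\<parallel>\<^sup>2\<close>, and \<open>v\<close> in the range of \<open>E\<^sub>a\<close> already exhausts
  this with \<open>b = a\<close>.\<close>

lemma pvm_orthogonal:
  assumes I: "finite I" and E: "pvm I E" and ij: "i \<in> I" "j \<in> I"
  shows "(\<Sum>k\<in>I. E a i k * E a' k j) = (if a = a' then E a i j else 0)"
proof (cases "a = a'")
  case True
  then show ?thesis by (simp add: pvm_idem[OF E ij])
next
  case False
  define T where "T b = mat_op I (E b)" for b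
  define v where "v = T a' (basis_vec j)"
  have sa: "cinner (T b u) w = cinner u (T b w)" for b u w
    unfolding T_def by (rule mat_op_adjoint[OF I]) (rule pvm_herm[OF E])
  have idem: "T b (T b u) = T b u" for b u
    unfolding T_def mat_op_compose[OF I]
    by (rule fun_cong[OF mat_op_cong]) (simp add: pvm_idem[OF E])
  have sq: "complex_of_real ((norm (T b u))\<^sup>2) = cinner u (T b u)" for b u
    by (simp only: sa idem flip: cinner_self)
  have "(\<Sum>b\<in>UNIV. T b u) = mat_op I (\<lambda>i j. \<Sum>b\<in>UNIV. E b i j) u" for u
    by (rule ell2_eqI) (simp add: T_def coord_sum coord_mat_op[OF I] sum_distrib_right sum.swap[of _ I UNIV])
  also have "\<dots> u = mat_op I (\<lambda>i j. of_bool (i = j)) u" for u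
    by (rule fun_cong[OF mat_op_cong]) (simp add: pvm_one[OF E])
  finally have one: "(\<Sum>b\<in>UNIV. T b u) = mat_op I (\<lambda>i j. of_bool (i = j)) u" for u .
  have "mat_op I (\<lambda>i j. of_bool (i = j)) v = v"
    unfolding v_def T_def mat_op_compose[OF I]
    by (rule fun_cong[OF mat_op_cong]) (simp add: of_bool_def I if_distrib[of "\<lambda>x. x * _"] cong: if_cong)
  then have "(\<Sum>b\<in>UNIV. T b v) = v" by (simp add: one)
  then have "complex_of_real (\<Sum>b\<in>UNIV. (norm (T b v))\<^sup>2) = complex_of_real ((norm v)\<^sup>2)"
    unfolding of_real_sum sq by (simp only: cinner_self flip: cinner_sum_right)
  then have "(\<Sum>b\<in>UNIV. (norm (T b v))\<^sup>2) = (norm (T a' v))\<^sup>2"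
    by (simp only: of_real_eq_iff) (simp add: v_def idem)
  then have "(\<Sum>b\<in>UNIV - {a'}. (norm (T b v))\<^sup>2) = 0"
    by (simp add: sum_diff1)
  then have "T a v = 0"
    using False by (simp add: sum_nonneg_eq_0_iff)
  then have "coord (T a v) i = 0" by simp
  moreover have "coord (T a v) i = (\<Sum>k\<in>I. E a i k * E a' k j)"
    using ij by (simp add: v_def T_def coord_mat_op[OF I] coord_basis_vec I if_distrib[of "\<lambda>x. _ * x"] cong: if_cong)
  ultimately show ?thesis using False by simp
qed

section \<open>Matrix representations of the free product\<close>

text \<open>The matrices over a variable index set \<open>I\<close> do not form a type, so polynomials are evaluated entry by entry.\<close>

primrec word_mat :: "'i set \<Rightarrow> ('g \<Rightarrow> 'i \<Rightarrow> 'i \<Rightarrow> complex) \<Rightarrow> 'g list \<Rightarrow> 'i \<Rightarrow> 'i \<Rightarrow> complex" where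
  "word_mat I G [] i j = of_bool (i = j)"
| "word_mat I G (g # gs) i j = (\<Sum>k\<in>I. G g i k * word_mat I G gs k j)"

definition poly_mat :: "'i set \<Rightarrow> ('g \<Rightarrow> 'i \<Rightarrow> 'i \<Rightarrow> complex) \<Rightarrow> 'g ncpoly \<Rightarrow> 'i \<Rightarrow> 'i \<Rightarrow> complex" where
  "poly_mat I G p i j = (\<Sum>w\<in>Poly_Mapping.keys p. Poly_Mapping.lookup p w * word_mat I G (letters w) i j)"

lemma poly_mat_superset:
  assumes "finite S" "Poly_Mapping.keys p \<subseteq> S"
  shows "poly_mat I G p i j = (\<Sum>w\<in>S. Poly_Mapping.lookup p w * word_mat I G (letters w) i j)"
  unfolding poly_mat_def using assms by (intro sum.mono_neutral_left) (auto simp: in_keys_iff)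

lemma poly_mat_single: "poly_mat I G (Poly_Mapping.single w c) i j = c * word_mat I G (letters w) i j"
  by (subst poly_mat_superset[of "{w}"]) auto

lemma poly_mat_add: "poly_mat I G (p + q) i j = poly_mat I G p i j + poly_mat I G q i j"
proof -
  let ?S = "Poly_Mapping.keys p \<union> Poly_Mapping.keys q"
  have "Poly_Mapping.keys (p + q) \<subseteq> ?S" by (rule Poly_Mapping.keys_add)
  then show ?thesis by (simp add: poly_mat_superset[of ?S] lookup_add distrib_right sum.distrib)
qed

lemma poly_mat_zero: "poly_mat I G 0 i j = 0"
  by (simp add: poly_mat_def)

lemma poly_mat_diff: "poly_mat I G (p - q) i j = poly_mat I G p i j - poly_mat I G q i j"
  using poly_mat_add[of I G "p - q" q i j] by simp

lemma poly_mat_sum: "poly_mat I G (sum f S) i j = (\<Sum>k\<in>S. poly_mat I G (f k) i j)"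
  by (induction S rule: infinite_finite_induct) (simp_all add: poly_mat_add poly_mat_zero)

lemma poly_mat_one: "poly_mat I G 1 i j = of_bool (i = j)"
  by (simp add: poly_mat_single zero_free_word_def flip: single_one)

lemma word_mat_append:
  assumes "finite I"
  shows "i \<in> I \<Longrightarrow> word_mat I G (us @ vs) i j = (\<Sum>k\<in>I. word_mat I G us i k * word_mat I G vs k j)"
proof (induction us arbitrary: i)
  case Nil
  then show ?case using assms by (simp add: of_bool_def if_distrib[of "\<lambda>x. x * _"] cong: if_cong)
next
  case (Cons u us)
  have "word_mat I G ((u # us) @ vs) i j = (\<Sum>k\<in>I. \<Sum>l\<in>I. G u i k * (word_mat I G us k l * word_mat I G vs l j))"
    using Cons by (simp add: sum_distrib_left)
  also have "\<dots> = (\<Sum>l\<in>I. word_mat I G (u # us) i l * word_mat I G vs l j)"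
    by (subst sum.swap) (simp add: sum_distrib_right mult.assoc)
  finally show ?case .
qed

context
  fixes I :: "'i set" and G :: "'g \<Rightarrow> 'i \<Rightarrow> 'i \<Rightarrow> complex"
  assumes I: "finite I" and herm: "\<And>g i j. i \<in> I \<Longrightarrow> j \<in> I \<Longrightarrow> G g j i = cnj (G g i j)"
begin

lemma poly_mat_mult:
  assumes i: "i \<in> I"
  shows "poly_mat I G (p * q) i j = (\<Sum>k\<in>I. poly_mat I G p i k * poly_mat I G q k j)"
proof (induction p rule: poly_induct)
  case (single w c)
  show ?case
    by (induction q rule: poly_induct)
      (simp_all add: mult_single poly_mat_single plus_free_word_def word_mat_append[OF I i] distrib_left poly_mat_add
        sum_distrib_left sum.distrib mult_ac)
qed (simp add: distrib_right poly_mat_add sum.distrib)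

lemma poly_mat_gen: "j \<in> I \<Longrightarrow> poly_mat I G (poly_gen g) i j = G g i j"
  using I by (simp add: poly_gen_def poly_mat_single of_bool_def if_distrib[of "\<lambda>x. _ * x"] cong: if_cong)

lemma poly_mat_const: "i \<in> I \<Longrightarrow> poly_mat I G (poly_const c * p) i j = c * poly_mat I G p i j"
  using I by (simp add: poly_mat_mult) (simp add: poly_const_def poly_mat_single zero_free_word_def of_bool_def
      if_distrib[of "\<lambda>x. x * _"] if_distrib[of "\<lambda>x. _ * x"] cong: if_cong)

lemma word_mat_rev: "i \<in> I \<Longrightarrow> j \<in> I \<Longrightarrow> word_mat I G (rev gs) j i = cnj (word_mat I G gs i j)"
proof (induction gs arbitrary: i)
  case (Cons g gs)
  have "word_mat I G (rev (g # gs)) j i = (\<Sum>k\<in>I. word_mat I G (rev gs) j k * G g k i)"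
    using Cons.prems I by (simp add: word_mat_append of_bool_def if_distrib[of "\<lambda>x. _ * x"] cong: if_cong)
  also have "\<dots> = (\<Sum>k\<in>I. cnj (word_mat I G gs k j) * cnj (G g i k))"
    using Cons by (intro sum.cong refl arg_cong2[of _ _ _ _ "(*)"] herm) auto
  finally show ?case by (simp add: mult.commute)
qed auto

lemma poly_mat_star:
  assumes "i \<in> I" "j \<in> I"
  shows "poly_mat I G (poly_star p) i j = cnj (poly_mat I G p j i)"
  by (induction p rule: poly_induct)
    (simp_all add: poly_star_single poly_mat_single word_rev_def word_mat_rev assms poly_star_add poly_mat_add)

lemma cstar_seminorm_matrix: "cstar_seminorm (\<lambda>p. onorm (mat_op I (poly_mat I G p)))"
  unfolding cstar_seminorm_def
proof (intro conjI allI)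
  fix p q c
  let ?T = "\<lambda>p. mat_op I (poly_mat I G p)"
  note bl = bounded_clinear_bounded_linear[OF bounded_clinear_mat_op[OF I]]
  have "?T (p + q) = (\<lambda>\<xi>. ?T p \<xi> + ?T q \<xi>)"
    unfolding mat_op_add[OF I, symmetric] by (rule mat_op_cong) (simp add: poly_mat_add)
  then show "onorm (?T (p + q)) \<le> onorm (?T p) + onorm (?T q)"
    using onorm_triangle[OF bl bl] by simp
  have "?T (poly_const c * p) = (\<lambda>\<xi>. c *\<^sub>C ?T p \<xi>)"
    unfolding mat_op_scale[OF I, symmetric] by (rule mat_op_cong) (simp add: poly_mat_const)
  then show "onorm (?T (poly_const c * p)) = cmod c * onorm (?T p)"
    by (simp add: onorm_scaleC[OF bounded_clinear_mat_op[OF I]])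
  have mult: "?T (p * q) = (\<lambda>\<xi>. ?T p (?T q \<xi>))" for p q
    unfolding mat_op_compose[OF I] by (rule mat_op_cong) (simp add: poly_mat_mult)
  then show "onorm (?T (p * q)) \<le> onorm (?T p) * onorm (?T q)"
    using onorm_compose[OF bl bl] by (simp add: o_def)
  show "onorm (?T (poly_star p * p)) = (onorm (?T p))\<^sup>2"
    unfolding mult
    by (rule onorm_adjoint_mult) (auto intro: bounded_clinear_mat_op[OF I] mat_op_adjoint[OF I] simp: poly_mat_star)
qed

lemma cmod_poly_mat_le:
  assumes "i \<in> I" "j \<in> I"
  shows "cmod (poly_mat I G p i j) \<le> onorm (mat_op I (poly_mat I G p))"
proof -
  let ?T = "mat_op I (poly_mat I G p)"
  have "poly_mat I G p i j = coord (?T (basis_vec j)) i"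
    using assms by (simp add: coord_mat_op[OF I] coord_basis_vec I if_distrib[of "\<lambda>x. _ * x"] cong: if_cong)
  also have "cmod \<dots> \<le> norm (?T (basis_vec j))" by (rule norm_coord_le)
  also have "\<dots> \<le> onorm ?T * norm (basis_vec j)"
    by (rule onorm[OF bounded_clinear_bounded_linear[OF bounded_clinear_mat_op[OF I]]])
  finally show ?thesis by (simp add: norm_basis_vec)
qed

end

lemma free_seminorm_matrix:
  fixes P :: "'x \<Rightarrow> 'a::finite \<Rightarrow> 'i \<Rightarrow> 'i \<Rightarrow> complex"
  assumes I: "finite I" and P: "\<And>x. pvm I (P x)"
  shows "free_seminorm (\<lambda>p. onorm (mat_op I (poly_mat I (\<lambda>(x, a). P x a) p)))"
proof -
  let ?G = "\<lambda>(x, a). P x a"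
  have herm: "?G g j i = cnj (?G g i j)" if "i \<in> I" "j \<in> I" for g i j
    by (cases g) (simp, rule pvm_herm[OF P that])
  have zero: "onorm (mat_op I (poly_mat I ?G p)) = 0"
    if "\<And>i j. i \<in> I \<Longrightarrow> j \<in> I \<Longrightarrow> poly_mat I ?G p i j = 0" for p
  proof -
    have "mat_op I (poly_mat I ?G p) = (\<lambda>_. 0)"
    proof -
      have "mat_op I (poly_mat I ?G p) = mat_op I (\<lambda>_ _. 0)" by (rule mat_op_cong) (rule that)
      then show ?thesis by (simp add: fun_eq_iff mat_op_zero[OF I])
    qed
    then show ?thesis by (simp add: onorm_zero)
  qed
  have rel: "poly_mat I ?G (poly_gen (x, a) * poly_gen (x, a') - (if a = a' then poly_gen (x, a) else 0)) i j = 0"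
    if "i \<in> I" "j \<in> I" for x a a' i j
    using that pvm_orthogonal[OF I P[of x] that, of a a']
    by (simp add: poly_mat_diff poly_mat_mult[OF I herm] poly_mat_gen[OF I herm] poly_mat_zero)
  have unit: "poly_mat I ?G ((\<Sum>a\<in>UNIV. poly_gen (x, a)) - 1) i j = 0" if "i \<in> I" "j \<in> I" for x i j
    using that pvm_one[OF P[of x] that]
    by (simp add: poly_mat_diff poly_mat_sum poly_mat_gen[OF I herm] poly_mat_one)
  show ?thesis
    unfolding free_seminorm_def
  proof (intro conjI allI)
    show "cstar_seminorm (\<lambda>p. onorm (mat_op I (poly_mat I ?G p)))"
      by (rule cstar_seminorm_matrix[OF I herm])
  qed (rule zero, erule (1) rel unit)+
qed

lemma closure_range_of_poly: "z \<in> closure (range of_poly)"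
proof -
  obtain u where "(\<lambda>n. of_poly (u n)) \<longlonglongrightarrow> z" by (metis free_cstar_approx)
  then show ?thesis unfolding closure_sequential by (intro exI[of _ "\<lambda>n. of_poly (u n)"]) simp
qed

lemma free_cstar_induct:
  assumes "closed {z. P z}" "\<And>p. P (of_poly p)"
  shows "P z"
proof -
  have "closure (range of_poly) \<subseteq> {z. P z}" by (rule closure_minimal) (use assms in auto)
  then show ?thesis using closure_range_of_poly by blast
qed

lemma poly_functional_extension:
  fixes f :: "('x \<times> 'a::finite) ncpoly \<Rightarrow> complex"
  assumes add: "\<And>p q. f (p + q) = f p + f q" and scale: "\<And>c p. f (poly_const c * p) = c * f p"
    and le: "\<And>p. cmod (f p) \<le> max_norm p"
  obtains g where "bounded_clinear g" "\<And>p. g (of_poly p) = f p"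
proof -
  have f_diff: "f (p - q) = f p - f q" for p q using add[of "p - q" q] by simp
  have "\<exists>u. poly_Cauchy u \<and> (\<lambda>n. of_poly (u n)) \<longlonglongrightarrow> z" for z :: "('x, 'a) free_cstar"
    by (rule free_cstar_approx[of z]) blast
  then have "\<exists>v. \<forall>z :: ('x, 'a) free_cstar. poly_Cauchy (v z) \<and> (\<lambda>n. of_poly (v z n)) \<longlonglongrightarrow> z"
    by (intro choice) blast
  then obtain v where v: "\<And>z. poly_Cauchy (v z)" "\<And>z :: ('x, 'a) free_cstar. (\<lambda>n. of_poly (v z n)) \<longlonglongrightarrow> z"
    by blast
  have conv: "convergent (\<lambda>n. f (u n))" if u: "poly_Cauchy u" for u
  proof -
    have "Cauchy (\<lambda>n. f (u n))"
      unfolding Cauchy_def dist_norm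
    proof (intro allI impI)
      fix r :: real assume "r > 0"
      then obtain N where "\<And>m n. m \<ge> N \<Longrightarrow> n \<ge> N \<Longrightarrow> max_norm (u m - u n) < r"
        by (rule poly_CauchyE[OF u]) blast
      then show "\<exists>N. \<forall>m\<ge>N. \<forall>n\<ge>N. norm (f (u m) - f (u n)) < r"
        unfolding f_diff[symmetric] using order_le_less_trans[OF le] by blast
    qed
    then show ?thesis by (rule Cauchy_convergent)
  qed
  define g where "g z = lim (\<lambda>n. f (v z n))" for z
  have g_lim: "(\<lambda>n. f (u n)) \<longlonglongrightarrow> g z" if u: "poly_Cauchy u" "(\<lambda>n. of_poly (u n)) \<longlonglongrightarrow> z" for u z
  proof -
    have "(\<lambda>n. of_poly (u n) - of_poly (v z n)) \<longlonglongrightarrow> z - z"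
      by (intro tendsto_diff u v)
    then have "(\<lambda>n. max_norm (u n - v z n)) \<longlonglongrightarrow> 0"
      using tendsto_norm_zero[of "\<lambda>n. of_poly (u n) - of_poly (v z n)"] by (simp add: of_poly_diff norm_of_poly)
    then have "(\<lambda>n. f (u n) - f (v z n)) \<longlonglongrightarrow> 0"
      by (rule Lim_null_comparison[rotated]) (simp add: le flip: f_diff)
    moreover have "(\<lambda>n. f (v z n)) \<longlonglongrightarrow> g z"
      using conv[OF v(1)] by (simp add: g_def convergent_LIMSEQ_iff)
    ultimately have "(\<lambda>n. f (u n) - f (v z n) + f (v z n)) \<longlonglongrightarrow> 0 + g z" by (rule tendsto_add)
    then show ?thesis by simp
  qed
  have g_poly: "g (of_poly p) = f p" for p
    using LIMSEQ_unique[OF g_lim[OF poly_Cauchy_const tendsto_const] tendsto_const] .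
  have "g (z + w) = g z + g w" for z w
  proof -
    have "(\<lambda>n. f (v z n + v w n)) \<longlonglongrightarrow> g (z + w)"
      by (intro g_lim poly_Cauchy_add v) (simp add: of_poly_add tendsto_add v)
    then show ?thesis
      unfolding add using tendsto_add[OF g_lim[OF v] g_lim[OF v], of z w] by (rule LIMSEQ_unique)
  qed
  moreover have "g (c *\<^sub>C z) = c * g z" for c z
  proof -
    have bl: "bounded_linear (\<lambda>z :: ('x, 'a) free_cstar. c *\<^sub>C z)"
      by (rule bounded_clinear_bounded_linear)
        (auto simp: bounded_clinear_def clinear_def scaleC_add_right scaleC_scaleC mult.commute norm_scaleC
          intro!: exI[of _ "cmod c"])
    have "(\<lambda>n. f (poly_const c * v z n)) \<longlonglongrightarrow> g (c *\<^sub>C z)"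
      by (intro g_lim poly_Cauchy_scale v) (simp add: of_poly_scale bounded_linear.tendsto[OF bl] v)
    then show ?thesis
      unfolding scale using tendsto_mult_left[OF g_lim[OF v], of c z] by (rule LIMSEQ_unique)
  qed
  moreover have "cmod (g z) \<le> norm z" for z
    by (rule LIMSEQ_le[OF tendsto_norm[OF g_lim[OF v]] tendsto_norm[OF v(2)]]) (simp add: norm_of_poly le)
  ultimately have "bounded_clinear g"
    unfolding bounded_clinear_def clinear_def scaleC_complex_def by (metis mult.right_neutral)
  then show ?thesis using g_poly by (rule that)
qed

definition mat_hom :: "'i set \<Rightarrow> ('c::cstar_algebra \<Rightarrow> 'i \<Rightarrow> 'i \<Rightarrow> complex) \<Rightarrow> bool" where
  "mat_hom I M \<longleftrightarrow> finite I \<and> (\<forall>i j. clinear (\<lambda>z. M z i j)) \<and>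
     (\<forall>z w. \<forall>i\<in>I. \<forall>j\<in>I. M (z * w) i j = (\<Sum>k\<in>I. M z i k * M w k j)) \<and>
     (\<forall>z. \<forall>i\<in>I. \<forall>j\<in>I. M (star z) i j = cnj (M z j i)) \<and>
     (\<forall>i\<in>I. \<forall>j\<in>I. M 1 i j = of_bool (i = j))"

lemma mat_homD:
  assumes "mat_hom I M"
  shows "finite I" "clinear (\<lambda>z. M z i j)"
    "i \<in> I \<Longrightarrow> j \<in> I \<Longrightarrow> M (z * w) i j = (\<Sum>k\<in>I. M z i k * M w k j)"
    "i \<in> I \<Longrightarrow> j \<in> I \<Longrightarrow> M (star z) i j = cnj (M z j i)"
    "i \<in> I \<Longrightarrow> j \<in> I \<Longrightarrow> M 1 i j = of_bool (i = j)"
  using assms unfolding mat_hom_def by blast+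

text \<open>The entries of polynomials in the projections are dominated by the operator norm, which is one of the
  seminorms that define the maximal norm; so they extend to the completion by continuity.\<close>

lemma free_cstar_mat_hom:
  fixes P :: "'x \<Rightarrow> 'a::finite \<Rightarrow> 'i \<Rightarrow> 'i \<Rightarrow> complex"
  assumes I: "finite I" and P: "\<And>x. pvm I (P x)"
  obtains M :: "('x, 'a) free_cstar \<Rightarrow> 'i \<Rightarrow> 'i \<Rightarrow> complex" where
    "mat_hom I M" "\<And>x a i j. i \<in> I \<Longrightarrow> j \<in> I \<Longrightarrow> M (free_gen x a) i j = P x a i j"
proof -
  let ?G = "\<lambda>(x, a). P x a"
  have herm: "?G g j i = cnj (?G g i j)" if "i \<in> I" "j \<in> I" for g i j
    by (cases g) (simp, rule pvm_herm[OF P that])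
  note pm = poly_mat_mult[OF I herm] poly_mat_gen[OF I herm] poly_mat_star[OF I herm]
  have "\<exists>g :: ('x, 'a) free_cstar \<Rightarrow> complex. bounded_clinear g \<and> (i \<in> I \<longrightarrow> j \<in> I \<longrightarrow> (\<forall>p. g (of_poly p) = poly_mat I ?G p i j))" for i j
  proof (cases "i \<in> I \<and> j \<in> I")
    case True
    have "cmod (poly_mat I ?G p i j) \<le> max_norm p" for p
    proof -
      have "cmod (poly_mat I ?G p i j) \<le> onorm (mat_op I (poly_mat I ?G p))"
        by (rule cmod_poly_mat_le[OF I herm]) (use True in auto)
      also have "\<dots> \<le> max_norm p"
        by (rule max_norm_upper[OF free_seminorm_matrix[OF I P]])
      finally show ?thesis .
    qed
    then obtain g :: "('x, 'a) free_cstar \<Rightarrow> complex" where "bounded_clinear g" "\<And>p. g (of_poly p) = poly_mat I ?G p i j"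
      by (rule poly_functional_extension[of "\<lambda>p. poly_mat I ?G p i j", rotated 2])
        (use True in \<open>auto simp: poly_mat_add poly_mat_const[OF I herm]\<close>)
    then show ?thesis by blast
  next
    case False
    have "bounded_clinear (\<lambda>_ :: ('x, 'a) free_cstar. 0 :: complex)"
      by (auto simp: bounded_clinear_def clinear_def intro!: exI[of _ 0])
    then show ?thesis using False by blast
  qed
  then obtain M' :: "'i \<Rightarrow> 'i \<Rightarrow> ('x, 'a) free_cstar \<Rightarrow> complex" where M': "\<And>i j. bounded_clinear (M' i j)"
    "\<And>i j p. i \<in> I \<Longrightarrow> j \<in> I \<Longrightarrow> M' i j (of_poly p) = poly_mat I ?G p i j"
    by metis
  note cont = continuous_on_compose2[OF bounded_clinear_continuous[OF M'(1)], OF _ subset_UNIV]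
  have tstar: "continuous_on UNIV (star :: ('x, 'a) free_cstar \<Rightarrow> _)"
    unfolding continuous_on_sequentially by (auto simp: o_def tendsto_star)
  have mult: "M' i j (z * w) = (\<Sum>k\<in>I. M' i k z * M' k j w)" if ij: "i \<in> I" "j \<in> I" for i j z w
  proof (induction z rule: free_cstar_induct)
    case 1
    show ?case by (intro closed_Collect_eq continuous_intros cont)
  next
    case (2 p)
    show ?case
    proof (induction w rule: free_cstar_induct)
      case 1
      show ?case by (intro closed_Collect_eq continuous_intros cont)
    next
      case (2 q)
      show ?case using ij by (simp add: M'(2) pm flip: of_poly_mult)
    qed
  qed
  have star: "M' i j (star z) = cnj (M' j i z)" if ij: "i \<in> I" "j \<in> I" for i j z
  proof (induction z rule: free_cstar_induct)
    case 1
    show ?case by (intro closed_Collect_eq continuous_intros cont tstar)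
  next
    case (2 p)
    show ?case using ij by (simp add: M'(2) pm flip: of_poly_star)
  qed
  have "M' i j 1 = of_bool (i = j)" if "i \<in> I" "j \<in> I" for i j
    using M'(2)[OF that, of 1] by (simp add: of_poly_one poly_mat_one)
  then have "mat_hom I (\<lambda>z i j. M' i j z)"
    unfolding mat_hom_def using I M'(1) mult star by (auto simp: bounded_clinear_def)
  moreover have "M' i j (free_gen x a) = P x a i j" if "i \<in> I" "j \<in> I" for x a i j
    using that by (simp add: free_gen_def M'(2) pm)
  ultimately show ?thesis by (rule that)
qed

section \<open>Tensor representations from finite models\<close>

lemma clinear_mat_op:
  assumes "finite I" "\<And>i j. clinear (\<lambda>z. M z i j)"
  shows "clinear (\<lambda>z. mat_op I (M z) \<xi>)"
proof -
  have "M (z + w) = (\<lambda>i j. M z i j + M w i j)" "M (c *\<^sub>C z) = (\<lambda>i j. c * M z i j)" for z w c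
    using clinear_add[OF assms(2)] clinear_scaleC[OF assms(2)] by (simp_all add: fun_eq_iff scaleC_complex_def)
  then show ?thesis
    by (simp add: clinear_def mat_op_add[OF assms(1)] mat_op_scale[OF assms(1)])
qed

lemma mat_hom_star_representation:
  assumes M: "mat_hom I M"
  shows "star_representation (\<lambda>z. mat_op I (M z))"
proof -
  note I = mat_homD(1)[OF M]
  have "mat_op I (M (z * w)) \<xi> = mat_op I (M z) (mat_op I (M w) \<xi>)" for z w \<xi>
    unfolding mat_op_compose[OF I] by (rule fun_cong[OF mat_op_cong]) (rule mat_homD(3)[OF M])
  moreover have "cinner (mat_op I (M (star z)) \<xi>) \<eta> = cinner \<xi> (mat_op I (M z) \<eta>)" for z \<xi> \<eta>
    by (rule mat_op_adjoint[OF I]) (rule mat_homD(4)[OF M])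
  ultimately show ?thesis
    unfolding star_representation_def
    using bounded_clinear_mat_op[OF I] clinear_mat_op[of I M, OF I mat_homD(2)[OF M]] by blast
qed

lemma unop_opp [simp]: "unop (opp a) = a"
  by (simp add: opp_inverse)

lemma mat_hom_opposite:
  assumes M: "mat_hom I M"
  shows "mat_hom I (\<lambda>w i j. M (unop w) j i)"
proof -
  have u: "unop (v + w) = unop v + unop w" "unop (c *\<^sub>C v) = c *\<^sub>C unop v" "unop 1 = 1"
    "unop (v * w) = unop w * unop v" "unop (star v) = star (unop v)" for v w :: "'b opposite" and c
    by (transfer; simp)+
  have cl: "clinear (\<lambda>w. M (unop w) j i)" for i j
    using mat_homD(2)[OF M] by (simp add: clinear_def u)
  have st: "M (unop (star w)) j i = cnj (M (unop w) i j)" if "i \<in> I" "j \<in> I" for w i j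
    using mat_homD(4)[OF M that(2,1), of "unop w"] by (simp add: u)
  show ?thesis
    unfolding mat_hom_def
  proof (intro conjI allI ballI)
    fix i j assume ij: "i \<in> I" "j \<in> I"
    show "M (unop (v * w)) j i = (\<Sum>k\<in>I. M (unop v) k i * M (unop w) j k)" for v w
      using mat_homD(3)[OF M ij(2,1), of "unop w" "unop v"] by (simp add: u mult.commute)
    show "M (unop 1) j i = of_bool (i = j)"
      unfolding u mat_homD(5)[OF M ij(2,1)] by (auto simp: of_bool_def)
    show "M (unop (star w)) j i = cnj (M (unop w) i j)" for w by (rule st[OF ij])
  qed (rule mat_homD(1)[OF M], rule cl)
qed

definition kron :: "('i \<Rightarrow> 'i \<Rightarrow> complex) \<Rightarrow> ('j \<Rightarrow> 'j \<Rightarrow> complex) \<Rightarrow> 'i \<times> 'j \<Rightarrow> 'i \<times> 'j \<Rightarrow> complex" where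
  "kron E G u v = E (fst u) (fst v) * G (snd u) (snd v)"

text \<open>The tensor is evaluated at the bilinear form \<open>(a, b) \<mapsto> M(a) \<otimes> N(b)\<close> of one entry, hence linearity holds by
  construction.\<close>

definition tensor_mat ::
    "('c::complex_vector \<Rightarrow> 'i \<Rightarrow> 'i \<Rightarrow> complex) \<Rightarrow> ('d::complex_vector \<Rightarrow> 'j \<Rightarrow> 'j \<Rightarrow> complex) \<Rightarrow>
     ('c, 'd) tensor \<Rightarrow> 'i \<times> 'j \<Rightarrow> 'i \<times> 'j \<Rightarrow> complex" where
  "tensor_mat M N t u v = Rep_tensor t (\<lambda>a b. kron (M a) (N b) u v)"

lemma tensor_mat_elementary:
  assumes "\<And>i j. clinear (\<lambda>z. M z i j)" "\<And>i j. clinear (\<lambda>w. N w i j)"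
  shows "tensor_mat M N (a \<otimes>\<^sub>T b) = kron (M a) (N b)"
proof -
  have "bilinear_form (\<lambda>a b. kron (M a) (N b) u v)" for u v
    using assms by (simp add: bilinear_form_def clinear_def kron_def algebra_simps scaleC_complex_def)
  then show ?thesis
    by (simp add: fun_eq_iff tensor_mat_def tensor_prod.rep_eq eval_form_def)
qed

lemma mat_op_kron_tensor:
  assumes "finite I" "finite J"
  shows "mat_op (I \<times> J) (kron E G) (ell2_tensor \<xi> \<eta>) = ell2_tensor (mat_op I E \<xi>) (mat_op J G \<eta>)"
proof (rule ell2_eqI)
  fix u :: "'a \<times> 'b"
  obtain i j where u: "u = (i, j)" by (cases u)
  have "(\<Sum>v\<in>I \<times> J. kron E G u v * coord (ell2_tensor \<xi> \<eta>) v) =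
      (\<Sum>k\<in>I. \<Sum>l\<in>J. (E i k * coord \<xi> k) * (G j l * coord \<eta> l))"
    by (simp add: sum.cartesian_product kron_def u ell2_tensor.rep_eq case_prod_unfold mult_ac)
  also have "\<dots> = (\<Sum>k\<in>I. E i k * coord \<xi> k) * (\<Sum>l\<in>J. G j l * coord \<eta> l)"
    by (simp add: sum_product)
  finally show "coord (mat_op (I \<times> J) (kron E G) (ell2_tensor \<xi> \<eta>)) u = coord (ell2_tensor (mat_op I E \<xi>) (mat_op J G \<eta>)) u"
    using assms by (simp add: coord_mat_op ell2_tensor.rep_eq u)
qed

lemma mat_hom_tensor_representation:
  assumes M: "mat_hom I M" and N: "mat_hom J N"
  shows "tensor_representation (\<lambda>z. mat_op I (M z)) (\<lambda>w. mat_op J (N w)) (\<lambda>t. mat_op (I \<times> J) (tensor_mat M N t))"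
proof -
  have fin: "finite (I \<times> J)" using mat_homD(1)[OF M] mat_homD(1)[OF N] by simp
  have "clinear (\<lambda>t. tensor_mat M N t u v)" for u v
    by (simp add: clinear_def tensor_mat_def plus_tensor.rep_eq scaleC_tensor.rep_eq scaleC_complex_def)
  from clinear_mat_op[of "I \<times> J" "tensor_mat M N", OF fin this] show ?thesis
    unfolding tensor_representation_def tensor_mat_elementary[OF mat_homD(2)[OF M] mat_homD(2)[OF N]]
      mat_op_kron_tensor[OF mat_homD(1)[OF M] mat_homD(1)[OF N]]
    using bounded_clinear_mat_op[OF fin] by blast
qed

lemma pvm_coarse:
  assumes I: "finite I" and E: "pvm I E"
  shows "pvm I (\<lambda>a i j. \<Sum>b | g b = a. E b i j)"
  unfolding pvm_def
proof (intro conjI allI ballI)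
  fix a i j assume ij: "i \<in> I" "j \<in> I"
  show "(\<Sum>b | g b = a. E b j i) = cnj (\<Sum>b | g b = a. E b i j)"
    unfolding cnj_sum by (intro sum.cong refl pvm_herm[OF E] ij)
  have "(\<Sum>k\<in>I. (\<Sum>b | g b = a. E b i k) * (\<Sum>b | g b = a. E b k j)) =
      (\<Sum>b | g b = a. \<Sum>b' | g b' = a. \<Sum>k\<in>I. E b i k * E b' k j)"
    by (simp add: sum_product sum.swap[of _ _ I])
  also have "\<dots> = (\<Sum>b | g b = a. \<Sum>b' | g b' = a. if b = b' then E b i j else 0)"
    by (simp add: pvm_orthogonal[OF I E ij])
  also have "\<dots> = (\<Sum>b | g b = a. E b i j)"
    by (intro sum.cong refl) simp
  finally show "(\<Sum>k\<in>I. (\<Sum>b | g b = a. E b i k) * (\<Sum>b | g b = a. E b k j)) = (\<Sum>b | g b = a. E b i j)" .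
  show "(\<Sum>a\<in>UNIV. \<Sum>b | g b = a. E b i j) = of_bool (i = j)"
    using sum.group[of UNIV UNIV g "\<lambda>b. E b i j"] pvm_one[OF E ij] by simp
qed

lemma pvm_transpose:
  assumes E: "pvm I E"
  shows "pvm I (\<lambda>a i j. E a j i)"
  unfolding pvm_def
proof (intro conjI allI ballI)
  fix a i j assume ij: "i \<in> I" "j \<in> I"
  show "E a i j = cnj (E a j i)" by (rule pvm_herm[OF E ij(2,1)])
  show "(\<Sum>k\<in>I. E a k i * E a j k) = E a j i"
    using pvm_idem[OF E ij(2,1), of a] by (simp add: mult.commute)
  show "(\<Sum>a\<in>UNIV. E a j i) = of_bool (i = j)"
    unfolding pvm_one[OF E ij(2,1)] by (auto simp: of_bool_def)
qed

text \<open>The component \<open>w a' b\<close> enters the first marginal \<open>u\<close> if \<open>a' = a\<close>, and the coarse-grained second marginal if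
  \<open>g b = a\<close>. On the graph of \<open>g\<close>, where \<open>a' = g b\<close>, these conditions agree.\<close>

lemma coarse_graining_close:
  fixes w :: "'a::finite \<Rightarrow> 'b::finite \<Rightarrow> 'v::real_normed_vector"
  assumes u: "u = (\<Sum>b\<in>UNIV. w a b)" and v: "\<And>b. v b = (\<Sum>a\<in>UNIV. w a b)"
  shows "norm (u - (\<Sum>b | g b = a. v b)) \<le> (\<Sum>a\<in>UNIV. \<Sum>b\<in>UNIV. if a = g b then 0 else norm (w a b))"
proof -
  have "u = (\<Sum>a'\<in>UNIV. \<Sum>b\<in>UNIV. of_bool (a' = a) *\<^sub>R w a' b)"
    by (simp add: u of_bool_def if_distrib[of "\<lambda>x. x *\<^sub>R _"] sum.swap[of _ "UNIV :: 'b set" "UNIV :: 'a set"] cong: if_cong)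
  moreover have "(\<Sum>b | g b = a. v b) = (\<Sum>a'\<in>UNIV. \<Sum>b\<in>UNIV. of_bool (g b = a) *\<^sub>R w a' b)"
  proof -
    have "(\<Sum>b | g b = a. v b) = (\<Sum>b\<in>UNIV. of_bool (g b = a) *\<^sub>R v b)"
      by (rule sum.mono_neutral_cong_left) auto
    then show ?thesis by (simp add: v scaleR_sum_right sum.swap[of _ "UNIV :: 'b set" "UNIV :: 'a set"])
  qed
  ultimately have "u - (\<Sum>b | g b = a. v b) = (\<Sum>a'\<in>UNIV. \<Sum>b\<in>UNIV. (of_bool (a' = a) - of_bool (g b = a)) *\<^sub>R w a' b)"
    by (simp add: scaleR_diff_left sum_subtractf)
  also have "norm \<dots> \<le> (\<Sum>a'\<in>UNIV. \<Sum>b\<in>UNIV. norm ((of_bool (a' = a) - of_bool (g b = a) :: real) *\<^sub>R w a' b))"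
    by (rule order_trans[OF norm_sum]) (intro sum_mono norm_sum)
  also have "\<dots> \<le> (\<Sum>a'\<in>UNIV. \<Sum>b\<in>UNIV. if a' = g b then 0 else norm (w a' b))"
    by (intro sum_mono) (auto simp: of_bool_def)
  finally show ?thesis .
qed

lemma infinite_free_cstar:
  "infinite (UNIV :: ('x, 'a::finite) free_cstar set)"
  "infinite (UNIV :: ('x, 'a::finite) free_cstar opposite set)"
proof -
  have inj: "inj (\<lambda>r :: real. r *\<^sub>R (1 :: ('x, 'a) free_cstar))"
    by (rule injI) (simp add: scaleR_cancel_right)
  show *: "infinite (UNIV :: ('x, 'a) free_cstar set)"
    using finite_imageD[OF finite_subset[OF subset_UNIV] inj] infinite_UNIV_char_0 by blast
  have "inj (opp :: ('x, 'a) free_cstar \<Rightarrow> _)" by (rule injI) (metis unop_opp)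
  then show "infinite (UNIV :: ('x, 'a) free_cstar opposite set)"
    using finite_imageD[OF finite_subset[OF subset_UNIV], of "opp :: ('x, 'a) free_cstar \<Rightarrow> _"] * by blast
qed

text \<open>A vector state on \<open>\<A>(X, A) \<otimes> \<A>(X, A)\<^sup>o\<^sup>p\<close> that reproduces \<open>q\<close> and does not distinguish the left and the right
  action of the generators, up to errors that vanish if the answers at the inputs \<open>(x, s x)\<close> are always on the graph
  of \<open>g x\<close> and those at \<open>(t y, y)\<close> on the graph of \<open>h y\<close>.\<close>

definition vector_state_model where
  "vector_state_model g h s t q \<pi> \<sigma> F \<Omega> \<longleftrightarrow>
    star_representation \<pi> \<and> star_representation \<sigma> \<and> tensor_representation \<pi> \<sigma> F \<and> norm \<Omega> = 1 \<and>
    (\<forall>x a. norm (F (free_gen x a \<otimes>\<^sub>T opp 1) \<Omega> - F (1 \<otimes>\<^sub>T opp (free_gen x a)) \<Omega>)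
      \<le> (\<Sum>a\<in>UNIV. \<Sum>b\<in>UNIV. if a = g x b then 0 else sqrt (q x (s x) a b))) \<and>
    (\<forall>x y a b. cmod (cinner \<Omega> (F ((free_gen x a * (\<Sum>a' | h y a' = b. free_gen (t y) a')) \<otimes>\<^sub>T opp 1) \<Omega>) - complex_of_real (q x y a b))
      \<le> (\<Sum>b\<in>UNIV. \<Sum>a\<in>UNIV. if b = h y a then 0 else sqrt (q (t y) y a b)))"

text \<open>The first party of a finite model represents \<open>\<A>(X, A)\<close>. The opposite algebra is represented by the
  coarse-grained measurements of the second party: the transposed measurements define a representation of
  \<open>\<A>(X, A)\<close>, and transposing it turns it into one of the opposite algebra that sends the generators to the
  original coarse-grained measurements. The two families act on different tensor factors, so that the vectors
  \<open>w x y a b\<close> of norm \<open>q(a, b|x, y)\<^sup>1\<^sup>/\<^sup>2\<close> decompose both marginals.\<close>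

lemma C_q_tensor_representation:
  fixes q :: "('x::finite, 'y::finite, 'a::finite, 'b::finite) correlation"
    and g :: "'x \<Rightarrow> 'b \<Rightarrow> 'a" and h :: "'y \<Rightarrow> 'a \<Rightarrow> 'b" and s :: "'x \<Rightarrow> 'y" and t :: "'y \<Rightarrow> 'x"
  assumes q: "q \<in> C_q"
  shows "\<exists>(\<pi> :: ('x, 'a) free_cstar \<Rightarrow> ('x, 'a) free_cstar ell2 \<Rightarrow> ('x, 'a) free_cstar ell2)
      (\<sigma> :: ('x, 'a) free_cstar opposite \<Rightarrow> ('x, 'a) free_cstar opposite ell2 \<Rightarrow> ('x, 'a) free_cstar opposite ell2) F \<Omega>.
    vector_state_model g h s t q \<pi> \<sigma> F \<Omega>"
proof -
  obtain I :: "('x, 'a) free_cstar set" and J :: "('x, 'a) free_cstar opposite set" and P Q z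
    where m: "fin_model I J P Q z q"
    using C_q_fin_model_infinite[OF q infinite_free_cstar] by blast
  then have I: "finite I" and J: "finite J" and P: "\<And>x. pvm I (P x)" and Q: "\<And>y. pvm J (Q y)"
    and z: "(\<Sum>i\<in>I. \<Sum>j\<in>J. (cmod (z i j))\<^sup>2) = 1"
    and qc: "\<And>x y a b. complex_of_real (q x y a b) = fin_corr I J (P x a) (Q y b) z"
    by (auto simp: fin_model_def)
  define Q' where "Q' x a i j = (\<Sum>b | g x b = a. Q (s x) b i j)" for x a i j
  have Q': "pvm J (Q' x)" for x
    unfolding Q'_def by (rule pvm_coarse[OF J Q])
  obtain M where M: "mat_hom I M" and Mg: "\<And>x a i j. i \<in> I \<Longrightarrow> j \<in> I \<Longrightarrow> M (free_gen x a) i j = P x a i j"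
    by (rule free_cstar_mat_hom[where P = P, OF I P]) blast
  obtain N0 :: "('x, 'a) free_cstar \<Rightarrow> _" where N0: "mat_hom J N0"
    and N0g: "\<And>x a i j. i \<in> J \<Longrightarrow> j \<in> J \<Longrightarrow> N0 (free_gen x a) i j = Q' x a j i"
    by (rule free_cstar_mat_hom[where P = "\<lambda>x a i j. Q' x a j i", OF J pvm_transpose[OF Q']]) blast
  define N where "N w i j = N0 (unop w) j i" for w i j
  have N: "mat_hom J N" unfolding N_def by (rule mat_hom_opposite[OF N0])
  define F where "F t = mat_op (I \<times> J) (tensor_mat M N t)" for t
  define \<pi> where "\<pi> a = mat_op I (M a)" for a
  define \<sigma> where "\<sigma> b = mat_op J (N b)" for b
  have rep: "star_representation \<pi>" "star_representation \<sigma>" "tensor_representation \<pi> \<sigma> F"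
    unfolding \<pi>_def \<sigma>_def F_def
    by (rule mat_hom_star_representation[OF M] mat_hom_star_representation[OF N] mat_hom_tensor_representation[OF M N])+
  define K where "K = I \<times> J"
  have K: "finite K" using I J by (simp add: K_def)
  define T where "T E G = mat_op K (kron E G)" for E G
  define \<Omega> where "\<Omega> = fin_vec K (\<lambda>(i, j). z i j)"
  have c\<Omega>: "coord \<Omega> u = (if u \<in> K then z (fst u) (snd u) else 0)" for u
    by (simp add: \<Omega>_def coord_fin_vec[OF K] case_prod_unfold)
  let ?d = "\<lambda>i j. of_bool (i = j) :: complex"
  have T_cong: "T E G = T E' G'" if "\<And>i j. i \<in> I \<Longrightarrow> j \<in> I \<Longrightarrow> E i j = E' i j" "\<And>i j. i \<in> J \<Longrightarrow> j \<in> J \<Longrightarrow> G i j = G' i j"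
    for E G E' G'
    unfolding T_def by (rule mat_op_cong) (auto simp: K_def kron_def that)
  have TT: "T E G (T E' G' v) = T (\<lambda>i j. \<Sum>k\<in>I. E i k * E' k j) (\<lambda>i j. \<Sum>k\<in>J. G i k * G' k j) v" for E G E' G' v
  proof -
    have "(\<Sum>r\<in>K. kron E G u r * kron E' G' r u') = kron (\<lambda>i j. \<Sum>k\<in>I. E i k * E' k j) (\<lambda>i j. \<Sum>k\<in>J. G i k * G' k j) u u'" for u u'
    proof -
      have "(\<Sum>r\<in>K. kron E G u r * kron E' G' r u') =
          (\<Sum>k\<in>I. \<Sum>l\<in>J. (E (fst u) k * E' k (fst u')) * (G (snd u) l * G' l (snd u')))"
        by (simp add: K_def kron_def sum.cartesian_product case_prod_unfold mult_ac)
      then show ?thesis by (simp add: kron_def sum_product)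
    qed
    then show ?thesis unfolding T_def mat_op_compose[OF K] by simp
  qed
  have T_adj: "cinner (T E G u) v = cinner u (T E G v)"
    if "\<And>i j. i \<in> I \<Longrightarrow> j \<in> I \<Longrightarrow> E j i = cnj (E i j)" "\<And>i j. i \<in> J \<Longrightarrow> j \<in> J \<Longrightarrow> G j i = cnj (G i j)" for E G u v
    unfolding T_def
  proof (rule mat_op_adjoint[OF K])
    fix u v assume "u \<in> K" "v \<in> K"
    then have "E (fst u) (fst v) = cnj (E (fst v) (fst u))" "G (snd u) (snd v) = cnj (G (snd v) (snd u))"
      by (auto simp: K_def intro!: that)
    then show "kron E G u v = cnj (kron E G v u)"
      unfolding kron_def complex_cnj_mult by (rule arg_cong2)
  qed
  have T_sum_left: "T (\<lambda>i j. \<Sum>k\<in>S. E k i j) G v = (\<Sum>k\<in>S. T (E k) G v)" for S E G v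
    by (rule ell2_eqI) (simp add: T_def coord_sum coord_mat_op[OF K] kron_def sum_distrib_right sum_distrib_left sum.swap[of _ S K])
  have T_sum_right: "T E (\<lambda>i j. \<Sum>k\<in>S. G k i j) v = (\<Sum>k\<in>S. T E (G k) v)" for S E G v
    by (rule ell2_eqI) (simp add: T_def coord_sum coord_mat_op[OF K] kron_def sum_distrib_right sum_distrib_left sum.swap[of _ S K])
  have corr: "cinner \<Omega> (T E G \<Omega>) = fin_corr I J E G z" for E G
  proof -
    have K_sum: "(\<Sum>u\<in>K. f u) = (\<Sum>i\<in>I. \<Sum>j\<in>J. f (i, j))" for f :: "_ \<Rightarrow> complex"
      by (simp add: K_def sum.cartesian_product)
    show ?thesis
      unfolding T_def cinner_mat_op[OF K] fin_corr_def K_sum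
      by (intro sum.cong refl) (simp add: c\<Omega> K_def kron_def mult_ac)
  qed
  have F_T: "F (a \<otimes>\<^sub>T b) = T (M a) (N b)" for a b
    by (simp add: F_def T_def K_def tensor_mat_elementary[OF mat_homD(2)[OF M] mat_homD(2)[OF N]])
  have N1: "N (opp 1) i j = ?d i j" if "i \<in> J" "j \<in> J" for i j
    using mat_homD(5)[OF N that] by (simp add: opp_one)
  have Fe: "F (free_gen x a \<otimes>\<^sub>T opp 1) = T (P x a) ?d" for x a
    unfolding F_T by (rule T_cong) (auto simp: Mg N1)
  have Fe': "F (1 \<otimes>\<^sub>T opp (free_gen x a)) v = (\<Sum>b | g x b = a. T ?d (Q (s x) b) v)" for x a v
    unfolding F_T T_sum_right[symmetric]
    by (rule fun_cong[OF T_cong]) (auto simp: mat_homD(5)[OF M] N_def N0g Q'_def)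
  define w where "w x y a b = T (P x a) (Q y b) \<Omega>" for x y a b
  have marg_A: "T (P x a) ?d \<Omega> = (\<Sum>b\<in>UNIV. w x y a b)" for x y a
    unfolding w_def T_sum_right[symmetric] by (rule fun_cong[OF T_cong]) (auto simp: pvm_one[OF Q])
  have marg_B: "T ?d (Q y b) \<Omega> = (\<Sum>a\<in>UNIV. w x y a b)" for x y b
    unfolding w_def T_sum_left[symmetric] by (rule fun_cong[OF T_cong]) (auto simp: pvm_one[OF P])
  have norm_w: "norm (w x y a b) = sqrt (q x y a b)" for x y a b
  proof -
    have "complex_of_real ((norm (w x y a b))\<^sup>2) = cinner \<Omega> (T (P x a) (Q y b) (T (P x a) (Q y b) \<Omega>))"
      unfolding cinner_self[symmetric] w_def
      by (rule T_adj) (auto intro: pvm_herm[OF P] pvm_herm[OF Q])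
    also have "T (P x a) (Q y b) (T (P x a) (Q y b) \<Omega>) = T (P x a) (Q y b) \<Omega>"
      unfolding TT by (rule fun_cong[OF T_cong]) (auto simp: pvm_idem[OF P] pvm_idem[OF Q])
    also have "cinner \<Omega> \<dots> = complex_of_real (q x y a b)" by (simp add: corr qc)
    finally have "(norm (w x y a b))\<^sup>2 = q x y a b" by (simp only: of_real_eq_iff)
    then show ?thesis by (metis norm_ge_zero real_sqrt_unique)
  qed
  have "(norm \<Omega>)\<^sup>2 = (\<Sum>u\<in>K. (cmod (z (fst u) (snd u)))\<^sup>2)"
    unfolding norm_ell2_square by (subst infsum_finite[OF K, symmetric]) (rule infsum_cong_neutral, auto simp: c\<Omega>)
  then have "(norm \<Omega>)\<^sup>2 = 1" using z by (simp add: K_def sum.cartesian_product case_prod_unfold)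
  then have norm\<Omega>: "norm \<Omega> = 1" by (simp add: power2_eq_1_iff) (use norm_ge_zero[of \<Omega>] in linarith)
  have first: "norm (F (free_gen x a \<otimes>\<^sub>T opp 1) \<Omega> - F (1 \<otimes>\<^sub>T opp (free_gen x a)) \<Omega>)
      \<le> (\<Sum>a\<in>UNIV. \<Sum>b\<in>UNIV. if a = g x b then 0 else sqrt (q x (s x) a b))" for x a
    unfolding Fe Fe' norm_w[symmetric]
    by (rule coarse_graining_close[of _ "w x (s x)"]) (rule marg_A, rule marg_B)
  have second: "cmod (cinner \<Omega> (F ((free_gen x a * (\<Sum>a' | h y a' = b. free_gen (t y) a')) \<otimes>\<^sub>T opp 1) \<Omega>) - complex_of_real (q x y a b))
      \<le> (\<Sum>b\<in>UNIV. \<Sum>a\<in>UNIV. if b = h y a then 0 else sqrt (q (t y) y a b))" (is "_ \<le> ?\<delta>") for x y a b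
  proof -
    let ?r = "\<Sum>a' | h y a' = b. T (P (t y) a') ?d \<Omega>"
    have sa: "cinner (T (P x a) ?d u) v = cinner u (T (P x a) ?d v)" for u v
      by (rule T_adj) (auto intro: pvm_herm[OF P])
    have "F ((free_gen x a * (\<Sum>a' | h y a' = b. free_gen (t y) a')) \<otimes>\<^sub>T opp 1) \<Omega>
        = F (free_gen x a \<otimes>\<^sub>T opp 1) (F ((\<Sum>a' | h y a' = b. free_gen (t y) a') \<otimes>\<^sub>T opp 1) \<Omega>)"
      using trep_mult[OF rep, of "free_gen x a" _ "opp 1" "opp 1"] by (simp add: opp_one)
    also have "\<dots> = T (P x a) ?d ?r"
      by (simp add: clinear_sum[OF clinear_tensor_prod_left] clinear_sum[OF trep_linear[OF rep]] Fe)
    finally have 1: "cinner \<Omega> (F ((free_gen x a * (\<Sum>a' | h y a' = b. free_gen (t y) a')) \<otimes>\<^sub>T opp 1) \<Omega>) = cinner (T (P x a) ?d \<Omega>) ?r"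
      by (simp only: sa)
    have "T (P x a) ?d (T ?d (Q y b) \<Omega>) = T (P x a) (Q y b) \<Omega>"
      unfolding TT by (rule fun_cong[OF T_cong])
        (auto simp: I J of_bool_def if_distrib[of "\<lambda>x. _ * x"] if_distrib[of "\<lambda>x. x * _"] cong: if_cong)
    then have 2: "complex_of_real (q x y a b) = cinner (T (P x a) ?d \<Omega>) (T ?d (Q y b) \<Omega>)"
      by (simp add: sa corr qc)
    have "cmod (cinner (T (P x a) ?d \<Omega>) ?r - cinner (T (P x a) ?d \<Omega>) (T ?d (Q y b) \<Omega>))
        \<le> norm (T (P x a) ?d \<Omega>) * norm (?r - T ?d (Q y b) \<Omega>)"
      unfolding cinner_diff_right[symmetric] by (rule cmod_cinner_le)
    also have "\<dots> \<le> 1 * ?\<delta>"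
    proof (rule mult_mono)
      have "norm (F (free_gen x a \<otimes>\<^sub>T opp 1) \<Omega>) \<le> norm (free_gen x a) * norm (opp (1 :: ('x, 'a) free_cstar)) * norm \<Omega>"
        by (rule trep_contractive[OF rep])
      also have "\<dots> \<le> 1"
      proof -
        have "norm (free_gen x a) \<le> 1"
          by (rule norm_alg_pvm_le) (simp add: alg_pvm_def star_free_gen free_gen_mult sum_free_gen)
        then show ?thesis by (simp add: norm_opp norm\<Omega>)
      qed
      finally show "norm (T (P x a) ?d \<Omega>) \<le> 1" by (simp add: Fe)
      show "norm (?r - T ?d (Q y b) \<Omega>) \<le> ?\<delta>"
        unfolding norm_w[symmetric] norm_minus_commute[of ?r]
        by (rule coarse_graining_close[of _ "\<lambda>b a. w (t y) y a b"]) (rule marg_B, rule marg_A)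
    qed auto
    finally show ?thesis by (simp add: 1 2)
  qed
  show ?thesis
    unfolding vector_state_model_def
    using rep norm\<Omega> first second by (intro exI[of _ \<pi>] exI[of _ \<sigma>] exI[of _ F] exI[of _ \<Omega>]) blast
qed

section \<open>Limits of vector states\<close>

text \<open>By Tychonoff's theorem the functions \<open>\<phi> q\<close> lie in a compact product of discs. The filter \<open>G\<close> is a common refinement
  of \<open>\<F>\<close> and of the neighbourhoods of a cluster point, and takes the place of an ultrafilter.\<close>

lemma pointwise_cluster_point:
  fixes \<phi> :: "'q \<Rightarrow> 't \<Rightarrow> complex"
  assumes \<F>: "\<F> \<noteq> bot" and le: "\<And>q t. cmod (\<phi> q t) \<le> K t"
  obtains G \<psi> where "G \<noteq> bot" "G \<le> \<F>" "\<And>t. ((\<lambda>q. \<phi> q t) \<longlongrightarrow> \<psi> t) G"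
proof -
  define X where "X = (\<Pi>\<^sub>E t\<in>UNIV. cball (0 :: complex) (K t))"
  have X: "\<phi> q \<in> X" for q
    unfolding X_def by (intro PiE_I) (use le[of q] in auto)
  have "compact X"
    unfolding X_def compactin_euclidean_iff[symmetric] euclidean_product_topology[symmetric] compactin_PiE by simp
  moreover have "filtermap \<phi> \<F> \<noteq> bot" using \<F> by (simp add: filtermap_bot_iff)
  moreover have "eventually (\<lambda>f. f \<in> X) (filtermap \<phi> \<F>)"
    by (simp add: eventually_filtermap X)
  ultimately obtain \<psi> where \<psi>: "inf (nhds \<psi>) (filtermap \<phi> \<F>) \<noteq> bot"
    unfolding compact_filter by blast
  define G where "G = inf \<F> (filtercomap \<phi> (nhds \<psi>))"
  have "G \<noteq> bot"
  proof
    assume "G = bot"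
    then have "eventually (\<lambda>_. False) G" by simp
    then obtain P Q where P: "eventually P \<F>" and Q: "eventually Q (filtercomap \<phi> (nhds \<psi>))"
      and PQ: "\<And>q. P q \<Longrightarrow> Q q \<Longrightarrow> False"
      unfolding G_def eventually_inf by blast
    obtain R where R: "eventually R (nhds \<psi>)" "\<And>q. R (\<phi> q) \<Longrightarrow> Q q"
      using Q unfolding eventually_filtercomap by blast
    have "eventually (\<lambda>q. \<not> R (\<phi> q)) \<F>"
      using P by (rule eventually_mono) (use PQ R(2) in blast)
    then have "eventually (\<lambda>f. \<not> R f) (filtermap \<phi> \<F>)" by (simp add: eventually_filtermap)
    then have "eventually (\<lambda>_. False) (inf (nhds \<psi>) (filtermap \<phi> \<F>))"
      using R(1) unfolding eventually_inf by blast
    then show False using \<psi> by (simp add: trivial_limit_def)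
  qed
  moreover have "G \<le> \<F>" by (simp add: G_def)
  moreover have "((\<lambda>q. \<phi> q t) \<longlongrightarrow> \<psi> t) G" for t
  proof -
    have lim: "filterlim \<phi> (nhds \<psi>) G"
      unfolding G_def by (rule filterlim_mono[OF filterlim_filtercomap order_refl]) simp
    show ?thesis
    proof (rule topological_tendstoI)
      fix U :: "complex set" assume U: "open U" "\<psi> t \<in> U"
      have "open ((\<lambda>f :: 't \<Rightarrow> complex. f t) -` U)"
        by (rule open_vimage[OF U(1) continuous_on_product_coordinates])
      from topological_tendstoD[OF lim this] show "\<forall>\<^sub>F q in G. \<phi> q t \<in> U" using U(2) by simp
    qed
  qed
  ultimately show ?thesis by (rule that)
qed

lemma clinear_limit:
  assumes G: "G \<noteq> bot" and lim: "\<And>t. ((\<lambda>q. \<phi> q t) \<longlongrightarrow> \<psi> t) G" and lin: "\<And>q. clinear (\<phi> q)"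
  shows "clinear (\<psi> :: 't::complex_vector \<Rightarrow> complex)"
  unfolding clinear_def
proof (intro conjI allI)
  fix x y c
  have "((\<lambda>q. \<phi> q (x + y)) \<longlongrightarrow> \<psi> x + \<psi> y) G"
    unfolding clinear_add[OF lin] by (intro tendsto_add lim)
  then show "\<psi> (x + y) = \<psi> x + \<psi> y" using tendsto_unique[OF G lim] by blast
  have "((\<lambda>q. \<phi> q (c *\<^sub>C x)) \<longlongrightarrow> c * \<psi> x) G"
    unfolding clinear_scaleC[OF lin] scaleC_complex_def by (intro tendsto_mult_left lim)
  then show "\<psi> (c *\<^sub>C x) = c *\<^sub>C \<psi> x" using tendsto_unique[OF G lim] by (simp add: scaleC_complex_def)
qed

text \<open>How far a vector is from making the left and the right action agree on \<open>w\<close>.\<close>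

definition defect :: "(('c, 'c opposite) tensor \<Rightarrow> 'k ell2 \<Rightarrow> 'k ell2) \<Rightarrow> 'k ell2 \<Rightarrow> 'c::cstar_algebra \<Rightarrow> real" where
  "defect F \<Omega> w = norm (F (w \<otimes>\<^sub>T opp 1) \<Omega> - F (1 \<otimes>\<^sub>T opp w) \<Omega>)"

context
  fixes \<pi> :: "'c::cstar_algebra \<Rightarrow> 'i ell2 \<Rightarrow> 'i ell2" and \<sigma> :: "'c opposite \<Rightarrow> 'j ell2 \<Rightarrow> 'j ell2"
    and F :: "('c, 'c opposite) tensor \<Rightarrow> ('i \<times> 'j) ell2 \<Rightarrow> ('i \<times> 'j) ell2" and \<Omega> :: "('i \<times> 'j) ell2"
  assumes rep: "star_representation \<pi>" "star_representation \<sigma>" "tensor_representation \<pi> \<sigma> F" and \<Omega>: "norm \<Omega> = 1"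
begin

lemma trep_left_norm: "norm (F (a \<otimes>\<^sub>T opp 1) v) \<le> norm a * norm v"
  and trep_right_norm: "norm (F (1 \<otimes>\<^sub>T opp a) v) \<le> norm a * norm v"
  using trep_contractive[OF rep, of a "opp 1" v] trep_contractive[OF rep, of 1 "opp a" v] by (simp_all add: norm_opp)

lemma trep_split: "F (a \<otimes>\<^sub>T opp b) v = F (a \<otimes>\<^sub>T opp 1) (F (1 \<otimes>\<^sub>T opp b) v)"
  and trep_split': "F (a \<otimes>\<^sub>T opp b) v = F (1 \<otimes>\<^sub>T opp b) (F (a \<otimes>\<^sub>T opp 1) v)"
  using trep_mult[OF rep, of a 1 "opp 1" "opp b" v] trep_mult[OF rep, of 1 a "opp b" "opp 1" v] by (simp_all add: opp_one)

lemma trep_left_mult: "F ((a * b) \<otimes>\<^sub>T opp 1) v = F (a \<otimes>\<^sub>T opp 1) (F (b \<otimes>\<^sub>T opp 1) v)"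
  and trep_right_mult: "F (1 \<otimes>\<^sub>T opp (a * b)) v = F (1 \<otimes>\<^sub>T opp b) (F (1 \<otimes>\<^sub>T opp a) v)"
  using trep_mult[OF rep, of a b "opp 1" "opp 1" v] trep_mult[OF rep, of 1 1 "opp b" "opp a" v]
  by (simp_all add: opp_one opp_mult)

lemma trep_left_clinear: "clinear (\<lambda>a. F (a \<otimes>\<^sub>T opp 1) v)"
  and trep_right_clinear: "clinear (\<lambda>a. F (1 \<otimes>\<^sub>T opp a) v)"
  by (simp_all add: clinear_def clinear_add[OF clinear_tensor_prod_left] clinear_scaleC[OF clinear_tensor_prod_left]
      clinear_add[OF clinear_opp] clinear_scaleC[OF clinear_opp]
      clinear_add[OF clinear_tensor_prod_right] clinear_scaleC[OF clinear_tensor_prod_right]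
      clinear_add[OF trep_linear[OF rep]] clinear_scaleC[OF trep_linear[OF rep]])

lemma defect_nonneg: "0 \<le> defect F \<Omega> w"
  by (simp add: defect_def)

lemma defect_one: "defect F \<Omega> 1 = 0"
  by (simp add: defect_def)

lemma defect_add: "defect F \<Omega> (v + w) \<le> defect F \<Omega> v + defect F \<Omega> w"
  unfolding defect_def clinear_add[OF trep_left_clinear] clinear_add[OF trep_right_clinear] add_diff_add
  by (rule norm_triangle_ineq)

lemma defect_scaleC: "defect F \<Omega> (c *\<^sub>C w) = cmod c * defect F \<Omega> w"
  unfolding defect_def clinear_scaleC[OF trep_left_clinear] clinear_scaleC[OF trep_right_clinear]
  by (simp add: norm_scaleC flip: complex_vector.scale_right_diff_distrib)

lemma defect_mult: "defect F \<Omega> (v * w) \<le> norm v * defect F \<Omega> w + norm w * defect F \<Omega> v"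
proof -
  note diff = clinear_diff[OF bounded_clinear_clinear[OF trep_bounded[OF rep]]]
  let ?l = "\<lambda>a. F (a \<otimes>\<^sub>T opp 1)" and ?r = "\<lambda>a. F (1 \<otimes>\<^sub>T opp a)"
  have "?l (v * w) \<Omega> - ?r (v * w) \<Omega> = ?l v (?l w \<Omega> - ?r w \<Omega>) + ?r w (?l v \<Omega> - ?r v \<Omega>)"
    unfolding diff trep_left_mult trep_right_mult trep_split[symmetric] trep_split'[symmetric] by simp
  then have "defect F \<Omega> (v * w) \<le> norm (?l v (?l w \<Omega> - ?r w \<Omega>)) + norm (?r w (?l v \<Omega> - ?r v \<Omega>))"
    unfolding defect_def by (simp add: norm_triangle_ineq)
  also have "\<dots> \<le> norm v * defect F \<Omega> w + norm w * defect F \<Omega> v"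
    unfolding defect_def by (intro add_mono trep_left_norm trep_right_norm)
  finally show ?thesis .
qed

lemma defect_le_norm: "defect F \<Omega> w \<le> 2 * norm w"
proof -
  have "defect F \<Omega> w \<le> norm (F (w \<otimes>\<^sub>T opp 1) \<Omega>) + norm (F (1 \<otimes>\<^sub>T opp w) \<Omega>)"
    unfolding defect_def by (rule norm_triangle_ineq4)
  also have "\<dots> \<le> norm w * norm \<Omega> + norm w * norm \<Omega>"
    by (intro add_mono trep_left_norm trep_right_norm)
  finally show ?thesis by (simp add: \<Omega>)
qed

text \<open>In the state of a vector without defect, the right action can be replaced by the left action, and elements
  can be moved cyclically.\<close>

lemma form_right_to_left:
  "cmod (cinner \<Omega> (F (z \<otimes>\<^sub>T opp w) \<Omega>) - cinner \<Omega> (F ((z * w) \<otimes>\<^sub>T opp 1) \<Omega>)) \<le> norm z * defect F \<Omega> w"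
proof -
  note diff = clinear_diff[OF bounded_clinear_clinear[OF trep_bounded[OF rep]]]
  have "cinner \<Omega> (F (z \<otimes>\<^sub>T opp w) \<Omega>) - cinner \<Omega> (F ((z * w) \<otimes>\<^sub>T opp 1) \<Omega>) =
      cinner \<Omega> (F (z \<otimes>\<^sub>T opp 1) (F (1 \<otimes>\<^sub>T opp w) \<Omega> - F (w \<otimes>\<^sub>T opp 1) \<Omega>))"
    unfolding diff cinner_diff_right trep_left_mult trep_split[symmetric] ..
  also have "cmod \<dots> \<le> norm \<Omega> * norm (F (z \<otimes>\<^sub>T opp 1) (F (1 \<otimes>\<^sub>T opp w) \<Omega> - F (w \<otimes>\<^sub>T opp 1) \<Omega>))"
    by (rule cmod_cinner_le)
  also have "\<dots> \<le> 1 * (norm z * norm (F (1 \<otimes>\<^sub>T opp w) \<Omega> - F (w \<otimes>\<^sub>T opp 1) \<Omega>))"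
    unfolding \<Omega> by (intro mult_left_mono trep_left_norm) simp
  finally show ?thesis by (simp add: defect_def norm_minus_commute)
qed

lemma form_commute:
  "cmod (cinner \<Omega> (F ((w * z) \<otimes>\<^sub>T opp 1) \<Omega>) - cinner \<Omega> (F (z \<otimes>\<^sub>T opp w) \<Omega>)) \<le> norm z * defect F \<Omega> (star w)"
proof -
  have l: "cinner (F (star w \<otimes>\<^sub>T opp 1) \<Omega>) v = cinner \<Omega> (F (w \<otimes>\<^sub>T opp 1) v)"
    and r: "cinner (F (1 \<otimes>\<^sub>T opp (star w)) \<Omega>) v = cinner \<Omega> (F (1 \<otimes>\<^sub>T opp w) v)" for v
    using trep_star[OF rep, of w "opp 1" \<Omega> v] trep_star[OF rep, of 1 "opp w" \<Omega> v] by (simp_all add: star_opp star_one)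
  have "cinner \<Omega> (F ((w * z) \<otimes>\<^sub>T opp 1) \<Omega>) - cinner \<Omega> (F (z \<otimes>\<^sub>T opp w) \<Omega>) =
      cinner (F (star w \<otimes>\<^sub>T opp 1) \<Omega> - F (1 \<otimes>\<^sub>T opp (star w)) \<Omega>) (F (z \<otimes>\<^sub>T opp 1) \<Omega>)"
    unfolding cinner_diff_left l r trep_left_mult trep_split'[of z w] ..
  also have "cmod \<dots> \<le> defect F \<Omega> (star w) * norm (F (z \<otimes>\<^sub>T opp 1) \<Omega>)"
    unfolding defect_def by (rule cmod_cinner_le)
  also have "\<dots> \<le> defect F \<Omega> (star w) * (norm z * norm \<Omega>)"
    by (intro mult_left_mono trep_left_norm defect_nonneg)
  finally show ?thesis by (simp add: \<Omega> mult.commute)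
qed

lemma form_positive: "cinner \<Omega> (F ((star z * z) \<otimes>\<^sub>T opp 1) \<Omega>) \<in> \<real>\<^sub>\<ge>\<^sub>0"
  using trep_norm_square[OF rep, of z "opp 1" \<Omega>]
  by (simp add: star_opp star_one flip: opp_mult) (metis nonneg_Reals_of_real_iff of_real_power zero_le_power2 norm_ge_zero)

lemma form_bounded: "cmod (cinner \<Omega> (F t \<Omega>)) \<le> onorm (F t)"
proof -
  have "cmod (cinner \<Omega> (F t \<Omega>)) \<le> norm \<Omega> * norm (F t \<Omega>)" by (rule cmod_cinner_le)
  also have "norm (F t \<Omega>) \<le> onorm (F t) * norm \<Omega>"
    by (rule onorm[OF bounded_clinear_bounded_linear[OF trep_bounded[OF rep]]])
  finally show ?thesis by (simp add: \<Omega>)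
qed

end

text \<open>The elements on which the defect tends to zero form a closed unital subalgebra, so it is enough that it contains
  the generators.\<close>

lemma defect_tendsto_zero:
  fixes F :: "'q \<Rightarrow> (('x, 'a::finite) free_cstar, ('x, 'a) free_cstar opposite) tensor \<Rightarrow> ('i \<times> 'j) ell2 \<Rightarrow> ('i \<times> 'j) ell2"
    and \<pi> :: "'q \<Rightarrow> ('x, 'a) free_cstar \<Rightarrow> 'i ell2 \<Rightarrow> 'i ell2" and \<sigma> :: "'q \<Rightarrow> ('x, 'a) free_cstar opposite \<Rightarrow> 'j ell2 \<Rightarrow> 'j ell2"
  assumes rep: "\<And>q. star_representation (\<pi> q)" "\<And>q. star_representation (\<sigma> q)" "\<And>q. tensor_representation (\<pi> q) (\<sigma> q) (F q)"
    and \<Omega>: "\<And>q. norm (\<Omega> q) = 1"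
    and gen: "\<And>x a. ((\<lambda>q. defect (F q) (\<Omega> q) (free_gen x a)) \<longlongrightarrow> 0) G"
  shows "((\<lambda>q. defect (F q) (\<Omega> q) w) \<longlongrightarrow> 0) G"
proof -
  let ?d = "\<lambda>q. defect (F q) (\<Omega> q)"
  note d_add = defect_add[OF rep \<Omega>] and d_scaleC = defect_scaleC[OF rep \<Omega>] and d_mult = defect_mult[OF rep \<Omega>]
    and d_le = defect_le_norm[OF rep \<Omega>]
  have squeeze: "((\<lambda>q. ?d q w) \<longlongrightarrow> 0) G" if "\<And>q. ?d q w \<le> f q" "(f \<longlongrightarrow> 0) G" for f w
  proof (rule tendsto_sandwich[OF _ _ tendsto_const that(2)])
    show "\<forall>\<^sub>F q in G. 0 \<le> ?d q w" by (simp add: defect_def)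
    show "\<forall>\<^sub>F q in G. ?d q w \<le> f q" by (simp add: that(1))
  qed
  have word: "((\<lambda>q. ?d q (of_poly (Poly_Mapping.single (Word gs) 1))) \<longlongrightarrow> 0) G" for gs
  proof (induction gs)
    case Nil
    show ?case by (simp add: of_poly_one defect_one[OF rep \<Omega>] flip: zero_free_word_def)
  next
    case (Cons g gs)
    obtain x a where g: "g = (x, a)" by (cases g)
    let ?w = "of_poly (Poly_Mapping.single (Word gs) 1) :: ('x, 'a) free_cstar"
    have "Poly_Mapping.single (Word (g # gs)) (1 :: complex) = poly_gen (x, a) * Poly_Mapping.single (Word gs) 1"
      by (simp add: poly_gen_def mult_single plus_free_word_def g)
    then have eq: "of_poly (Poly_Mapping.single (Word (g # gs)) 1) = free_gen x a * ?w"
      by (simp add: of_poly_mult free_gen_def)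
    show ?case
      unfolding eq
    proof (rule squeeze[OF d_mult])
      show "((\<lambda>q. norm (free_gen x a) * ?d q ?w + norm ?w * ?d q (free_gen x a)) \<longlongrightarrow> 0) G"
        by (rule tendsto_eq_intros Cons.IH gen refl | simp)+
    qed
  qed
  have poly: "((\<lambda>q. ?d q (of_poly p)) \<longlongrightarrow> 0) G" for p
  proof (induction p rule: poly_induct)
    case (single v c)
    have "Poly_Mapping.single v c = poly_const c * Poly_Mapping.single (Word (letters v)) 1"
      by (simp add: poly_const_def mult_single)
    then have "?d q (of_poly (Poly_Mapping.single v c)) = cmod c * ?d q (of_poly (Poly_Mapping.single (Word (letters v)) 1))" for q
      by (simp only: of_poly_scale d_scaleC)
    then show ?case using tendsto_mult_right_zero[OF word[of "letters v"], of "cmod c"] by simp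
  next
    case (add p p')
    show ?case
      unfolding of_poly_add
      by (rule squeeze[OF d_add]) (rule tendsto_add_zero[OF add])
  qed
  show ?thesis
  proof (rule tendstoI)
    fix r :: real assume r: "r > 0"
    then have "\<exists>p. dist (of_poly p) w < r / 4"
      using closure_range_of_poly[of w] unfolding closure_approachable by (metis rangeE zero_less_divide_iff zero_less_numeral)
    then obtain p where p: "norm (w - of_poly p) < r / 4" by (auto simp: dist_norm norm_minus_commute)
    have "\<forall>\<^sub>F q in G. dist (?d q (of_poly p)) 0 < r / 2"
      using poly[of p] r by (intro tendstoD) simp_all
    then show "\<forall>\<^sub>F q in G. dist (?d q w) 0 < r"
    proof (rule eventually_mono)
      fix q assume q: "dist (?d q (of_poly p)) 0 < r / 2"
      have "?d q ((w - of_poly p) + of_poly p) \<le> ?d q (w - of_poly p) + ?d q (of_poly p)"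
        by (rule d_add)
      then have "?d q w \<le> ?d q (w - of_poly p) + ?d q (of_poly p)" by simp
      also have "\<dots> \<le> 2 * norm (w - of_poly p) + ?d q (of_poly p)"
        using d_le by simp
      also have "\<dots> < r" using p q by simp
      finally show "dist (?d q w) 0 < r" by (simp add: defect_def)
    qed
  qed
qed

section \<open>Approximately finite-dimensional correlations yield amenable traces\<close>

text \<open>The support conditions make the errors in \<open>vector_state_model\<close> tend to zero as quantum correlations approach \<open>p\<close>.
  Any cluster point \<open>\<psi>\<close> of the vector states then satisfies \<open>\<psi>(z \<otimes> w\<^sup>o\<^sup>p) = \<psi>(zw \<otimes> 1) = \<psi>(wz \<otimes> 1)\<close>.\<close>

lemma C_qa_imp_amenable_trace:
  fixes p :: "('x::finite, 'y::finite, 'a::finite, 'b::finite) correlation"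
    and g :: "'x \<Rightarrow> 'b \<Rightarrow> 'a" and h :: "'y \<Rightarrow> 'a \<Rightarrow> 'b" and s :: "'x \<Rightarrow> 'y" and t :: "'y \<Rightarrow> 'x"
  assumes p: "p \<in> C_qa"
    and g: "\<And>x a b. a \<noteq> g x b \<Longrightarrow> p x (s x) a b = 0" and h: "\<And>y a b. b \<noteq> h y a \<Longrightarrow> p (t y) y a b = 0"
  obtains \<tau> :: "('x, 'a) free_cstar \<Rightarrow> complex" where "amenable_trace \<tau>"
    "\<And>x y a b. complex_of_real (p x y a b) = \<tau> (free_gen x a * (\<Sum>a' | h y a' = b. free_gen (t y) a'))"
proof -
  have nonempty: "(C_q :: ('x, 'y, 'a, 'b) correlation set) \<noteq> {}"
    using p by (auto simp: C_qa_def)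
  \<comment> \<open>A correlation outside of \<open>C_q\<close> is never met by the filter; it gets the data of a fixed element of \<open>C_q\<close>.\<close>
  then obtain q0 :: "('x, 'y, 'a, 'b) correlation" where q0: "q0 \<in> C_q" by blast
  define c where "c q = (if q \<in> C_q then q else q0)" for q
  let ?model = "\<lambda>q (d :: (('x, 'a) free_cstar \<Rightarrow> ('x, 'a) free_cstar ell2 \<Rightarrow> ('x, 'a) free_cstar ell2)
      \<times> (('x, 'a) free_cstar opposite \<Rightarrow> ('x, 'a) free_cstar opposite ell2 \<Rightarrow> ('x, 'a) free_cstar opposite ell2) \<times> _ \<times> _).
    vector_state_model g h s t (c q) (fst d) (fst (snd d)) (fst (snd (snd d))) (snd (snd (snd d)))"
  have "\<exists>d. ?model q d" for q
    using C_q_tensor_representation[where q = "c q" and g = g and s = s and h = h and t = t] q0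
    by (simp add: c_def split_paired_Ex)
  then have "\<exists>D. \<forall>q. ?model q (D q)" by (intro choice allI)
  then obtain D where D: "\<And>q. ?model q (D q)" by blast
  define \<pi> \<sigma> F \<Omega> where "\<pi> q = fst (D q)" and "\<sigma> q = fst (snd (D q))" and "F q = fst (snd (snd (D q)))"
    and "\<Omega> q = snd (snd (snd (D q)))" for q
  have all: "vector_state_model g h s t (c q) (\<pi> q) (\<sigma> q) (F q) (\<Omega> q)" for q
    using D[of q] unfolding \<pi>_def \<sigma>_def F_def \<Omega>_def .
  then have rep: "\<And>q. star_representation (\<pi> q)" "\<And>q. star_representation (\<sigma> q)" "\<And>q. tensor_representation (\<pi> q) (\<sigma> q) (F q)"
    and \<Omega>: "\<And>q. norm (\<Omega> q) = 1"
    and first: "\<And>q x a. defect (F q) (\<Omega> q) (free_gen x a)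
      \<le> (\<Sum>a\<in>UNIV. \<Sum>b\<in>UNIV. if a = g x b then 0 else sqrt (c q x (s x) a b))"
    and second: "\<And>q x y a b. cmod (cinner (\<Omega> q) (F q ((free_gen x a * (\<Sum>a' | h y a' = b. free_gen (t y) a')) \<otimes>\<^sub>T opp 1) (\<Omega> q))
        - complex_of_real (c q x y a b)) \<le> (\<Sum>b\<in>UNIV. \<Sum>a\<in>UNIV. if b = h y a then 0 else sqrt (c q (t y) y a b))"
    unfolding defect_def vector_state_model_def by blast+
  define \<phi> where "\<phi> q u = cinner (\<Omega> q) (F q u (\<Omega> q))" for q u
  have \<phi>_lin: "clinear (\<phi> q)" for q
    using trep_linear[OF rep] by (simp add: \<phi>_def clinear_def cinner_add_right cinner_scaleC_right scaleC_complex_def)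
  have \<phi>_le: "cmod (\<phi> q u) \<le> min_tensor_norm u" for q u
    unfolding \<phi>_def by (rule order_trans[OF form_bounded[OF rep \<Omega>] min_tensor_norm_upper[OF rep]])
  have "inf (nhds p) (principal C_q) \<noteq> bot"
  proof
    assume "inf (nhds p) (principal C_q) = bot"
    then have "eventually (\<lambda>q. q \<notin> C_q) (nhds p)"
      using eventually_inf_principal[of "\<lambda>_. False" "nhds p" C_q] by simp
    then obtain U where "open U" "p \<in> U" "U \<inter> C_q = {}"
      unfolding eventually_nhds by blast
    then show False
      using p open_Int_closure_eq_empty[of U C_q] unfolding C_qa_def by blast
  qed
  then obtain G \<psi> where G: "G \<noteq> bot" "G \<le> inf (nhds p) (principal C_q)"
    and \<psi>: "\<And>u. ((\<lambda>q. \<phi> q u) \<longlongrightarrow> \<psi> u) G"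
    by (rule pointwise_cluster_point[where \<phi> = \<phi> and K = min_tensor_norm]) (use \<phi>_le in blast)+
  have Gc: "((\<lambda>q. c q x y a b) \<longlongrightarrow> p x y a b) G" for x y a b
  proof -
    have "eventually (\<lambda>q. q \<in> C_q) G"
      using filter_leD[OF G(2), of "\<lambda>q. q \<in> C_q"] by (auto simp: eventually_inf_principal intro: always_eventually)
    then have ev: "eventually (\<lambda>q. q x y a b = c q x y a b) G"
      by (rule eventually_mono) (simp add: c_def)
    have "continuous_on UNIV (\<lambda>q :: ('x, 'y, 'a, 'b) correlation. q x y a b)"
      using continuous_on_product_then_coordinatewise[OF continuous_on_product_then_coordinatewise[OF
        continuous_on_product_then_coordinatewise[OF continuous_on_product_then_coordinatewise[OF continuous_on_id]]]] .
    then have "isCont (\<lambda>q :: ('x, 'y, 'a, 'b) correlation. q x y a b) p"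
      by (simp add: continuous_on_eq_continuous_at)
    moreover have "((\<lambda>q. q) \<longlongrightarrow> p) G"
      unfolding filterlim_def filtermap_ident using G(2) by simp
    ultimately have "((\<lambda>q. q x y a b) \<longlongrightarrow> p x y a b) G"
      using isCont_tendsto_compose[of p "\<lambda>q. q x y a b" "\<lambda>q. q" G] by blast
    then show ?thesis using tendsto_cong[OF ev] by blast
  qed
  have lim1: "((\<lambda>q. \<Sum>a\<in>UNIV. \<Sum>b\<in>UNIV. if a = g x b then 0 else sqrt (c q x (s x) a b)) \<longlongrightarrow> 0) G" for x
  proof -
    have "((\<lambda>q. if a = g x b then 0 else sqrt (c q x (s x) a b)) \<longlongrightarrow> 0) G" for a b
      using tendsto_real_sqrt[OF Gc[of x "s x" a b]] g[of a x b] by (cases "a = g x b") simp_all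
    then show ?thesis by (intro tendsto_null_sum)
  qed
  have lim2: "((\<lambda>q. \<Sum>b\<in>UNIV. \<Sum>a\<in>UNIV. if b = h y a then 0 else sqrt (c q (t y) y a b)) \<longlongrightarrow> 0) G" for y
  proof -
    have "((\<lambda>q. if b = h y a then 0 else sqrt (c q (t y) y a b)) \<longlongrightarrow> 0) G" for a b
      using tendsto_real_sqrt[OF Gc[of "t y" y a b]] h[of b y a] by (cases "b = h y a") simp_all
    then show ?thesis by (intro tendsto_null_sum)
  qed
  have "((\<lambda>q. defect (F q) (\<Omega> q) (free_gen x a)) \<longlongrightarrow> 0) G" for x a
  proof (rule tendsto_sandwich[OF _ _ tendsto_const lim1[of x]])
    show "\<forall>\<^sub>F q in G. 0 \<le> defect (F q) (\<Omega> q) (free_gen x a)" by (simp add: defect_def)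
  qed (intro always_eventually allI first)
  then have def0: "((\<lambda>q. defect (F q) (\<Omega> q) w) \<longlongrightarrow> 0) G" for w
    by (rule defect_tendsto_zero[OF rep \<Omega>])
  have same_limit: "l = l'" if "\<And>q. cmod (f q - f' q) \<le> e q" "(e \<longlongrightarrow> 0) G" "(f \<longlongrightarrow> l) G" "(f' \<longlongrightarrow> l') G" for f f' e l l'
  proof -
    have "((\<lambda>q. f q - f' q) \<longlongrightarrow> 0) G"
      by (rule Lim_null_comparison[OF _ that(2)]) (simp add: that(1))
    then have "l - l' = 0" by (rule tendsto_unique[OF G(1) tendsto_diff[OF that(3,4)]])
    then show ?thesis by simp
  qed
  define \<tau> where "\<tau> z = \<psi> (z \<otimes>\<^sub>T opp 1)" for z
  have \<psi>_lin: "clinear \<psi>" by (rule clinear_limit[OF G(1) \<psi> \<phi>_lin])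
  have \<tau>_lin: "clinear \<tau>"
    by (simp add: clinear_def \<tau>_def clinear_add[OF clinear_tensor_prod_left] clinear_scaleC[OF clinear_tensor_prod_left]
        clinear_add[OF \<psi>_lin] clinear_scaleC[OF \<psi>_lin])
  have right: "\<psi> (z \<otimes>\<^sub>T opp w) = \<tau> (z * w)" for z w
    unfolding \<tau>_def
    by (rule same_limit[OF _ _ \<psi> \<psi>, of _ _ "\<lambda>q. norm z * defect (F q) (\<Omega> q) w"])
      (auto simp: \<phi>_def intro: form_right_to_left[OF rep \<Omega>] tendsto_mult_right_zero[OF def0])
  have comm: "\<tau> (w * z) = \<psi> (z \<otimes>\<^sub>T opp w)" for z w
    unfolding \<tau>_def
    by (rule same_limit[OF _ _ \<psi> \<psi>, of _ _ "\<lambda>q. norm z * defect (F q) (\<Omega> q) (star w)"])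
      (auto simp: \<phi>_def intro: form_commute[OF rep \<Omega>] tendsto_mult_right_zero[OF def0])
  have pos: "\<tau> (star z * z) \<in> \<real>\<^sub>\<ge>\<^sub>0" for z
  proof (rule Lim_in_closed_set[OF closed_nonneg_Reals_complex _ G(1)])
    show "((\<lambda>q. \<phi> q ((star z * z) \<otimes>\<^sub>T opp 1)) \<longlongrightarrow> \<tau> (star z * z)) G" unfolding \<tau>_def by (rule \<psi>)
    show "\<forall>\<^sub>F q in G. \<phi> q ((star z * z) \<otimes>\<^sub>T opp 1) \<in> \<real>\<^sub>\<ge>\<^sub>0"
      unfolding \<phi>_def by (intro always_eventually allI form_positive[OF rep \<Omega>])
  qed
  have "cmod (\<psi> u) \<le> 1 * min_tensor_norm u" for u
    using tendsto_upperbound[OF tendsto_norm[OF \<psi>] _ G(1)] \<phi>_le by simp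
  then have "amenable_trace \<tau>"
    unfolding amenable_trace_def is_trace_def
    using \<tau>_lin pos right comm \<psi>_lin by metis
  moreover have "complex_of_real (p x y a b) = \<tau> (free_gen x a * (\<Sum>a' | h y a' = b. free_gen (t y) a'))" for x y a b
    unfolding \<tau>_def
    by (rule same_limit[OF _ lim2[of y] tendsto_of_real[OF Gc] \<psi>])
      (use second in \<open>simp add: \<phi>_def norm_minus_commute\<close>)
  ultimately show ?thesis by (rule that)
qed

section \<open>Perfect strategies of mirror games\<close>

lemma alg_pvm_free_gen: "alg_pvm free_gen"
  by (simp add: alg_pvm_def star_free_gen free_gen_mult sum_free_gen)

lemma alg_pvm_hom:
  assumes e: "alg_pvm e" and \<rho>: "unital_star_hom \<rho>"
  shows "alg_pvm (\<lambda>x a. \<rho> (e x a))"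
proof -
  have lin: "clinear \<rho>" and mult: "\<And>u v. \<rho> (u * v) = \<rho> u * \<rho> v" and star: "\<And>u. \<rho> (star u) = star (\<rho> u)" and one: "\<rho> 1 = 1"
    using \<rho> by (auto simp: unital_star_hom_def)
  show ?thesis
    unfolding alg_pvm_def
  proof (intro conjI allI)
    fix x a a'
    show "star (\<rho> (e x a)) = \<rho> (e x a)" unfolding star[symmetric] alg_pvmD(1)[OF e] ..
    show "\<rho> (e x a) * \<rho> (e x a') = (if a = a' then \<rho> (e x a) else 0)"
      unfolding mult[symmetric] alg_pvmD(2)[OF e] by (simp add: clinear_zero[OF lin])
    show "(\<Sum>a\<in>UNIV. \<rho> (e x a)) = 1"
      using clinear_sum[OF lin, of "e x" UNIV] by (simp add: alg_pvmD(3)[OF e] one)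
  qed
qed

lemma alg_pvm_coarse:
  assumes e: "alg_pvm e"
  shows "alg_pvm (\<lambda>y b. \<Sum>a | h y a = b. e (t y) a)"
  unfolding alg_pvm_def
proof (intro conjI allI)
  fix y b b'
  show "star (\<Sum>a | h y a = b. e (t y) a) = (\<Sum>a | h y a = b. e (t y) a)"
    by (simp add: star_sum alg_pvmD[OF e])
  have "(\<Sum>a | h y a = b. e (t y) a) * (\<Sum>a | h y a = b'. e (t y) a) =
      (\<Sum>a | h y a = b. \<Sum>a' | h y a' = b'. if a = a' then e (t y) a else 0)"
    by (simp add: sum_product alg_pvmD[OF e])
  also have "\<dots> = (\<Sum>a | h y a = b. if b = b' then e (t y) a else 0)"
    by (intro sum.cong refl) auto
  finally show "(\<Sum>a | h y a = b. e (t y) a) * (\<Sum>a | h y a = b'. e (t y) a) =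
      (if b = b' then \<Sum>a | h y a = b. e (t y) a else 0)" by simp
  show "(\<Sum>b\<in>UNIV. \<Sum>a | h y a = b. e (t y) a) = 1"
    using sum.group[of UNIV UNIV "h y" "e (t y)"] alg_pvmD(3)[OF e] by simp
qed

theorem theorem6p4:
  fixes lam :: "'x::finite \<Rightarrow> 'y::finite \<Rightarrow> 'a::finite \<Rightarrow> 'b::finite \<Rightarrow> bool"
    and p :: "('x, 'y, 'a, 'b) correlation"
  assumes "mirror_game lam"
    and "p \<in> perfect_for lam C_ns"
  shows "p \<in> perfect_for lam C_qa \<longleftrightarrow>
    (\<exists>(\<tau> :: ('x, 'a) free_cstar \<Rightarrow> complex) (\<rho> :: ('y, 'b) free_cstar \<Rightarrow> ('x, 'a) free_cstar).
       amenable_trace \<tau> \<and> unital_star_hom \<rho> \<and> \<rho> ` gen_span \<subseteq> gen_span \<and>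
       (\<forall>x y a b. complex_of_real (p x y a b) = \<tau> (free_gen x a * \<rho> (free_gen y b))))"
proof
  obtain s :: "'x \<Rightarrow> 'y" and t :: "'y \<Rightarrow> 'x"
    where s0: "\<forall>x b a a'. a \<noteq> a' \<longrightarrow> \<not> (lam x (s x) a b \<and> lam x (s x) a' b)"
      and t0: "\<forall>y a b b'. b \<noteq> b' \<longrightarrow> \<not> (lam (t y) y a b \<and> lam (t y) y a b')"
    using assms(1) unfolding mirror_game_def by (elim exE conjE)
  have s: "a = a'" if "lam x (s x) a b" "lam x (s x) a' b" for x b a a' using s0 that by blast
  have t: "b = b'" if "lam (t y) y a b" "lam (t y) y a b'" for y a b b' using t0 that by blast
  have p0: "p x y a b = 0" if "\<not> lam x y a b" for x y a b
    using assms(2) that by (simp add: perfect_for_def)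
  \<comment> \<open>On answers that the rule excludes altogether, these functions take arbitrary values; such answers have
    probability zero.\<close>
  define g where "g x b = (SOME a. lam x (s x) a b)" for x b
  define h where "h y a = (SOME b. lam (t y) y a b)" for y a
  have g: "p x (s x) a b = 0" if "a \<noteq> g x b" for x a b
    using p0[of x "s x" a b] s[of x a b "g x b"] someI[of "\<lambda>a. lam x (s x) a b" a] that by (auto simp: g_def)
  have h: "p (t y) y a b = 0" if "b \<noteq> h y a" for y a b
    using p0[of "t y" y a b] t[of y a b "h y a"] someI[of "\<lambda>b. lam (t y) y a b" b] that by (auto simp: h_def)
  assume "p \<in> perfect_for lam C_qa"
  then have "p \<in> C_qa" by (simp add: perfect_for_def)
  then obtain \<tau> :: "('x, 'a) free_cstar \<Rightarrow> complex" where \<tau>: "amenable_trace \<tau>"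
    "\<And>x y a b. complex_of_real (p x y a b) = \<tau> (free_gen x a * (\<Sum>a' | h y a' = b. free_gen (t y) a'))"
    by (rule C_qa_imp_amenable_trace[where g = g and h = h and s = s and t = t]) (use g h in blast)+
  define f where "f y b = (\<Sum>a | h y a = b. free_gen (t y) a :: ('x, 'a) free_cstar)" for y b
  have "alg_pvm f" unfolding f_def by (rule alg_pvm_coarse[OF alg_pvm_free_gen])
  then obtain \<rho> :: "('y, 'b) free_cstar \<Rightarrow> ('x, 'a) free_cstar"
    where \<rho>: "unital_star_hom \<rho>" "\<And>y b. \<rho> (free_gen y b) = f y b"
    using free_cstar_universal[of f] alg_pvmD[of f] by blast
  have lin: "clinear \<rho>" using \<rho>(1) by (simp add: unital_star_hom_def)
  have f_span: "f y b \<in> gen_span" for y b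
    unfolding f_def gen_span_def by (intro complex_vector.span_sum complex_vector.span_base) blast
  have "\<rho> z \<in> gen_span" if "z \<in> gen_span" for z
  proof (rule cspan_subset[where P = "\<lambda>z. \<rho> z \<in> gen_span" and S = "{free_gen y b | y b. True}"])
    show "z \<in> cspan {free_gen y b | y b. True}" using that by (simp add: gen_span_def)
    show "{free_gen y b | y b. True} \<subseteq> {z. \<rho> z \<in> gen_span}" using \<rho>(2) f_span by auto
    show "\<rho> 0 \<in> gen_span"
      unfolding gen_span_def clinear_zero[OF lin] by (rule complex_vector.span_zero)
    show "\<rho> (u + v) \<in> gen_span" if "\<rho> u \<in> gen_span" "\<rho> v \<in> gen_span" for u v
      using that unfolding gen_span_def clinear_add[OF lin] by (rule complex_vector.span_add)
    show "\<rho> (c *\<^sub>C u) \<in> gen_span" if "\<rho> u \<in> gen_span" for c u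
      using that unfolding gen_span_def clinear_scaleC[OF lin] by (rule complex_vector.span_scale)
  qed
  then show "\<exists>(\<tau> :: ('x, 'a) free_cstar \<Rightarrow> complex) (\<rho> :: ('y, 'b) free_cstar \<Rightarrow> ('x, 'a) free_cstar).
       amenable_trace \<tau> \<and> unital_star_hom \<rho> \<and> \<rho> ` gen_span \<subseteq> gen_span \<and>
       (\<forall>x y a b. complex_of_real (p x y a b) = \<tau> (free_gen x a * \<rho> (free_gen y b)))"
    using \<tau> \<rho> by (intro exI[of _ \<tau>] exI[of _ \<rho>]) (auto simp: f_def)
next
  assume "\<exists>(\<tau> :: ('x, 'a) free_cstar \<Rightarrow> complex) (\<rho> :: ('y, 'b) free_cstar \<Rightarrow> ('x, 'a) free_cstar).
       amenable_trace \<tau> \<and> unital_star_hom \<rho> \<and> \<rho> ` gen_span \<subseteq> gen_span \<and>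
       (\<forall>x y a b. complex_of_real (p x y a b) = \<tau> (free_gen x a * \<rho> (free_gen y b)))"
  then obtain \<tau> :: "('x, 'a) free_cstar \<Rightarrow> complex" and \<rho> :: "('y, 'b) free_cstar \<Rightarrow> ('x, 'a) free_cstar"
    where \<tau>: "amenable_trace \<tau>" and \<rho>: "unital_star_hom \<rho>"
      and p: "\<And>x y a b. complex_of_real (p x y a b) = \<tau> (free_gen x a * \<rho> (free_gen y b))" by blast
  have "p \<in> C_qa"
    by (rule amenable_trace_imp_C_qa[OF \<tau> alg_pvm_free_gen alg_pvm_hom[OF alg_pvm_free_gen \<rho>] p])
      (use assms(2) in \<open>simp add: perfect_for_def C_ns_def\<close>)
  then show "p \<in> perfect_for lam C_qa" using assms(2) by (simp add: perfect_for_def)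
qed

end
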